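(* Let $L_1,L_2>0$, let $\phi_0\in L^2(\mathbb{T}^2)$ and let $\mathbf{v}\in L^\infty(\mathbb{R}_+;L^2(\mathbb{T}^2))$ be a vector field with $\operatorname{div}\mathbf{v}=0$ in the sense of distributions. There exists $0<T\le 1$, depending on $L_1,L_2$, on $\sup_{t>0}\|\mathbf{v}(t)\|_{L^2}$ and on $\|\phi_0\|_{L^2}$, such that the equation $$\partial_t \phi+\mathbf{v}\cdot\nabla\phi+\tfrac12|\nabla\phi|^2=-\Delta^2\phi-\Delta\phi$$ admits a mild solution $\phi$ on $[0,T]$ with initial data $\phi_0$, which belongs to $\tilde X_T$ and is unique in $\tilde X_T$.
   Context: $\mathbb{T}^2=[0,L_1]\times[0,L_2]$ with periodic boundary conditions. $\mathcal{L}=\Delta^2+\Delta$, and $e^{-t\mathcal{L}}$ is the semigroup it generates on $L^2(\mathbb{T}^2)$, i.e. the Fourier multiplier with symbol $e^{-t(|\tilde{\mathbf k}|^4-|\tilde{\mathbf k}|^2)}$, where $\tilde{\mathbf k}=2\pi(k_1/L_1,k_2/L_2)$, $(k_1,k_2)\in\mathbb{Z}^2$ (for $t>0$ it is also applied to $L^1$ functions through the same formula). A mild solution on $[0,T]$ with initial data $\phi_0\in L^2(\mathbb{T}^2)$ is a function $\phi\in C([0,T];L^2(\mathbb{T}^2))$ with $\nabla\phi$ locally integrable such that, for all $0\le t\le T$, $$\phi(t)=e^{-t\mathcal{L}}\phi_0-\frac12\int_0^t e^{-(t-\tau)\mathcal{L}}|\nabla\phi(\tau)|^2\,d\tau-\int_0^t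 e^{-(t-\tau)\mathcal{L}}(\mathbf{v}(\tau)\cdot\nabla\phi(\tau))\,d\tau$$ in $L^2(\mathbb{T}^2)$, the integrals being Bochner integrals. $\tilde X_T$ is the Banach space of all $\phi\in C([0,T];L^2(\mathbb{T}^2))$ with $\sup_{0<t\le T}t^{1/4}\|\nabla\phi(t)\|_{L^2}<\infty$, with norm $\|\phi\|_{\tilde X_T}=\max\big(\sup_{0\le t\le T}\|\phi(t)\|_{L^2},\ \sup_{0<t\le T}t^{1/4}\|\nabla\phi(t)\|_{L^2}\big)$. *)

theory Defs
  imports "HOL-Analysis.Analysis" "HOL-Probability.Essential_Supremum"
begin

text \<open>
  Bochner integrals in \<open>L\<^sup>2\<close> need a type.  We build \<open>L\<^sup>2(\<real>\<^sup>2; 'b)\<close> as a quotient by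
  almost everywhere equality; \<open>L\<^sup>2\<close> of the torus with side lengths \<open>L1\<close>, \<open>L2\<close> is identified below
  with the closed subspace of classes that vanish outside the period cell \<open>[0,L1] \<times> [0,L2]\<close>.
\<close>

type_synonym plane = "real \<times> real"

definition square_integrable :: "(plane \<Rightarrow> 'b::euclidean_space) \<Rightarrow> bool" where
  "square_integrable f \<longleftrightarrow>
     f \<in> borel_measurable lborel \<and> integrable lborel (\<lambda>x. (norm (f x))\<^sup>2)"

lemma square_integrableD [measurable_dest]:
  "square_integrable f \<Longrightarrow> f \<in> borel_measurable lborel"
  by (simp add: square_integrable_def)

lemma square_integrable_zero [simp]: "square_integrable (\<lambda>x. 0)"
  by (simp add: square_integrable_def)

lemma square_integrable_bound:
  fixes f :: "plane \<Rightarrow> 'b::euclidean_space" and g :: "plane \<Rightarrow> 'c::euclidean_space"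
  assumes "square_integrable g" "f \<in> borel_measurable lborel"
    "AE x in lborel. norm (f x) \<le> norm (g x)"
  shows "square_integrable f"
  unfolding square_integrable_def
proof
  show "integrable lborel (\<lambda>x. (norm (f x))\<^sup>2)"
  proof (rule Bochner_Integration.integrable_bound)
    show "integrable lborel (\<lambda>x. (norm (g x))\<^sup>2)"
      using assms by (simp add: square_integrable_def)
    show "AE x in lborel. norm ((norm (f x))\<^sup>2) \<le> norm ((norm (g x))\<^sup>2)"
      using assms(3) by eventually_elim (auto intro: power_mono)
  qed (use assms in measurable)
qed fact

lemma square_integrable_scaleR:
  assumes "square_integrable f"
  shows "square_integrable (\<lambda>x. c *\<^sub>R f x)"
  using assms by (auto simp: square_integrable_def power_mult_distrib)

lemma square_integrable_add:
  assumes f: "square_integrable f" and g: "square_integrable g"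
  shows "square_integrable (\<lambda>x. f x + g x)"
  unfolding square_integrable_def
proof
  note [measurable] = f[THEN square_integrableD] g[THEN square_integrableD]
  show "(\<lambda>x. f x + g x) \<in> borel_measurable lborel"
    by measurable
  show "integrable lborel (\<lambda>x. (norm (f x + g x))\<^sup>2)"
  proof (rule Bochner_Integration.integrable_bound)
    show "integrable lborel (\<lambda>x. 2 * (norm (f x))\<^sup>2 + 2 * (norm (g x))\<^sup>2)"
      using f g by (simp add: square_integrable_def)
    have "(norm (f x + g x))\<^sup>2 \<le> 2 * (norm (f x))\<^sup>2 + 2 * (norm (g x))\<^sup>2" for x
    proof -
      have "(norm (f x + g x))\<^sup>2 \<le> (norm (f x) + norm (g x))\<^sup>2"
        by (intro power_mono norm_triangle_ineq) auto
      also have "\<dots> \<le> 2 * (norm (f x))\<^sup>2 + 2 * (norm (g x))\<^sup>2"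
        using zero_le_power2[of "norm (f x) - norm (g x)"]
        by (simp add: power2_eq_square algebra_simps)
      finally show ?thesis .
    qed
    then show "AE x in lborel. norm ((norm (f x + g x))\<^sup>2) \<le> norm (2 * (norm (f x))\<^sup>2 + 2 * (norm (g x))\<^sup>2)"
      by (auto intro!: always_eventually)
  qed measurable
qed

lemma square_integrable_diff:
  assumes "square_integrable f" "square_integrable g"
  shows "square_integrable (\<lambda>x. f x - g x)"
  using square_integrable_add[OF assms(1) square_integrable_scaleR[OF assms(2), of "-1"]] by simp

lemma integrable_inner_square_integrable:
  assumes f: "square_integrable f" and g: "square_integrable g"
  shows "integrable lborel (\<lambda>x. f x \<bullet> g x)"
proof (rule Bochner_Integration.integrable_bound)
  note [measurable] = f[THEN square_integrableD] g[THEN square_integrableD]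
  show "(\<lambda>x. f x \<bullet> g x) \<in> borel_measurable lborel"
    by measurable
  show "integrable lborel (\<lambda>x. (norm (f x))\<^sup>2 + (norm (g x))\<^sup>2)"
    using f g by (simp add: square_integrable_def)
  have "\<bar>f x \<bullet> g x\<bar> \<le> (norm (f x))\<^sup>2 + (norm (g x))\<^sup>2" for x
    using Cauchy_Schwarz_ineq2[of "f x" "g x"] zero_le_power2[of "norm (f x) - norm (g x)"]
      mult_nonneg_nonneg[of "norm (f x)" "norm (g x)"]
    by (simp add: power2_eq_square algebra_simps)
  then show "AE x in lborel. norm (f x \<bullet> g x) \<le> norm ((norm (f x))\<^sup>2 + (norm (g x))\<^sup>2)"
    by (auto intro!: always_eventually)
qed

quotient_type (overloaded) 'b L2 = "plane \<Rightarrow> 'b::euclidean_space" / partial: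
  "\<lambda>f g. square_integrable f \<and> square_integrable g \<and> (AE x in lborel. f x = g x)"
  morphisms rep_L2 abs_L2
proof (rule part_equivpI)
  show "\<exists>f::plane \<Rightarrow> 'b. square_integrable f \<and> square_integrable f \<and> (AE x in lborel. f x = f x)"
    by (rule exI[of _ "\<lambda>x. 0"]) simp
  show "symp (\<lambda>(f::plane \<Rightarrow> 'b) g. square_integrable f \<and> square_integrable g \<and> (AE x in lborel. f x = g x))"
    by (auto intro!: sympI elim: eventually_mono)
  show "transp (\<lambda>(f::plane \<Rightarrow> 'b) g. square_integrable f \<and> square_integrable g \<and> (AE x in lborel. f x = g x))"
  proof (rule transpI, elim conjE, intro conjI)
    fix f g h :: "plane \<Rightarrow> 'b"
    assume "AE x in lborel. f x = g x" "AE x in lborel. g x = h x"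
    then show "AE x in lborel. f x = h x"
      by eventually_elim simp
  qed
qed

instantiation L2 :: (euclidean_space) real_inner
begin

lift_definition zero_L2 :: "'a L2" is "\<lambda>x. 0"
  by simp

lift_definition plus_L2 :: "'a L2 \<Rightarrow> 'a L2 \<Rightarrow> 'a L2" is "\<lambda>f g x. f x + g x"
  by (auto intro: square_integrable_add elim: eventually_elim2)

lift_definition minus_L2 :: "'a L2 \<Rightarrow> 'a L2 \<Rightarrow> 'a L2" is "\<lambda>f g x. f x - g x"
  by (auto intro: square_integrable_diff elim: eventually_elim2)

lift_definition scaleR_L2 :: "real \<Rightarrow> 'a L2 \<Rightarrow> 'a L2" is "\<lambda>c f x. c *\<^sub>R f x"
  by (auto intro: square_integrable_scaleR elim: eventually_mono)

lift_definition inner_L2 :: "'a L2 \<Rightarrow> 'a L2 \<Rightarrow> real" is "\<lambda>f g. LINT x|lborel. f x \<bullet> g x"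
proof -
  fix f f' g g' :: "plane \<Rightarrow> 'a"
  assume 1: "square_integrable f \<and> square_integrable f' \<and> (AE x in lborel. f x = f' x)"
    and 2: "square_integrable g \<and> square_integrable g' \<and> (AE x in lborel. g x = g' x)"
  note [measurable] = 1[THEN conjunct1, THEN square_integrableD] 2[THEN conjunct1, THEN square_integrableD]
   1[THEN conjunct2, THEN conjunct1, THEN square_integrableD] 2[THEN conjunct2, THEN conjunct1, THEN square_integrableD]
  show "(LINT x|lborel. f x \<bullet> g x) = (LINT x|lborel. f' x \<bullet> g' x)"
  proof (rule integral_cong_AE)
    have "AE x in lborel. f x = f' x" "AE x in lborel. g x = g' x" using 1 2 by auto
    then show "AE x in lborel. f x \<bullet> g x = f' x \<bullet> g' x"
      by eventually_elim simp
  qed measurable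
qed

definition uminus_L2 :: "'a L2 \<Rightarrow> 'a L2" where "uminus_L2 f = (-1) *\<^sub>R f"
definition norm_L2 :: "'a L2 \<Rightarrow> real" where "norm_L2 f = sqrt (f \<bullet> f)"
definition dist_L2 :: "'a L2 \<Rightarrow> 'a L2 \<Rightarrow> real" where "dist_L2 f g = norm (f - g)"
definition sgn_L2 :: "'a L2 \<Rightarrow> 'a L2" where "sgn_L2 f = inverse (norm f) *\<^sub>R f"
definition uniformity_L2 :: "('a L2 \<times> 'a L2) filter" where
  "uniformity_L2 = (INF e\<in>{0<..}. principal {(f, g). dist f g < e})"
definition open_L2 :: "'a L2 set \<Rightarrow> bool" where
  "open_L2 U \<longleftrightarrow> (\<forall>f\<in>U. eventually (\<lambda>(f', g). f' = f \<longrightarrow> g \<in> U) uniformity)"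

instance
proof
  fix f g h :: "'a L2" and a b :: real
  show "f + g + h = f + (g + h)" "f + g = g + f" "0 + f = f"
    by (transfer; auto simp: algebra_simps intro!: square_integrable_add)+
  show "- f + f = 0" "f - g = f + - g"
    unfolding uminus_L2_def
    by (transfer; auto simp: algebra_simps intro!: square_integrable_add square_integrable_diff square_integrable_scaleR)+
  show "a *\<^sub>R (f + g) = a *\<^sub>R f + a *\<^sub>R g" "(a + b) *\<^sub>R f = a *\<^sub>R f + b *\<^sub>R f"
    "a *\<^sub>R b *\<^sub>R f = (a * b) *\<^sub>R f" "1 *\<^sub>R f = f"
    by (transfer; auto simp: algebra_simps intro!: square_integrable_add square_integrable_scaleR;
      use square_integrable_add square_integrable_scaleR in fastforce)+
  show "f \<bullet> g = g \<bullet> f"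
    by transfer (simp add: inner_commute)
  show "(f + g) \<bullet> h = f \<bullet> h + g \<bullet> h"
    by transfer (auto simp: inner_add_left integrable_inner_square_integrable intro!: Bochner_Integration.integral_add)
  show "(a *\<^sub>R f) \<bullet> g = a * (f \<bullet> g)"
    by transfer auto
  show "0 \<le> f \<bullet> f"
    by transfer auto
  show "f \<bullet> f = 0 \<longleftrightarrow> f = 0"
  proof transfer
    fix f :: "plane \<Rightarrow> 'a"
    assume f: "square_integrable f \<and> square_integrable f \<and> (AE x in lborel. f x = f x)"
    then have "(LINT x|lborel. f x \<bullet> f x) = 0 \<longleftrightarrow> (AE x in lborel. f x \<bullet> f x = 0)"
      by (intro integral_nonneg_eq_0_iff_AE integrable_inner_square_integrable) auto
    with f show "(LINT x|lborel. f x \<bullet> f x) = 0 \<longleftrightarrow>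
      square_integrable f \<and> square_integrable (\<lambda>x. 0::'a) \<and> (AE x in lborel. f x = 0)"
      by simp
  qed
qed (auto simp: norm_L2_def dist_L2_def sgn_L2_def uniformity_L2_def open_L2_def)

end

lemma square_integrable_rep_L2 [simp]: "square_integrable (rep_L2 u)"
  using Quotient_rep_reflp[OF Quotient_L2] by blast

lemma abs_L2_rep_L2 [simp]: "abs_L2 (rep_L2 u) = u"
  using Quotient_abs_rep[OF Quotient_L2] .

lemma abs_L2_eq_iff:
  assumes "square_integrable f" "square_integrable g"
  shows "abs_L2 f = abs_L2 g \<longleftrightarrow> (AE x in lborel. f x = g x)"
  using Quotient_rel[OF Quotient_L2, of f g] assms by auto

lemma rep_L2_abs_L2:
  assumes "square_integrable f"
  shows "AE x in lborel. rep_L2 (abs_L2 f) x = f x"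
  using abs_L2_eq_iff[of "rep_L2 (abs_L2 f)" f] assms by simp

lemma abs_L2_diff:
  assumes "square_integrable f" "square_integrable g"
  shows "abs_L2 f - abs_L2 g = abs_L2 (\<lambda>x. f x - g x)"
  using assms by (intro minus_L2.abs_eq) auto

lemma abs_L2_add:
  assumes "square_integrable f" "square_integrable g"
  shows "abs_L2 f + abs_L2 g = abs_L2 (\<lambda>x. f x + g x)"
  using assms by (intro plus_L2.abs_eq) auto

lemma abs_L2_scaleR:
  assumes "square_integrable f"
  shows "c *\<^sub>R abs_L2 f = abs_L2 (\<lambda>x. c *\<^sub>R f x)"
  using assms by (intro scaleR_L2.abs_eq) auto

lemma abs_L2_zero: "abs_L2 (\<lambda>x. 0) = 0"
  by (simp add: zero_L2.abs_eq)

lemma norm_abs_L2: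
  assumes "square_integrable f"
  shows "norm (abs_L2 f) = sqrt (LINT x|lborel. (norm (f x))\<^sup>2)"
  using assms inner_L2.abs_eq[of f f] by (simp add: norm_L2_def power2_norm_eq_inner)

lemma abs_L2_sum:
  assumes "finite I" "\<And>i. i \<in> I \<Longrightarrow> square_integrable (f i)"
  shows "square_integrable (\<lambda>x. \<Sum>i\<in>I. f i x) \<and> abs_L2 (\<lambda>x. \<Sum>i\<in>I. f i x) = (\<Sum>i\<in>I. abs_L2 (f i))"
  using assms
proof (induction I rule: finite_induct)
  case empty
  then show ?case by (simp add: abs_L2_zero)
next
  case (insert i I)
  then show ?case
    by (auto simp: square_integrable_add abs_L2_add[symmetric])
qed

lemma tendsto_abs_L2:
  fixes f :: "nat \<Rightarrow> plane \<Rightarrow> 'b::euclidean_space" and w :: "plane \<Rightarrow> 'c::euclidean_space"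
  assumes w: "square_integrable w"
    and f: "\<And>n. f n \<in> borel_measurable lborel" and g: "g \<in> borel_measurable lborel"
    and bound: "\<And>n. AE x in lborel. norm (f n x) \<le> norm (w x)"
    and lim: "AE x in lborel. (\<lambda>n. f n x) \<longlonglongrightarrow> g x"
  shows "(\<lambda>n. abs_L2 (f n)) \<longlonglongrightarrow> abs_L2 g"
proof -
  note [measurable] = f g
  have bound': "AE x in lborel. \<forall>n. norm (f n x) \<le> norm (w x)"
    using bound by (simp add: AE_all_countable)
  have bg: "AE x in lborel. norm (g x) \<le> norm (w x)"
    using bound' lim
  proof eventually_elim
    case (elim x)
    then show ?case
      by (intro Lim_bounded[OF tendsto_norm]) auto
  qed
  have sf: "square_integrable (f n)" for n
    by (rule square_integrable_bound[OF w f bound])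
  have sg: "square_integrable g"
    by (rule square_integrable_bound[OF w g bg])
  have "(\<lambda>n. LINT x|lborel. (norm (f n x - g x))\<^sup>2) \<longlonglongrightarrow> (LINT x|(lborel :: plane measure). (0::real))"
  proof (rule integral_dominated_convergence)
    show "integrable lborel (\<lambda>x. 4 * (norm (w x))\<^sup>2)"
      using w by (simp add: square_integrable_def)
    show "AE x in lborel. (\<lambda>n. (norm (f n x - g x))\<^sup>2) \<longlonglongrightarrow> 0"
      using lim
    proof eventually_elim
      case (elim x)
      then have "(\<lambda>n. (norm (f n x - g x))\<^sup>2) \<longlonglongrightarrow> (norm (g x - g x))\<^sup>2"
        by (intro tendsto_intros)
      then show ?case by simp
    qed
    show "AE x in lborel. norm ((norm (f n x - g x))\<^sup>2) \<le> 4 * (norm (w x))\<^sup>2" for n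
      using bound[of n] bg
    proof eventually_elim
      case (elim x)
      then have "(norm (f n x - g x))\<^sup>2 \<le> (2 * norm (w x))\<^sup>2"
        using norm_triangle_ineq4[of "f n x" "g x"] by (intro power_mono) auto
      then show ?case by (simp add: power_mult_distrib)
    qed
  qed measurable
  then have "(\<lambda>n. sqrt (LINT x|lborel. (norm (f n x - g x))\<^sup>2)) \<longlonglongrightarrow> sqrt 0"
    by (intro tendsto_real_sqrt) simp
  then have "(\<lambda>n. norm (abs_L2 (f n) - abs_L2 g)) \<longlonglongrightarrow> 0"
    by (simp add: abs_L2_diff[OF sf sg] norm_abs_L2[OF square_integrable_diff[OF sf sg]])
  then show ?thesis
    by (rule LIM_zero_cancel[OF tendsto_norm_zero_cancel])
qed

instance L2 :: (euclidean_space) banach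
proof
  fix X :: "nat \<Rightarrow> 'a L2"
  assume X: "Cauchy X"
  define f where "f n = rep_L2 (X n)" for n
  have f: "square_integrable (f n)" and X_eq: "X n = abs_L2 (f n)" for n
    by (simp_all add: f_def)
  note [measurable] = f[THEN square_integrableD]
  obtain h :: "plane \<Rightarrow> real" where h [measurable]: "h \<in> borel_measurable lborel"
    and h_pos: "\<And>x. 0 < h x" and "\<And>x. h x \<le> 1" and h_int: "integrable lborel h"
    by (rule sigma_finite_measure.obtain_positive_integrable_function[OF sigma_finite_lborel]) (rule that)
  define w where "w x = sqrt (h x)" for x
  have "w \<in> borel_measurable lborel"
    unfolding w_def by measurable
  moreover have "(\<lambda>x. (norm (w x))\<^sup>2) = h"
    using less_imp_le[OF h_pos] by (simp add: w_def fun_eq_iff)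
  ultimately have w: "square_integrable w"
    using h_int by (simp add: square_integrable_def)
  have w_pos: "0 < w x" for x
    using h_pos by (simp add: w_def)
  have w_abs: "\<bar>w x\<bar> = w x" for x
    using w_pos[of x] by simp
  have w_int: "integrable lborel (\<lambda>x. w x * norm (g x))" and
    w_le: "(LINT x|lborel. w x * norm (g x)) \<le> norm (abs_L2 w) * norm (abs_L2 g)"
    if "square_integrable g" for g :: "plane \<Rightarrow> 'a"
  proof -
    have n: "square_integrable (\<lambda>x. norm (g x))"
      using square_integrableD[OF that] by (intro square_integrable_bound[OF that]) auto
    show "integrable lborel (\<lambda>x. w x * norm (g x))"
      using integrable_inner_square_integrable[OF w n] by simp
    have "(LINT x|lborel. w x * norm (g x)) = abs_L2 w \<bullet> abs_L2 (\<lambda>x. norm (g x))"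
      using inner_L2.abs_eq[of w "\<lambda>x. norm (g x)"] w n by simp
    also have "\<dots> \<le> norm (abs_L2 w) * norm (abs_L2 (\<lambda>x. norm (g x)))"
      by (rule norm_cauchy_schwarz)
    finally show "(LINT x|lborel. w x * norm (g x)) \<le> norm (abs_L2 w) * norm (abs_L2 g)"
      by (simp add: norm_abs_L2 n that)
  qed
  note [measurable] = w[THEN square_integrableD]
  obtain r where r: "strict_mono r" and r_AE: "AE x in lborel. Cauchy (\<lambda>i. w x *\<^sub>R f (r i) x)"
  proof (rule cauchy_L1_AE_cauchy_subseq[of lborel "\<lambda>n x. w x *\<^sub>R f n x"])
    show "integrable lborel (\<lambda>x. w x *\<^sub>R f n x)" for n
      by (rule integrable_norm_cancel) (use w_int[OF f, of n] in \<open>simp_all add: w_abs\<close>)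
    fix e :: real
    assume "0 < e"
    then have pos: "0 < e / (norm (abs_L2 w) + 1)"
      by (simp add: add_nonneg_pos)
    then obtain N where N: "\<And>i j. i \<ge> N \<Longrightarrow> j \<ge> N \<Longrightarrow> norm (X i - X j) < e / (norm (abs_L2 w) + 1)"
      using CauchyD[OF X pos] by blast
    show "\<exists>N. \<forall>i\<ge>N. \<forall>j\<ge>N. (LINT x|lborel. norm (w x *\<^sub>R f i x - w x *\<^sub>R f j x)) < e"
    proof (intro exI[of _ N] allI impI)
      fix i j assume ij: "N \<le> i" "N \<le> j"
      have "(LINT x|lborel. norm (w x *\<^sub>R f i x - w x *\<^sub>R f j x)) = (LINT x|lborel. w x * norm (f i x - f j x))"
        by (simp only: scaleR_diff_right[symmetric] norm_scaleR w_abs)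
      also have "\<dots> \<le> norm (abs_L2 w) * norm (X i - X j)"
        using w_le[OF square_integrable_diff[OF f f]] by (simp add: X_eq abs_L2_diff f)
      also have "\<dots> \<le> (norm (abs_L2 w) + 1) * norm (X i - X j)"
        by (intro mult_right_mono) auto
      also have "\<dots> < (norm (abs_L2 w) + 1) * (e / (norm (abs_L2 w) + 1))"
        by (intro mult_strict_left_mono N ij) (simp add: add_nonneg_pos)
      also have "\<dots> = e"
        using add_nonneg_pos[OF norm_ge_zero[of "abs_L2 w"] zero_less_one] by simp
      finally show "(LINT x|lborel. norm (w x *\<^sub>R f i x - w x *\<^sub>R f j x)) < e" .
    qed
  qed
  from r_AE have conv: "AE x in lborel. convergent (\<lambda>i. f (r i) x)"
  proof eventually_elim
    case (elim x)
    then have "convergent (\<lambda>i. inverse (w x) *\<^sub>R (w x *\<^sub>R f (r i) x))"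
      by (intro bounded_linear.convergent[OF bounded_linear_scaleR_right] Cauchy_convergent)
    then show ?case using w_pos[of x] by simp
  qed
  define g where "g x = lim (\<lambda>i. f (r i) x)" for x
  have g [measurable]: "g \<in> borel_measurable lborel"
    unfolding g_def by (rule borel_measurable_lim_metric) measurable
  have lim: "AE x in lborel. (\<lambda>i. f (r i) x) \<longlonglongrightarrow> g x"
    using conv by eventually_elim (simp add: g_def convergent_LIMSEQ_iff)
  have close: "square_integrable (\<lambda>x. f n x - g x) \<and> norm (abs_L2 (\<lambda>x. f n x - g x)) \<le> e"
    if e: "0 < e" and N: "\<And>i j. i \<ge> N \<Longrightarrow> j \<ge> N \<Longrightarrow> norm (X i - X j) < e" and "N \<le> n" for e N n
  proof -
    have "(\<integral>\<^sup>+x. ennreal ((norm (f n x - g x))\<^sup>2) \<partial>lborel)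
      = (\<integral>\<^sup>+x. liminf (\<lambda>i. ennreal ((norm (f n x - f (r i) x))\<^sup>2)) \<partial>lborel)"
    proof (rule nn_integral_cong_AE)
      show "AE x in lborel. ennreal ((norm (f n x - g x))\<^sup>2) = liminf (\<lambda>i. ennreal ((norm (f n x - f (r i) x))\<^sup>2))"
        using lim
      proof eventually_elim
        case (elim x)
        then have "(\<lambda>i. ennreal ((norm (f n x - f (r i) x))\<^sup>2)) \<longlonglongrightarrow> ennreal ((norm (f n x - g x))\<^sup>2)"
          by (intro tendsto_intros) auto
        then show ?case by (intro sym[OF lim_imp_Liminf]) simp_all
      qed
    qed
    also have "\<dots> \<le> liminf (\<lambda>i. \<integral>\<^sup>+x. ennreal ((norm (f n x - f (r i) x))\<^sup>2) \<partial>lborel)"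
      by (rule nn_integral_liminf) measurable
    also have "\<dots> \<le> liminf (\<lambda>i. ennreal (e\<^sup>2))"
    proof (rule Liminf_mono, rule eventually_sequentiallyI[of N])
      fix i assume i: "N \<le> i"
      then have "N \<le> r i"
        using seq_suble[OF r, of i] by simp
      have d: "square_integrable (\<lambda>x. f n x - f (r i) x)"
        by (intro square_integrable_diff f)
      have "(\<integral>\<^sup>+x. ennreal ((norm (f n x - f (r i) x))\<^sup>2) \<partial>lborel) = ennreal (LINT x|lborel. (norm (f n x - f (r i) x))\<^sup>2)"
        by (rule nn_integral_eq_integral) (use d in \<open>auto simp: square_integrable_def\<close>)
      also have "(LINT x|lborel. (norm (f n x - f (r i) x))\<^sup>2) = (norm (X n - X (r i)))\<^sup>2"
        by (simp add: X_eq abs_L2_diff f norm_abs_L2 d)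
      also have "ennreal \<dots> \<le> ennreal (e\<^sup>2)"
        by (intro ennreal_leI power_mono less_imp_le[OF N]) (use \<open>N \<le> n\<close> \<open>N \<le> r i\<close> in auto)
      finally show "(\<integral>\<^sup>+x. ennreal ((norm (f n x - f (r i) x))\<^sup>2) \<partial>lborel) \<le> ennreal (e\<^sup>2)" .
    qed
    also have "\<dots> = ennreal (e\<^sup>2)"
      by (simp add: Liminf_const)
    finally have le: "(\<integral>\<^sup>+x. ennreal ((norm (f n x - g x))\<^sup>2) \<partial>lborel) \<le> ennreal (e\<^sup>2)" .
    have int: "integrable lborel (\<lambda>x. (norm (f n x - g x))\<^sup>2)"
    proof (rule integrableI_bounded)
      show "(\<integral>\<^sup>+x. ennreal (norm ((norm (f n x - g x))\<^sup>2)) \<partial>lborel) < \<infinity>"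
        using le_less_trans[OF le ennreal_less_top] by simp
    qed measurable
    then have sq: "square_integrable (\<lambda>x. f n x - g x)"
      by (simp add: square_integrable_def)
    have "(LINT x|lborel. (norm (f n x - g x))\<^sup>2) \<le> e\<^sup>2"
      using le by (simp add: nn_integral_eq_integral[OF int])
    then have "norm (abs_L2 (\<lambda>x. f n x - g x)) \<le> e"
      using e by (simp add: norm_abs_L2[OF sq] real_le_lsqrt)
    with sq show ?thesis by simp
  qed
  obtain M where "\<And>i j. i \<ge> M \<Longrightarrow> j \<ge> M \<Longrightarrow> norm (X i - X j) < 1"
    using CauchyD[OF X, of 1] by auto
  from close[OF _ this, of M] have "square_integrable (\<lambda>x. f M x - g x)"
    by simp
  from square_integrable_diff[OF f[of M] this] have sg: "square_integrable g"
    by simp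
  have "X \<longlonglongrightarrow> abs_L2 g"
  proof (rule LIMSEQ_I)
    fix e :: real assume e: "0 < e"
    then obtain N where "\<And>i j. i \<ge> N \<Longrightarrow> j \<ge> N \<Longrightarrow> norm (X i - X j) < e / 2"
      using CauchyD[OF X, of "e / 2"] by auto
    from close[OF _ this] have "norm (X n - abs_L2 g) \<le> e / 2" if "N \<le> n" for n
      using e that by (simp add: X_eq abs_L2_diff f sg)
    moreover have "e / 2 < e"
      using e by simp
    ultimately have "norm (X n - abs_L2 g) < e" if "N \<le> n" for n
      using that le_less_trans by blast
    then show "\<exists>N. \<forall>n\<ge>N. norm (X n - abs_L2 g) < e"
      by blast
  qed
  then show "convergent X"
    by (rule convergentI)
qed

lemma countable_dense_in_closed_span:
  fixes S :: "'a::real_normed_vector set"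
  assumes "countable S"
  shows "\<exists>D. countable D \<and> subspace (closure D) \<and> S \<subseteq> closure D"
proof -
  define comb :: "(rat \<times> 'a) list \<Rightarrow> 'a" where
    "comb l = sum_list (map (\<lambda>(q, s). of_rat q *\<^sub>R s) l)" for l
  define D where "D = comb ` lists (UNIV \<times> S)"
  have "countable D"
    unfolding D_def using assms by (intro countable_image countable_lists) auto
  have D_add: "x + y \<in> D" if xy: "x \<in> D" "y \<in> D" for x y
  proof -
    obtain l k where "l \<in> lists (UNIV \<times> S)" "x = comb l" "k \<in> lists (UNIV \<times> S)" "y = comb k"
      using xy by (auto simp: D_def)
    then show ?thesis
      unfolding D_def by (intro image_eqI[of _ _ "l @ k"]) (auto simp: comb_def)
  qed
  have D_scale: "of_rat q *\<^sub>R x \<in> D" if x: "x \<in> D" for x and q :: rat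
  proof -
    obtain l where l: "l \<in> lists (UNIV \<times> S)" "x = comb l"
      using x by (auto simp: D_def)
    have "of_rat q *\<^sub>R comb l = comb (map (\<lambda>(p, s). (q * p, s)) l)"
      by (induction l) (auto simp: comb_def scaleR_add_right of_rat_mult)
    with l show ?thesis
      unfolding D_def by (intro image_eqI[of _ _ "map (\<lambda>(p, s). (q * p, s)) l"]) auto
  qed
  have "subspace (closure D)"
    unfolding subspace_def
  proof (intro conjI ballI allI)
    have "comb [] \<in> D"
      unfolding D_def by blast
    then show "0 \<in> closure D"
      using closure_subset by (auto simp: comb_def)
  next
    fix x y assume "x \<in> closure D" "y \<in> closure D"
    then obtain a b where "\<And>n. a n \<in> D" "a \<longlonglongrightarrow> x" "\<And>n. b n \<in> D" "b \<longlonglongrightarrow> y"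
      by (auto simp: closure_sequential)
    then show "x + y \<in> closure D"
      unfolding closure_sequential
      by (intro exI[of _ "\<lambda>n. a n + b n"]) (auto intro!: D_add tendsto_add)
  next
    fix c :: real and x assume "x \<in> closure D"
    then obtain a where a: "\<And>n. a n \<in> D" "a \<longlonglongrightarrow> x"
      by (auto simp: closure_sequential)
    have "c \<in> closure \<rat>"
      by (simp add: Rats_closure_real)
    then obtain q where q: "\<And>n. q n \<in> \<rat>" "q \<longlonglongrightarrow> c"
      by (auto simp: closure_sequential)
    then have "q n *\<^sub>R a n \<in> D" for n
      using D_scale[OF a(1)] by (metis Rats_cases)
    then show "c *\<^sub>R x \<in> closure D"
      unfolding closure_sequential using a q
      by (intro exI[of _ "\<lambda>n. q n *\<^sub>R a n"]) (auto intro!: tendsto_scaleR)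
  qed
  moreover have "S \<subseteq> closure D"
  proof
    fix s assume "s \<in> S"
    then have "comb [(1, s)] \<in> D"
      unfolding D_def by (intro imageI) auto
    then show "s \<in> closure D"
      using closure_subset by (auto simp: comb_def)
  qed
  ultimately show ?thesis
    using \<open>countable D\<close> by blast
qed

lemma square_integrable_indicator:
  fixes y :: "'b::euclidean_space"
  assumes [measurable]: "A \<in> sets borel" and "emeasure lborel A < \<infinity>"
  shows "square_integrable (\<lambda>x. indicator A x *\<^sub>R y)"
proof -
  have "(\<lambda>x. (norm (indicator A x *\<^sub>R y))\<^sup>2) = (\<lambda>x. indicator A x *\<^sub>R (norm y)\<^sup>2)"
    by (auto simp: indicator_def)
  with assms show ?thesis
    by (auto simp: square_integrable_def)
qed

lemma L2_countable_dense: "\<exists>D :: 'b::euclidean_space L2 set. countable D \<and> closure D = UNIV"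
proof -
  obtain B :: "plane set set" where B: "countable B" "topological_basis B"
    using ex_countable_basis by blast
  define C where "C = (\<lambda>(b, n). b \<inter> ball 0 (real n)) ` (B \<times> (UNIV::nat set))"
  define \<U> where "\<U> = {\<Union>F |F. finite F \<and> F \<subseteq> C}"
  define ind :: "plane set \<Rightarrow> 'b \<Rightarrow> plane \<Rightarrow> 'b" where "ind A y = (\<lambda>x. indicator A x *\<^sub>R y)" for A y
  define S where "S = (\<lambda>(U, y). abs_L2 (ind U y)) ` (\<U> \<times> Basis)"
  have C: "countable C"
    unfolding C_def using B by (intro countable_image countable_SIGMA) auto
  have C_open: "open c" if "c \<in> C" for c
    using that B by (auto simp: C_def topological_basis_open)
  have "\<U> = \<Union> ` {F. finite F \<and> F \<subseteq> C}"
    by (auto simp: \<U>_def)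
  then have "countable \<U>"
    using C by (simp add: countable_Collect_finite_subset)
  then have "countable S"
    unfolding S_def using \<open>countable \<U>\<close> by (intro countable_image countable_SIGMA) (auto intro: countable_finite)
  then obtain D where D: "countable D" "subspace (closure D)" "S \<subseteq> closure D"
    using countable_dense_in_closed_span by blast
  define V where "V = closure D"
  have V: "subspace V"
    using D by (simp add: V_def)
  have V_closed: "x \<in> V" if "\<And>n. a n \<in> V" "a \<longlonglongrightarrow> x" for a x
    using that unfolding V_def by (meson closed_closure closed_sequentially)
  have open_V: "abs_L2 (ind U y) \<in> V"
    if U: "open U" and fin: "emeasure lborel U < \<infinity>" and y: "y \<in> Basis" for U y
  proof (cases "U = {}")
    case True
    then show ?thesis
      using subspace_0[OF V] by (simp add: ind_def abs_L2_zero)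
  next
    case False
    define CU where "CU = {c\<in>C. c \<subseteq> U}"
    have U_eq: "U = \<Union>CU"
    proof
      show "U \<subseteq> \<Union>CU"
      proof
        fix x assume "x \<in> U"
        then obtain b where b: "b \<in> B" "x \<in> b" "b \<subseteq> U"
          using topological_basisE[OF B(2) U] by blast
        obtain n where "norm x < real n"
          using reals_Archimedean2 by blast
        with b have "b \<inter> ball 0 (real n) \<in> CU" "x \<in> b \<inter> ball 0 (real n)"
          by (auto simp: CU_def C_def)
        then show "x \<in> \<Union>CU" by blast
      qed
    qed (auto simp: CU_def)
    with False have "CU \<noteq> {}" by auto
    moreover have "countable CU"
      using C by (auto simp: CU_def)
    ultimately obtain c :: "nat \<Rightarrow> plane set" where c: "range c = CU"
      by (metis range_from_nat_into)
    define W where "W n = (\<Union>i\<le>n. c i)" for n :: nat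
    have W_U: "W n \<in> \<U>" for n
      unfolding \<U>_def W_def using c by (auto simp: CU_def intro!: exI[of _ "c ` {..n}"])
    have W_open: "open (W n)" for n
    proof -
      have "c i \<in> C" for i
        using c by (auto simp: CU_def)
      then show ?thesis
        unfolding W_def by (intro open_UN ballI C_open)
    qed
    have W_sub: "W n \<subseteq> U" for n
      using c by (auto simp: W_def CU_def)
    have "(\<lambda>n. abs_L2 (ind (W n) y)) \<longlonglongrightarrow> abs_L2 (ind U y)"
    proof (rule tendsto_abs_L2)
      show "square_integrable (ind U y)"
        unfolding ind_def using U fin by (intro square_integrable_indicator) auto
      show "ind (W n) y \<in> borel_measurable lborel" for n
        using W_open by (auto simp: ind_def intro!: borel_measurable_scaleR borel_measurable_indicator)
      show "ind U y \<in> borel_measurable lborel"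
        using U by (auto simp: ind_def intro!: borel_measurable_scaleR borel_measurable_indicator)
      show "AE x in lborel. norm (ind (W n) y x) \<le> norm (ind U y x)" for n
        using W_sub[of n] by (auto simp: ind_def indicator_def)
      have "(\<lambda>n. ind (W n) y x) \<longlonglongrightarrow> ind U y x" for x
      proof (cases "x \<in> U")
        case True
        then obtain i where "x \<in> c i"
          using U_eq c by auto
        then have "\<forall>\<^sub>F n in sequentially. ind (W n) y x = ind U y x"
          using True by (auto simp: eventually_sequentially W_def ind_def indicator_def intro!: exI[of _ i])
        then show ?thesis
          by (rule tendsto_eventually)
      next
        case False
        then have "ind (W n) y x = ind U y x" for n
          using W_sub[of n] by (auto simp: ind_def indicator_def)
        then show ?thesis by simp
      qed
      then show "AE x in lborel. (\<lambda>n. ind (W n) y x) \<longlonglongrightarrow> ind U y x"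
        by simp
    qed
    moreover have "abs_L2 (ind (W n) y) \<in> V" for n
    proof -
      have "abs_L2 (ind (W n) y) \<in> S"
        using W_U[of n] y by (force simp: S_def)
      then show ?thesis
        using D by (auto simp: V_def)
    qed
    ultimately show ?thesis
      by (rule V_closed[rotated])
  qed
  have basis_V: "abs_L2 (ind A y) \<in> V"
    if A [measurable]: "A \<in> sets borel" and fin: "emeasure lborel A < \<infinity>" and y: "y \<in> Basis" for A y
  proof -
    have "\<exists>x\<in>V. dist x (abs_L2 (ind A y)) < e" if e: "0 < e" for e
    proof -
      obtain U where U: "open U" "A \<subseteq> U" "emeasure lborel (U - A) < ennreal (e\<^sup>2)"
        using outer_regular_lborel[OF A, of "e\<^sup>2"] e by auto
      have [measurable]: "U \<in> sets borel"
        using U by simp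
      have finUA: "emeasure lborel (U - A) < \<infinity>"
        using U(3) by (auto intro: less_trans)
      have "emeasure lborel U \<le> emeasure lborel A + emeasure lborel (U - A)"
        using U by (subst plus_emeasure) (auto intro!: emeasure_mono)
      then have finU: "emeasure lborel U < \<infinity>"
        using fin finUA by (auto simp: le_less_trans)
      have sU: "square_integrable (ind U y)" and sA: "square_integrable (ind A y)"
        and sUA: "square_integrable (ind (U - A) y)"
        unfolding ind_def using fin finU finUA by (auto intro!: square_integrable_indicator)
      have "(\<lambda>x. ind U y x - ind A y x) = ind (U - A) y"
        using U by (auto simp: ind_def indicator_def fun_eq_iff)
      then have "dist (abs_L2 (ind U y)) (abs_L2 (ind A y)) = norm (abs_L2 (ind (U - A) y))"
        by (simp add: dist_norm abs_L2_diff sU sA)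
      also have "\<dots> = sqrt (LINT x|lborel. indicator (U - A) x)"
      proof -
        have "(\<lambda>x. (norm (ind (U - A) y x))\<^sup>2) = (\<lambda>x. indicator (U - A) x)"
          using y by (auto simp: ind_def indicator_def)
        then show ?thesis
          by (simp add: norm_abs_L2 sUA)
      qed
      also have "\<dots> = sqrt (measure lborel (U - A))"
        by simp
      also have "\<dots> < e"
      proof -
        have "measure lborel (U - A) < e\<^sup>2"
          using U(3) finUA by (simp add: emeasure_eq_ennreal_measure less_top ennreal_less_iff)
        then show ?thesis
          using e by (intro real_less_lsqrt) auto
      qed
      finally show ?thesis
        using open_V[OF U(1) finU y] by blast
    qed
    then have "abs_L2 (ind A y) \<in> closure V"
      by (simp add: closure_approachable)
    then show ?thesis
      by (simp add: V_def)
  qed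
  have ind_V: "abs_L2 (ind A y) \<in> V"
    if A [measurable]: "A \<in> sets borel" and fin: "emeasure lborel A < \<infinity>" for A y
  proof -
    have s: "square_integrable (ind A z)" for z
      unfolding ind_def using A fin by (rule square_integrable_indicator)
    have "ind A y = (\<lambda>x. \<Sum>b\<in>Basis. (y \<bullet> b) *\<^sub>R ind A b x)"
    proof
      fix x
      have "ind A y x = indicator A x *\<^sub>R (\<Sum>b\<in>Basis. (y \<bullet> b) *\<^sub>R b)"
        by (simp add: ind_def euclidean_representation)
      then show "ind A y x = (\<Sum>b\<in>Basis. (y \<bullet> b) *\<^sub>R ind A b x)"
        by (simp add: ind_def scaleR_sum_right mult.commute)
    qed
    then have "abs_L2 (ind A y) = (\<Sum>b\<in>Basis. abs_L2 (\<lambda>x. (y \<bullet> b) *\<^sub>R ind A b x))"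
      using abs_L2_sum[of Basis "\<lambda>b x. (y \<bullet> b) *\<^sub>R ind A b x"] s
      by (simp add: square_integrable_scaleR)
    also have "\<dots> = (\<Sum>b\<in>Basis. (y \<bullet> b) *\<^sub>R abs_L2 (ind A b))"
      by (simp add: abs_L2_scaleR s)
    also have "\<dots> \<in> V"
      by (intro subspace_sum V subspace_scale basis_V A fin)
    finally show ?thesis .
  qed
  have "u \<in> V" for u
  proof -
    define f where "f = rep_L2 u"
    have f: "square_integrable f" and u: "u = abs_L2 f"
      by (simp_all add: f_def)
    obtain F where F: "\<And>i. simple_function lborel (F i)" "\<And>x. (\<lambda>i. F i x) \<longlonglongrightarrow> f x"
      "\<And>i x. norm (F i x) \<le> 2 * norm (f x)"
      using borel_measurable_implies_sequence_metric[OF square_integrableD[OF f], of 0]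
      by (auto simp: dist_norm)
    have sw: "square_integrable (\<lambda>x. 2 *\<^sub>R f x)"
      using f by (rule square_integrable_scaleR)
    have FM [measurable]: "F i \<in> borel_measurable lborel" for i
      using F(1) by (rule borel_measurable_simple_function)
    have sF: "square_integrable (F i)" for i
      by (rule square_integrable_bound[OF sw FM]) (simp add: F(3))
    have "abs_L2 (F i) \<in> V" for i
    proof -
      define A where "A z = F i -` {z}" for z
      define Y where "Y = F i ` UNIV - {0}"
      have Y: "finite Y"
        using simple_functionD(1)[OF F(1), of i] by (simp add: Y_def)
      have A [measurable]: "A z \<in> sets borel" for z
        using simple_functionD(2)[OF F(1), of i "{z}"] by (simp add: A_def)
      have fin: "emeasure lborel (A z) < \<infinity>" if "z \<noteq> 0" for z
      proof -
        have "integrable lborel (\<lambda>x. indicator (A z) x *\<^sub>R (norm z)\<^sup>2)"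
        proof (rule Bochner_Integration.integrable_bound)
          show "integrable lborel (\<lambda>x. (norm (F i x))\<^sup>2)"
            using sF[of i] by (simp add: square_integrable_def)
          show "AE x in lborel. norm (indicator (A z) x *\<^sub>R (norm z)\<^sup>2) \<le> norm ((norm (F i x))\<^sup>2)"
            by (auto simp: A_def indicator_def)
        qed measurable
        then have "integrable lborel (indicator (A z) :: plane \<Rightarrow> real)"
          using that by simp
        then show ?thesis
          by (simp add: integrable_indicator_iff)
      qed
      have sA: "square_integrable (ind (A z) z)" if "z \<in> Y" for z
        unfolding ind_def using that by (intro square_integrable_indicator fin A) (simp add: Y_def)
      have "F i = (\<lambda>x. \<Sum>z\<in>Y. ind (A z) z x)"
      proof
        fix x
        have "(\<Sum>z\<in>Y. ind (A z) z x) = (\<Sum>z\<in>Y. if z = F i x then F i x else 0)"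
          by (intro sum.cong) (auto simp: ind_def A_def indicator_def)
        then show "F i x = (\<Sum>z\<in>Y. ind (A z) z x)"
          using Y by (auto simp: Y_def)
      qed
      then have "abs_L2 (F i) = (\<Sum>z\<in>Y. abs_L2 (ind (A z) z))"
        using abs_L2_sum[OF Y, of "\<lambda>z. ind (A z) z"] sA by simp
      also have "\<dots> \<in> V"
        by (intro subspace_sum V ind_V A fin) (simp add: Y_def)
      finally show ?thesis .
    qed
    moreover have "(\<lambda>i. abs_L2 (F i)) \<longlonglongrightarrow> u"
      unfolding u by (rule tendsto_abs_L2[OF sw FM square_integrableD[OF f]]) (simp_all add: F)
    ultimately show ?thesis
      by (rule V_closed)
  qed
  then show ?thesis
    using D(1) by (auto simp: V_def)
qed

instance L2 :: (euclidean_space) second_countable_topology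
proof
  obtain D :: "'a L2 set" where D: "countable D" "closure D = UNIV"
    using L2_countable_dense by blast
  define B where "B = (\<lambda>(d, n). ball d (1 / real (Suc n))) ` (D \<times> UNIV)"
  have "topological_basis B"
  proof (rule topological_basisI)
    show "open b" if "b \<in> B" for b
      using that by (auto simp: B_def)
    fix U :: "'a L2 set" and x assume "open U" "x \<in> U"
    then obtain e where e: "0 < e" "ball x e \<subseteq> U"
      using open_contains_ball by blast
    then obtain n where n: "1 / real (Suc n) < e / 2"
      using nat_approx_posE[of "e / 2"] by auto
    have "x \<in> closure D"
      using D by simp
    then obtain d where d: "d \<in> D" "dist d x < 1 / real (Suc n)"
      unfolding closure_approachable by (metis of_nat_0_less_iff zero_less_Suc zero_less_divide_1_iff)
    have "ball d (1 / real (Suc n)) \<subseteq> ball x e"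
    proof
      fix z assume "z \<in> ball d (1 / real (Suc n))"
      then show "z \<in> ball x e"
        using d n dist_triangle[of x z d] by (simp add: dist_commute)
    qed
    with d e show "\<exists>b\<in>B. x \<in> b \<and> b \<subseteq> U"
      by (intro bexI[of _ "ball d (1 / real (Suc n))"]) (auto simp: B_def dist_commute)
  qed
  moreover have "countable B"
    unfolding B_def using D by (intro countable_image countable_SIGMA) auto
  ultimately show "\<exists>B::'a L2 set set. countable B \<and> open = generate_topology B"
    using topological_basis_imp_subbasis by blast
qed

definition period_cell :: "real \<Rightarrow> real \<Rightarrow> plane set" where
  "period_cell L1 L2 = {0..L1} \<times> {0..L2}"

definition L2_torus :: "real \<Rightarrow> real \<Rightarrow> 'b::euclidean_space L2 set" where
  "L2_torus L1 L2 = {u. AE x in lborel. x \<notin> period_cell L1 L2 \<longrightarrow> rep_L2 u x = 0}"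

definition to_L2_torus :: "real \<Rightarrow> real \<Rightarrow> (plane \<Rightarrow> 'b::euclidean_space) \<Rightarrow> 'b L2" where
  "to_L2_torus L1 L2 f = abs_L2 (\<lambda>x. indicator (period_cell L1 L2) x *\<^sub>R f x)"

definition wave_vector :: "real \<Rightarrow> real \<Rightarrow> int \<times> int \<Rightarrow> plane" where
  "wave_vector L1 L2 k = (2 * pi * (real_of_int (fst k) / L1), 2 * pi * (real_of_int (snd k) / L2))"

definition fourier_coeff :: "real \<Rightarrow> real \<Rightarrow> (plane \<Rightarrow> real) \<Rightarrow> int \<times> int \<Rightarrow> complex" where
  "fourier_coeff L1 L2 f k =
     (1 / (L1 * L2)) *\<^sub>R (LINT x:period_cell L1 L2|lborel. f x *\<^sub>R cis (- (wave_vector L1 L2 k \<bullet> x)))"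

text \<open>
  The semigroup generated by \<open>- (\<Delta>\<^sup>2 + \<Delta>)\<close>, applied to a representative of an integrable real
  function.  The sum is taken in \<open>L\<^sup>2\<close>: for square integrable \<open>f\<close> it converges unconditionally for
  all \<open>t \<ge> 0\<close>, for integrable \<open>f\<close> it converges absolutely for \<open>t > 0\<close>.  For real \<open>f\<close> the modes
  \<open>k\<close> and \<open>-k\<close> are conjugate and the symbol is even, so that taking real parts termwise does not
  change the sum; it makes the terms elements of the real space.
\<close>

definition semigroup_KS :: "real \<Rightarrow> real \<Rightarrow> real \<Rightarrow> (plane \<Rightarrow> real) \<Rightarrow> real L2" where
  "semigroup_KS L1 L2 t f =
     (\<Sum>\<^sub>\<infinity>k. exp (- t * (norm (wave_vector L1 L2 k) ^ 4 - norm (wave_vector L1 L2 k) ^ 2)) *\<^sub>R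
        to_L2_torus L1 L2 (\<lambda>x. Re (fourier_coeff L1 L2 f k * cis (wave_vector L1 L2 k \<bullet> x))))"

text \<open>
  Test functions on the torus: periodic \<open>C\<^sup>\<infinity>\<close> functions on the plane.  The family \<open>D\<close> below consists
  of the partial derivatives \<open>D i j = \<partial>\<^sub>1\<^sup>i \<partial>\<^sub>2\<^sup>j \<psi>\<close>.
\<close>

definition test_function :: "real \<Rightarrow> real \<Rightarrow> (plane \<Rightarrow> real) \<Rightarrow> bool" where
  "test_function L1 L2 \<psi> \<longleftrightarrow>
     (\<forall>x. \<psi> (x + (L1, 0)) = \<psi> x \<and> \<psi> (x + (0, L2)) = \<psi> x) \<and>
     (\<exists>D :: nat \<Rightarrow> nat \<Rightarrow> plane \<Rightarrow> real. D 0 0 = \<psi> \<and>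
        (\<forall>i j x. (D i j has_derivative
           (\<lambda>h. fst h * D (Suc i) j x + snd h * D i (Suc j) x)) (at x)))"

definition weak_gradient ::
    "real \<Rightarrow> real \<Rightarrow> (plane \<Rightarrow> real) \<Rightarrow> (plane \<Rightarrow> plane) \<Rightarrow> bool" where
  "weak_gradient L1 L2 f g \<longleftrightarrow>
     set_integrable lborel (period_cell L1 L2) g \<and>
     (\<forall>\<psi>. test_function L1 L2 \<psi> \<longrightarrow> (\<forall>h\<in>Basis.
        (LINT x:period_cell L1 L2|lborel. f x * frechet_derivative \<psi> (at x) h) =
        - (LINT x:period_cell L1 L2|lborel. (g x \<bullet> h) * \<psi> x)))"

definition divergence_free :: "real \<Rightarrow> real \<Rightarrow> (plane \<Rightarrow> plane) \<Rightarrow> bool" where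
  "divergence_free L1 L2 w \<longleftrightarrow>
     (\<forall>\<psi>. test_function L1 L2 \<psi> \<longrightarrow>
        (LINT x:period_cell L1 L2|lborel. frechet_derivative \<psi> (at x) (w x)) = 0)"

text \<open>
  \<open>L\<^sup>\<infinity>(\<real>\<^sub>+; L\<^sup>2)\<close> for vector fields.  Values at \<open>t \<le> 0\<close> are irrelevant, and an element of the
  space is represented by a Borel measurable function of time.
\<close>

definition Linf_L2 :: "real \<Rightarrow> real \<Rightarrow> (real \<Rightarrow> plane L2) set" where
  "Linf_L2 L1 L2 =
     {v. v \<in> borel_measurable (restrict_space lborel {0<..}) \<and>
         (AE t in restrict_space lborel {0<..}. v t \<in> L2_torus L1 L2) \<and>
         esssup (restrict_space lborel {0<..}) (\<lambda>t. ereal (norm (v t))) < \<infinity>}"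

definition Linf_L2_norm :: "(real \<Rightarrow> plane L2) \<Rightarrow> real" where
  "Linf_L2_norm v = real_of_ereal (esssup (restrict_space lborel {0<..}) (\<lambda>t. ereal (norm (v t))))"

definition C_L2 :: "real \<Rightarrow> real \<Rightarrow> real \<Rightarrow> (real \<Rightarrow> real L2) set" where
  "C_L2 L1 L2 T = {\<phi>. continuous_on {0..T} \<phi> \<and> (\<forall>t\<in>{0..T}. \<phi> t \<in> L2_torus L1 L2)}"

definition Xtilde :: "real \<Rightarrow> real \<Rightarrow> real \<Rightarrow> (real \<Rightarrow> real L2) set" where
  "Xtilde L1 L2 T =
     {\<phi> \<in> C_L2 L1 L2 T. \<exists>C. \<forall>t\<in>{0<..T}. \<exists>g\<in>L2_torus L1 L2.
        weak_gradient L1 L2 (rep_L2 (\<phi> t)) (rep_L2 g) \<and> t powr (1/4) * norm g \<le> C}"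

text \<open>
  \<open>G\<close> is the spatial gradient of \<open>\<phi>\<close>, required to be a locally integrable function on
  \<open>(0,T) \<times> torus\<close>; it is unique up to null sets.  The integrability of \<open>\<bar>G \<tau>\<bar>\<^sup>2\<close> and
  \<open>v \<tau> \<bullet> G \<tau>\<close> in space is what the semigroup needs in order to be applied to them.
\<close>

definition mild_solution ::
    "real \<Rightarrow> real \<Rightarrow> (real \<Rightarrow> plane L2) \<Rightarrow> real L2 \<Rightarrow> real \<Rightarrow> (real \<Rightarrow> real L2) \<Rightarrow> bool" where
  "mild_solution L1 L2 v \<phi>0 T \<phi> \<longleftrightarrow>
     \<phi> \<in> C_L2 L1 L2 T \<and>
     (\<exists>G :: real \<Rightarrow> plane \<Rightarrow> plane.
        (\<forall>a b. 0 < a \<longrightarrow> a \<le> b \<longrightarrow> b < T \<longrightarrow>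
           set_integrable lborel ({a..b} \<times> period_cell L1 L2) (\<lambda>(t, x). G t x)) \<and>
        (AE \<tau> in lborel. \<tau> \<in> {0<..<T} \<longrightarrow>
           weak_gradient L1 L2 (rep_L2 (\<phi> \<tau>)) (G \<tau>) \<and>
           set_integrable lborel (period_cell L1 L2) (\<lambda>x. (norm (G \<tau> x))\<^sup>2) \<and>
           set_integrable lborel (period_cell L1 L2) (\<lambda>x. rep_L2 (v \<tau>) x \<bullet> G \<tau> x)) \<and>
        (\<forall>t\<in>{0..T}.
           set_integrable lborel {0<..<t}
             (\<lambda>\<tau>. semigroup_KS L1 L2 (t - \<tau>) (\<lambda>x. (norm (G \<tau> x))\<^sup>2)) \<and>
           set_integrable lborel {0<..<t}
             (\<lambda>\<tau>. semigroup_KS L1 L2 (t - \<tau>) (\<lambda>x. rep_L2 (v \<tau>) x \<bullet> G \<tau> x)) \<and>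
           \<phi> t = semigroup_KS L1 L2 t (rep_L2 \<phi>0)
             - (1/2) *\<^sub>R (LINT \<tau>:{0<..<t}|lborel.
                 semigroup_KS L1 L2 (t - \<tau>) (\<lambda>x. (norm (G \<tau> x))\<^sup>2))
             - (LINT \<tau>:{0<..<t}|lborel.
                 semigroup_KS L1 L2 (t - \<tau>) (\<lambda>x. rep_L2 (v \<tau>) x \<bullet> G \<tau> x))))"

end

theory Submission
  imports Defs
begin

text \<open>
  The unknown is the gradient \<open>u = \<nabla>\<phi>\<close>, because the nonlinearity only sees \<open>u\<close>.  Write \<open>S s\<close> for the
  semigroup.  If \<open>g\<close> and \<open>h\<close> are square integrable vector fields, then \<open>g \<bullet> h\<close> is merely integrable, but
  its Fourier coefficients are bounded by \<open>\<parallel>g\<parallel> \<parallel>h\<parallel> / area\<close>.  Since \<open>\<Sum>k. exp (-2 s (\<bar>k\<bar>\<^sup>4 - \<bar>k\<bar>\<^sup>2))\<close> grows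
  like \<open>s powr (-1/2)\<close> as \<open>s\<close> tends to \<open>0\<close>, and like \<open>s powr (-1)\<close> with an additional factor \<open>\<bar>k\<bar>\<^sup>2\<close>,
  the bilinear maps \<open>S s (g \<bullet> h)\<close> and \<open>B s g h = \<nabla> S s (g \<bullet> h)\<close> have norms at most of order
  \<open>s powr (-1/4)\<close> and \<open>s powr (-1/2)\<close> (\<open>torus.smoothing_sums\<close>, \<open>torus.norm_kernel\<close>).
  
  Taking the gradient of the mild formulation gives an equation in which no derivative is left:
  \<open>u t = \<nabla> S t \<phi>0 - \<integral> B (t - \<tau>) (u \<tau> / 2 + v \<tau>) (u \<tau>) d\<tau>\<close>, integrated over \<open>0 < \<tau> < t\<close>.
  For \<open>\<parallel>u \<tau>\<parallel> \<le> R \<tau> powr (-1/4)\<close> the integrand is of order \<open>(t - \<tau>) powr (-1/2) * \<tau> powr (-1/2)\<close>, whose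
  integral does not depend on \<open>t\<close>.  This is smaller by a factor \<open>t powr (1/4)\<close> than what the weight
  allows, so the right-hand side is a contraction on a short time interval whose length depends only
  on the constants, on the bound for \<open>v\<close> and on the norm of \<open>\<phi>0\<close> (\<open>volterra.existence\<close>).  Uniqueness
  among all solutions with a finite weighted norm, on the same interval, follows from the same
  estimate with the additional weight \<open>exp (\<mu> t)\<close>, \<open>\<mu>\<close> large (\<open>volterra.uniqueness\<close>).
  
  It remains to pass between \<open>u\<close> and \<open>\<phi>\<close>.  Given \<open>u\<close>, the mild formula defines \<open>\<phi>\<close>
  (\<open>torus_flow.profile\<close>); it is continuous because \<open>1/4 + 1/2 < 1\<close>, and its weak gradient is \<open>u\<close>, because
  weak gradients form a closed linear relation which contains every Fourier mode
  (\<open>torus_flow.profile_gradient\<close>).  Conversely, the gradient of any mild solution in the space solves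
  the equation for \<open>u\<close>.  This uses that a weak gradient is unique, which is the completeness of the
  trigonometric system (\<open>torus.fourier_complete\<close>), and that jointly measurable functions and Borel
  measurable maps into \<open>L\<^sup>2\<close> determine each other (\<open>measurable_representative\<close>, \<open>measurable_abs_L2\<close>).
\<close>

section \<open>Fourier analysis on the period cell\<close>

text \<open>
  Indicators of open sets are bounded pointwise limits of continuous functions, and open sets are
  an intersection-stable generator of the Borel sets.
\<close>

lemma integral_zero_continuous_imp_borel:
  fixes F :: "'a \<Rightarrow> real" and E :: "'a \<Rightarrow> 'b::metric_space"
  assumes F_int: "integrable M F" and E [measurable]: "E \<in> borel_measurable M"
    and cont: "\<And>h :: 'b \<Rightarrow> real. continuous_on UNIV h \<Longrightarrow> (LINT x|M. F x * h (E x)) = 0"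
    and B: "B \<in> sets borel"
  shows "(LINT x|M. F x * indicator B (E x)) = 0"
proof -
  note [measurable] = borel_measurable_integrable[OF F_int]
  have "open": "(LINT x|M. F x * indicator U (E x)) = 0" if U: "open U" for U
  proof (cases "U = UNIV")
    case True
    then show ?thesis using cont[of "\<lambda>x. 1"] by simp
  next
    case False
    \<comment> \<open>\<open>infdist z {}\<close> is \<open>0\<close> by convention, which is why \<open>U = UNIV\<close> is treated separately.\<close>
    define h where "h n z = min 1 (real n * infdist z (- U))" for n :: nat and z
    have h_cont: "continuous_on UNIV (h n)" for n
      unfolding h_def by (intro continuous_intros)
    note [measurable] = borel_measurable_continuous_onI[OF h_cont] borel_open[OF U]
    have h_lim: "(\<lambda>n. h n z) \<longlonglongrightarrow> indicator U z" for z
    proof (cases "z \<in> U")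
      case True
      then have pos: "0 < infdist z (- U)"
        using False U in_closed_iff_infdist_zero[of "- U" z] infdist_nonneg[of z "- U"]
        by (auto simp: less_le)
      obtain N :: nat where N: "1 / infdist z (- U) \<le> real N"
        using real_arch_simple by blast
      have "h n z = 1" if "N \<le> n" for n
      proof -
        have "1 / infdist z (- U) \<le> real n"
          using N that by (meson of_nat_le_iff order_trans)
        then show ?thesis
          using pos by (simp add: h_def field_simps)
      qed
      then have "\<forall>\<^sub>F n in sequentially. h n z = indicator U z"
        using True by (auto simp: eventually_sequentially)
      then show ?thesis by (rule tendsto_eventually)
    next
      case False
      then show ?thesis by (simp add: h_def)
    qed
    have "(\<lambda>n. LINT x|M. F x * h n (E x)) \<longlonglongrightarrow> (LINT x|M. F x * indicator U (E x))"
    proof (rule integral_dominated_convergence[where w = "\<lambda>x. \<bar>F x\<bar>"])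
      show "AE x in M. (\<lambda>n. F x * h n (E x)) \<longlonglongrightarrow> F x * indicator U (E x)"
        by (intro AE_I2 tendsto_mult_left h_lim)
      show "AE x in M. norm (F x * h n (E x)) \<le> \<bar>F x\<bar>" for n
        by (intro AE_I2) (auto simp: abs_mult h_def infdist_nonneg intro!: mult_left_le)
    qed (use F_int in auto)
    then show ?thesis
      by (simp add: cont[OF h_cont] LIMSEQ_const_iff)
  qed
  have "Int_stable {U :: 'b set. open U}" "{U :: 'b set. open U} \<subseteq> Pow UNIV"
    "B \<in> sigma_sets UNIV {U. open U}"
    using B by (auto simp: borel_def Int_stable_def)
  then show ?thesis
  proof (induction rule: sigma_sets_induct_disjoint)
    case (basic A)
    then show ?case using "open" by simp
  next
    case empty
    then show ?case by simp
  next
    case (compl A)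
    then have [measurable]: "A \<in> sets borel" by (simp add: borel_def)
    have "(LINT x|M. F x * indicator (UNIV - A) (E x)) = (LINT x|M. F x * 1 - F x * indicator A (E x))"
      by (intro Bochner_Integration.integral_cong) (auto simp: indicator_def)
    also have "\<dots> = (LINT x|M. F x * 1) - (LINT x|M. F x * indicator A (E x))"
    proof (rule Bochner_Integration.integral_diff)
      show "integrable M (\<lambda>x. F x * indicator A (E x))"
        by (rule Bochner_Integration.integrable_bound[OF F_int]) (auto simp: indicator_def)
    qed (use F_int in simp)
    also have "\<dots> = 0"
      using compl cont[of "\<lambda>x. 1"] by simp
    finally show ?case .
  next
    case (union A)
    then have [measurable]: "A i \<in> sets borel" for i by (auto simp: borel_def)
    define S where "S i = E -` A i \<inter> space M" for i
    have [measurable]: "S i \<in> sets M" for i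
      unfolding S_def by measurable
    have S_eq: "(LINT x:E -` C \<inter> space M|M. F x) = (LINT x|M. F x * indicator C (E x))" for C
      unfolding set_lebesgue_integral_def
      by (intro Bochner_Integration.integral_cong) (auto simp: indicator_def)
    have "(LINT x:(\<Union>i. S i)|M. F x) = (\<Sum>i. LINT x:S i|M. F x)"
    proof (rule lebesgue_integral_countable_add)
      show "S i \<inter> S j = {}" if "i \<noteq> j" for i j
        using union(1) that unfolding S_def disjoint_family_on_def by blast
      show "set_integrable M (\<Union>i. S i) F"
        unfolding set_integrable_def
        by (rule integrable_mult_indicator[OF _ F_int]) measurable
    qed measurable
    moreover have "(\<Union>i. S i) = E -` (\<Union>i. A i) \<inter> space M"
      by (auto simp: S_def)
    ultimately show ?case
      using union(3) by (simp add: S_eq S_def del: UN_simps)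
  qed
qed

text \<open>
  The argument jumps only across the nonnegative reals, where it is constant.
\<close>

lemma borel_measurable_Arg2pi: "Arg2pi \<in> borel_measurable borel"
proof (rule measurable_piecewise_restrict[of "{\<real>\<^sub>\<ge>\<^sub>0, - \<real>\<^sub>\<ge>\<^sub>0}"])
  fix \<Omega> :: "complex set" assume "\<Omega> \<in> {\<real>\<^sub>\<ge>\<^sub>0, - \<real>\<^sub>\<ge>\<^sub>0}"
  then consider "\<Omega> = \<real>\<^sub>\<ge>\<^sub>0" | "\<Omega> = - \<real>\<^sub>\<ge>\<^sub>0" by auto
  then show "Arg2pi \<in> borel_measurable (restrict_space borel \<Omega>)"
  proof cases
    case 1
    have "Arg2pi z = 0" if "z \<in> \<real>\<^sub>\<ge>\<^sub>0" for z
      using that by (auto simp: Arg2pi_eq_0 nonneg_Reals_def)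
    then show ?thesis
      using 1 by (subst measurable_cong[of _ _ "\<lambda>_. 0"]) (auto simp: space_restrict_space)
  next
    case 2
    have "continuous_on (- \<real>\<^sub>\<ge>\<^sub>0) Arg2pi"
      by (rule continuous_at_imp_continuous_on) (auto intro: continuous_at_Arg2pi)
    then show ?thesis
      using 2 by (simp add: borel_measurable_continuous_on_restrict)
  qed
  show "\<Omega> \<inter> space borel \<in> sets borel"
    using \<open>\<Omega> \<in> _\<close> by auto
qed auto

text \<open>
  Test with the sets where \<open>F\<close> is positive and where it is negative.
\<close>

lemma AE_zero_of_integral_indicator_zero:
  fixes F :: "'a \<Rightarrow> real"
  assumes F_int: "integrable M F"
    and sets: "\<And>C. C \<in> sets M \<Longrightarrow> (LINT x|M. F x * indicator C x) = 0"
  shows "AE x in M. F x = 0"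
proof -
  note [measurable] = borel_measurable_integrable[OF F_int]
  have half: "AE x in M. s * F x \<le> 0" if "s \<in> {1, -1}" for s :: real
  proof -
    define C where "C = {x \<in> space M. 0 < s * F x}"
    have C: "C \<in> sets M"
      unfolding C_def by measurable
    have "(LINT x|M. s * F x * indicator C x) = 0"
      using sets[OF C] by (simp add: mult.assoc)
    moreover have "integrable M (\<lambda>x. s * F x * indicator C x)"
      using integrable_real_mult_indicator[OF C F_int] by (simp add: mult.assoc)
    ultimately have "AE x in M. s * F x * indicator C x = 0"
      by (subst (asm) integral_nonneg_eq_0_iff_AE) (auto simp: C_def indicator_def)
    then show ?thesis
      using AE_space by eventually_elim (auto simp: C_def indicator_def split: if_splits)
  qed
  have "AE x in M. 1 * F x \<le> 0" "AE x in M. - 1 * F x \<le> 0"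
    by (rule half; simp)+
  then show ?thesis
    by eventually_elim simp
qed

lemma cos_add_2pi_int: "cos (a + 2 * pi * real_of_int n) = cos a"
  by (simp add: cos_add)

text \<open>
  Differentiation shifts the phase by \<open>pi / 2\<close>.  Waves are therefore written as cosines with a
  phase: all their derivatives are again of this form, and no separate treatment of sines is needed.
\<close>

lemma has_derivative_cos_wave:
  "((\<lambda>x::plane. cos (w \<bullet> x + \<theta>)) has_derivative
     (\<lambda>h. fst h * (fst w * cos (w \<bullet> x + (\<theta> + pi / 2))) + snd h * (snd w * cos (w \<bullet> x + (\<theta> + pi / 2))))) (at x)"
proof -
  have "((\<lambda>x::plane. cos (w \<bullet> x + \<theta>)) has_derivative (\<lambda>h. (w \<bullet> h) * - sin (w \<bullet> x + \<theta>))) (at x)"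
    by (auto intro!: derivative_eq_intros)
  moreover have "cos (w \<bullet> x + (\<theta> + pi / 2)) = - sin (w \<bullet> x + \<theta>)"
    by (simp add: cos_add sin_add)
  ultimately show ?thesis
    by (simp add: inner_prod_def algebra_simps)
qed

locale torus =
  fixes L1 L2 :: real
  assumes L1_pos: "0 < L1" and L2_pos: "0 < L2"
begin

abbreviation Q :: "plane set" where "Q \<equiv> period_cell L1 L2"
abbreviation wv :: "int \<times> int \<Rightarrow> plane" where "wv \<equiv> wave_vector L1 L2"

lemma Q_eq_cbox: "Q = cbox (0, 0) (L1, L2)"
  by (simp add: period_cell_def cbox_Pair_eq)

lemma Q_borel [measurable]: "Q \<in> sets borel"
  by (simp add: Q_eq_cbox)

lemma compact_Q: "compact Q"
  by (simp add: Q_eq_cbox)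

lemma emeasure_Q_finite: "emeasure lborel Q < \<infinity>"
  using emeasure_lborel_cbox_finite by (simp add: Q_eq_cbox)

definition area :: real where "area = L1 * L2"

lemma area_pos: "0 < area"
  using L1_pos L2_pos by (simp add: area_def)

lemma measure_Q: "measure lborel Q = area"
  using L1_pos L2_pos
  by (simp add: Q_eq_cbox content_cbox_if[unfolded measure_lborel_cbox_eq] measure_lborel_cbox_eq area_def
      Basis_prod_def prod.union_disjoint inner_Pair_0 disjoint_iff)

text \<open>
  Fubini reduces this to the fundamental theorem of calculus on one edge of the cell, where the two
  boundary values cancel by periodicity.  It serves twice: for the orthogonality of the waves and for
  the integration by parts behind weak gradients.
\<close>

lemma integral_periodic_derivative:
  fixes P P1 P2 :: "plane \<Rightarrow> real"
  assumes der: "\<And>x. (P has_derivative (\<lambda>h. fst h * P1 x + snd h * P2 x)) (at x)"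
    and per: "\<And>x. P (x + (L1, 0)) = P x" "\<And>x. P (x + (0, L2)) = P x"
    and cont: "continuous_on UNIV P1" "continuous_on UNIV P2"
  shows "(LINT x:Q|lborel. P1 x) = 0" "(LINT x:Q|lborel. P2 x) = 0"
proof -
  have int: "integrable (lborel \<Otimes>\<^sub>M lborel) (\<lambda>(x, y). indicator Q (x, y) *\<^sub>R F (x, y))"
    if "continuous_on UNIV F" for F :: "plane \<Rightarrow> real"
    unfolding lborel_prod
    using borel_integrable_compact[OF compact_Q continuous_on_subset[OF that subset_UNIV]]
    by (simp add: case_prod_unfold)
  have ind: "indicator Q (x, y) = (indicator {0..L1} x * indicator {0..L2} y :: real)" for x y
    by (auto simp: period_cell_def indicator_def)
  have "((\<lambda>s. P (s, y)) has_field_derivative P1 (s, y)) (at s)" for s y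
  proof -
    have "((\<lambda>s. P (s, y)) has_derivative (\<lambda>h. P1 (s, y) * h)) (at s)"
      by (rule has_derivative_eq_rhs[OF has_derivative_compose[OF _ der]]) (auto intro!: derivative_eq_intros)
    then show ?thesis
      by (simp add: has_field_derivative_def)
  qed
  moreover have "isCont (\<lambda>s. P1 (s, y)) s" for s y
    using continuous_on_compose2[OF cont(1), of UNIV "\<lambda>s. (s, y)"]
    by (auto simp: continuous_on_eq_continuous_at intro!: continuous_intros)
  ultimately have 1: "(LINT s|lborel. P1 (s, y) * indicator {0..L1} s) = 0" for y
    using integral_FTC_Icc_real[of 0 L1 "\<lambda>s. P (s, y)" "\<lambda>s. P1 (s, y)"] per(1)[of "(0, y)"] L1_pos
    by simp
  have "(LINT y|lborel. LINT s|lborel. indicator Q (s, y) *\<^sub>R P1 (s, y)) =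
    (LINT y|lborel. indicator {0..L2} y * (LINT s|lborel. P1 (s, y) * indicator {0..L1} s))"
    unfolding integral_mult_right_zero[symmetric] by (simp add: ind ac_simps)
  then have "(LINT y|lborel. LINT s|lborel. indicator Q (s, y) *\<^sub>R P1 (s, y)) = 0"
    by (simp add: 1)
  then show "(LINT x:Q|lborel. P1 x) = 0"
    using lborel_pair.integral_snd[OF int[OF cont(1)]]
    by (simp add: set_lebesgue_integral_def lborel_prod case_prod_unfold)
  have "((\<lambda>s. P (y, s)) has_field_derivative P2 (y, s)) (at s)" for s y
  proof -
    have "((\<lambda>s. P (y, s)) has_derivative (\<lambda>h. P2 (y, s) * h)) (at s)"
      by (rule has_derivative_eq_rhs[OF has_derivative_compose[OF _ der]]) (auto intro!: derivative_eq_intros)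
    then show ?thesis
      by (simp add: has_field_derivative_def)
  qed
  moreover have "isCont (\<lambda>s. P2 (y, s)) s" for s y
    using continuous_on_compose2[OF cont(2), of UNIV "\<lambda>s. (y, s)"]
    by (auto simp: continuous_on_eq_continuous_at intro!: continuous_intros)
  ultimately have 2: "(LINT s|lborel. P2 (y, s) * indicator {0..L2} s) = 0" for y
    using integral_FTC_Icc_real[of 0 L2 "\<lambda>s. P (y, s)" "\<lambda>s. P2 (y, s)"] per(2)[of "(y, 0)"] L2_pos
    by simp
  have "(LINT y|lborel. LINT s|lborel. indicator Q (y, s) *\<^sub>R P2 (y, s)) =
    (LINT y|lborel. indicator {0..L1} y * (LINT s|lborel. P2 (y, s) * indicator {0..L2} s))"
    unfolding integral_mult_right_zero[symmetric] by (simp add: ind ac_simps)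
  then have "(LINT y|lborel. LINT s|lborel. indicator Q (y, s) *\<^sub>R P2 (y, s)) = 0"
    by (simp add: 2)
  then show "(LINT x:Q|lborel. P2 x) = 0"
    using lborel_pair.integral_fst[OF int[OF cont(2)]]
    by (simp add: set_lebesgue_integral_def lborel_prod case_prod_unfold)
qed

lemma wv_add: "wv (k + l) = wv k + wv l"
  by (simp add: wave_vector_def plus_prod_def add_divide_distrib distrib_left)

lemma wv_diff: "wv (k - l) = wv k - wv l"
  by (simp add: wave_vector_def minus_prod_def diff_divide_distrib right_diff_distrib)

lemma wv_eq_0_iff: "wv k = 0 \<longleftrightarrow> k = 0"
  using L1_pos L2_pos by (simp add: wave_vector_def zero_prod_def prod_eq_iff)

lemma wv_period: "wv k \<bullet> (x + (L1, 0)) = wv k \<bullet> x + 2 * pi * real_of_int (fst k)"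
  "wv k \<bullet> (x + (0, L2)) = wv k \<bullet> x + 2 * pi * real_of_int (snd k)"
  using L1_pos L2_pos by (simp_all add: wave_vector_def inner_prod_def field_simps)

lemma cos_wave_periodic: "cos (wv k \<bullet> (x + (L1, 0)) + \<theta>) = cos (wv k \<bullet> x + \<theta>)"
  "cos (wv k \<bullet> (x + (0, L2)) + \<theta>) = cos (wv k \<bullet> x + \<theta>)"
  using cos_add_2pi_int[of "wv k \<bullet> x + \<theta>"] by (simp_all only: wv_period ac_simps)

lemma test_function_cos_wave: "test_function L1 L2 (\<lambda>x. cos (wv k \<bullet> x + \<theta>))"
proof -
  define D where "D = (\<lambda>(i::nat) (j::nat) x. fst (wv k) ^ i * snd (wv k) ^ j * cos (wv k \<bullet> x + (\<theta> + real (i + j) * (pi / 2))))"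
  have "(D i j has_derivative (\<lambda>h. fst h * D (Suc i) j x + snd h * D i (Suc j) x)) (at x)" for i j x
  proof -
    have "\<theta> + real (i + j) * (pi / 2) + pi / 2 = \<theta> + real (Suc i + j) * (pi / 2)"
      "\<theta> + real (i + j) * (pi / 2) + pi / 2 = \<theta> + real (i + Suc j) * (pi / 2)"
      by (simp_all add: algebra_simps add_divide_distrib)
    then show ?thesis
      unfolding D_def
      using has_derivative_mult_right[OF has_derivative_cos_wave[of "wv k" "\<theta> + real (i + j) * (pi / 2)" x],
          of "fst (wv k) ^ i * snd (wv k) ^ j"]
      by (simp add: algebra_simps)
  qed
  moreover have "D 0 0 = (\<lambda>x. cos (wv k \<bullet> x + \<theta>))"
    by (simp add: D_def)
  ultimately show ?thesis
    unfolding test_function_def by (auto simp: cos_wave_periodic intro!: exI[of _ D])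
qed

lemma integral_cos_wave:
  assumes "k \<noteq> 0"
  shows "(LINT x:Q|lborel. cos (wv k \<bullet> x + \<theta>)) = 0"
proof -
  have "(LINT x:Q|lborel. fst (wv k) * cos (wv k \<bullet> x + (\<theta> - pi / 2 + pi / 2))) = 0"
    "(LINT x:Q|lborel. snd (wv k) * cos (wv k \<bullet> x + (\<theta> - pi / 2 + pi / 2))) = 0"
    by (rule integral_periodic_derivative[OF has_derivative_cos_wave[of "wv k" "\<theta> - pi / 2"]];
      (intro cos_wave_periodic continuous_intros)?)+
  moreover have "fst (wv k) \<noteq> 0 \<or> snd (wv k) \<noteq> 0"
    using assms wv_eq_0_iff[of k] by (auto simp: prod_eq_iff)
  ultimately show ?thesis
    by auto
qed

lemma set_integrable_continuous_Q:
  fixes f :: "plane \<Rightarrow> 'b::euclidean_space"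
  assumes "continuous_on UNIV f"
  shows "set_integrable lborel Q f"
  unfolding set_integrable_def
  by (rule borel_integrable_compact[OF compact_Q continuous_on_subset[OF assms subset_UNIV]])

text \<open>
  The modes \<open>k\<close> and \<open>- k\<close> span the same two-dimensional space of real functions, hence the exception.
\<close>

lemma integral_cos_wave_product:
  assumes "l \<noteq> k" "l \<noteq> - k"
  shows "(LINT x:Q|lborel. cos (wv k \<bullet> x + \<theta>) * cos (wv l \<bullet> x + \<eta>)) = 0"
proof -
  have "cos (wv k \<bullet> x + \<theta>) * cos (wv l \<bullet> x + \<eta>) =
      (1/2) * cos (wv (k - l) \<bullet> x + (\<theta> - \<eta>)) + (1/2) * cos (wv (k + l) \<bullet> x + (\<theta> + \<eta>))" for x
  proof -
    have "cos a * cos b = (1/2) * cos (a - b) + (1/2) * cos (a + b)" for a b :: real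
      by (simp add: cos_times_cos add_divide_distrib)
    from this[of "wv k \<bullet> x + \<theta>" "wv l \<bullet> x + \<eta>"] show ?thesis
      by (simp only: wv_add wv_diff inner_add_left inner_diff_left) (simp add: algebra_simps)
  qed
  moreover have "k - l \<noteq> 0" "k + l \<noteq> 0"
    using assms by (auto simp: add_eq_0_iff)
  moreover have "set_integrable lborel Q (\<lambda>x. (1/2) * cos (wv m \<bullet> x + \<phi>))" for m and \<phi> :: real
    by (intro set_integrable_continuous_Q continuous_intros)
  ultimately show ?thesis
    by (simp add: set_integral_add integral_cos_wave)
qed


text \<open>
  Trigonometric polynomials as an inductive predicate: the product formula for cosines then makes
  them an algebra by a double induction.
\<close>

inductive trig_poly :: "(plane \<Rightarrow> real) \<Rightarrow> bool" where
  wave: "trig_poly (\<lambda>x. a * cos (wv k \<bullet> x + \<theta>))"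
| add: "trig_poly p \<Longrightarrow> trig_poly q \<Longrightarrow> trig_poly (\<lambda>x. p x + q x)"

lemma trig_poly_mult:
  assumes "trig_poly p" "trig_poly q"
  shows "trig_poly (\<lambda>x. p x * q x)"
  using assms
proof (induction p)
  case (wave a k \<theta>)
  from wave show ?case
  proof (induction q)
    case (wave b l \<eta>)
    have "(a * cos (wv k \<bullet> x + \<theta>)) * (b * cos (wv l \<bullet> x + \<eta>)) =
        (a * b / 2) * cos (wv (k - l) \<bullet> x + (\<theta> - \<eta>)) + (a * b / 2) * cos (wv (k + l) \<bullet> x + (\<theta> + \<eta>))" for x
    proof -
      have "(a * cos s) * (b * cos t) = (a * b / 2) * cos (s - t) + (a * b / 2) * cos (s + t)" for s t :: real
        by (simp add: cos_diff cos_add algebra_simps)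
      from this[of "wv k \<bullet> x + \<theta>" "wv l \<bullet> x + \<eta>"] show ?thesis
        by (simp only: wv_add wv_diff inner_add_left inner_diff_left) (simp add: algebra_simps)
    qed
    then show ?case
      by (simp only: ) (intro trig_poly.intros)
  next
    case (add p q)
    then show ?case
      by (simp only: distrib_left) (intro trig_poly.add)
  qed
next
  case (add p1 p2)
  then show ?case
    by (simp add: distrib_right trig_poly.add)
qed

lemma trig_poly_const: "trig_poly (\<lambda>x. c)"
  using trig_poly.wave[of c 0 0] by (simp add: wave_vector_def zero_prod_def[symmetric])

text \<open>
  The covering map of the torus, with values in a pair of unit circles.  Stone and Weierstrass
  cannot be applied on the cell, since periodic functions do not separate opposite edges; it is applied
  on the compact image of this map.
\<close>

definition circles :: "plane \<Rightarrow> complex \<times> complex" where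
  "circles x = (cis (2 * pi * fst x / L1), cis (2 * pi * snd x / L2))"

lemma continuous_circles: "continuous_on UNIV circles"
  unfolding circles_def using L1_pos L2_pos by (intro continuous_intros) auto

text \<open>
  A real linear functional of \<open>circles x\<close> is a combination of the cosines and sines of the two angles.
\<close>

lemma trig_poly_polynomial_circles:
  assumes "real_polynomial_function P"
  shows "trig_poly (\<lambda>x. P (circles x))"
  using assms
proof induction
  case (linear h)
  interpret bounded_linear h by fact
  have "h (circles x) = h (1, 0) * cos (wv (1, 0) \<bullet> x + 0) + h (\<i>, 0) * cos (wv (1, 0) \<bullet> x + (- pi / 2))
     + (h (0, 1) * cos (wv (0, 1) \<bullet> x + 0) + h (0, \<i>) * cos (wv (0, 1) \<bullet> x + (- pi / 2)))" for x
  proof -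
    define s t where "s = 2 * pi * fst x / L1" and "t = 2 * pi * snd x / L2"
    have "circles x = cos s *\<^sub>R (1, 0) + sin s *\<^sub>R (\<i>, 0) + cos t *\<^sub>R (0, 1) + sin t *\<^sub>R (0, \<i>)"
      by (simp add: circles_def s_def t_def complex_eq_iff)
    then have "h (circles x) = cos s * h (1, 0) + sin s * h (\<i>, 0) + cos t * h (0, 1) + sin t * h (0, \<i>)"
      by (simp only: add scaleR real_scaleR_def)
    moreover have "wv (1, 0) \<bullet> x = s" "wv (0, 1) \<bullet> x = t"
      by (simp_all add: wave_vector_def inner_prod_def s_def t_def)
    ultimately show ?thesis
      by (simp add: cos_diff)
  qed
  then show ?case
    by (simp only: ) (intro trig_poly.intros)
qed (auto intro: trig_poly.add trig_poly_mult trig_poly_const)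

text \<open>
  Completeness of the trigonometric system, for integrable functions.  By Stone and Weierstrass
  \<open>f\<close> is orthogonal to every continuous function of \<open>circles x\<close>, hence to the indicator of
  every Borel set of the two circles.  On the half-open cell the map \<open>circles\<close> has the Borel measurable
  inverse given by the arguments, so these indicators include those of all Borel subsets of the cell.
\<close>

lemma fourier_complete:
  fixes f :: "plane \<Rightarrow> real"
  assumes f: "set_integrable lborel Q f"
    and zero: "\<And>k \<theta>. (LINT x:Q|lborel. f x * cos (wv k \<bullet> x + \<theta>)) = 0"
  shows "AE x in lborel. x \<in> Q \<longrightarrow> f x = 0"
proof -
  \<comment> \<open>On the half-open cell \<open>circles\<close> is injective; the two edges removed are null sets.\<close>
  define Q' where "Q' = {x\<in>Q. fst x < L1 \<and> snd x < L2}"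
  have "Q' = Q \<inter> {..<L1} \<times> {..<L2}"
    by (auto simp: Q'_def)
  then have [measurable]: "Q' \<in> sets borel"
    by (simp only:) (intro sets.Int Q_borel borel_open open_Times open_lessThan)
  define F where "F x = indicator Q' x * f x" for x
  have edges: "AE x in lborel. x \<in> Q \<longrightarrow> x \<in> Q'"
  proof -
    have "AE x in lborel. fst x \<noteq> L1 \<and> snd x \<noteq> L2"
    proof -
      have 1: "{L1} \<times> UNIV \<in> null_sets (lborel :: plane measure)"
        by (simp add: null_sets_def lborel_prod[symmetric] lborel.emeasure_pair_measure_Times)
      have 2: "UNIV \<times> {L2} \<in> null_sets (lborel :: plane measure)"
        by (simp add: null_sets_def lborel_prod[symmetric] lborel.emeasure_pair_measure_Times)
      show ?thesis
        by (rule AE_I'[OF null_sets.Un[OF 1 2]]) auto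
    qed
    then show ?thesis
      by eventually_elim (auto simp: Q'_def period_cell_def)
  qed
  have f_int: "integrable lborel (\<lambda>x. indicator Q x * f x)"
    using f by (simp add: set_integrable_def)
  have F_eq: "F x = indicator Q' x * (indicator Q x * f x)" for x
    by (auto simp: F_def Q'_def indicator_def)
  have F_int: "integrable lborel F"
    unfolding F_eq[abs_def] using integrable_real_mult_indicator[OF _ f_int, of Q'] by (simp add: mult.commute)
  note [measurable] = borel_measurable_integrable[OF F_int] borel_measurable_integrable[OF f_int]
  have F_AE: "AE x in lborel. indicator Q x * f x = F x"
    using edges by eventually_elim (auto simp: F_def Q'_def indicator_def)
  have int_F_eq: "(LINT x|lborel. F x * h x) = (LINT x:Q|lborel. f x * h x)"
    if [measurable]: "h \<in> borel_measurable lborel" for h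
  proof -
    have "(LINT x|lborel. F x * h x) = (LINT x|lborel. (indicator Q x * f x) * h x)"
      by (rule integral_cong_AE) (use F_AE in \<open>auto elim: eventually_mono\<close>)
    then show ?thesis
      by (simp add: set_lebesgue_integral_def mult.assoc)
  qed
  have F_bounded_int: "integrable lborel (\<lambda>x. F x * h x)"
    if [measurable]: "h \<in> borel_measurable lborel" and "\<And>x. \<bar>h x\<bar> \<le> B" for h and B :: real
  proof (rule Bochner_Integration.integrable_bound)
    show "integrable lborel (\<lambda>x. B * F x)" using F_int by simp
    have "0 \<le> B" using that(2)[of undefined] by linarith
    then show "AE x in lborel. norm (F x * h x) \<le> norm (B * F x)"
      using that(2) by (auto simp: abs_mult mult.commute[of B] intro!: mult_left_mono)
  qed measurable
  have trig: "(LINT x|lborel. F x * p x) = 0 \<and> p \<in> borel_measurable lborel \<and> (\<exists>B. \<forall>x. \<bar>p x\<bar> \<le> B)"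
    if "trig_poly p" for p
    using that
  proof induction
    case (wave a k \<theta>)
    have "\<bar>a * cos (wv k \<bullet> x + \<theta>)\<bar> \<le> \<bar>a\<bar> * 1" for x
      unfolding abs_mult by (intro mult_left_mono) auto
    then show ?case
      using zero[of k \<theta>] by (auto simp: int_F_eq mult.left_commute[of _ a] intro!: exI[of _ "\<bar>a\<bar>"])
  next
    case (add p q)
    then obtain B C where BC: "\<And>x. \<bar>p x\<bar> \<le> B" "\<And>x. \<bar>q x\<bar> \<le> C"
      by auto
    then have "\<bar>p x + q x\<bar> \<le> B + C" for x
      by (meson abs_triangle_ineq add_mono order_trans)
    with add F_bounded_int[of p B] F_bounded_int[of q C] BC show ?case
      by (auto simp: distrib_left)
  qed
  have [measurable]: "circles \<in> borel_measurable borel"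
    by (rule borel_measurable_continuous_onI[OF continuous_circles])
  define K :: "(complex \<times> complex) set" where "K = sphere 0 1 \<times> sphere 0 1"
  have K: "compact K" "circles x \<in> K" for x
    by (auto simp: K_def circles_def intro: compact_Times)
  have cont: "(LINT x|lborel. F x * h (circles x)) = 0" if h: "continuous_on UNIV h" for h
  proof -
    have [measurable]: "h \<in> borel_measurable borel"
      by (rule borel_measurable_continuous_onI[OF h])
    have "\<bar>LINT x|lborel. F x * h (circles x)\<bar> \<le> 0 + e" if e: "0 < e" for e
    proof -
      define I where "I = (LINT x|lborel. \<bar>F x\<bar>)"
      have I: "0 \<le> I" by (simp add: I_def)
      have "0 < e / (I + 1)" using e I by simp
      then obtain p where p: "real_polynomial_function p" "\<And>z. z \<in> K \<Longrightarrow> \<bar>h z - p z\<bar> < e / (I + 1)"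
        using Stone_Weierstrass_real_polynomial_function[OF K(1) continuous_on_subset[OF h subset_UNIV]] by metis
      from trig[OF trig_poly_polynomial_circles[OF p(1)]] obtain B where
        B: "(LINT x|lborel. F x * p (circles x)) = 0" "(\<lambda>x. p (circles x)) \<in> borel_measurable lborel"
          "\<And>x. \<bar>p (circles x)\<bar> \<le> B"
        by auto
      note [measurable] = B(2)
      have "\<bar>h (circles x)\<bar> \<le> B + e / (I + 1)" for x
        using p(2)[OF K(2), of x] B(3)[of x] by linarith
      note ih = F_bounded_int[OF _ this]
      have ip: "integrable lborel (\<lambda>x. F x * p (circles x))"
        by (rule F_bounded_int[OF B(2) B(3)])
      have "(LINT x|lborel. F x * h (circles x)) = (LINT x|lborel. F x * h (circles x) - F x * p (circles x))"
        using B(1) ih ip by simp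
      also have "\<bar>\<dots>\<bar> \<le> (LINT x|lborel. \<bar>F x\<bar> * (e / (I + 1)))"
      proof (rule integral_abs_bound_integral)
        show "integrable lborel (\<lambda>x. F x * h (circles x) - F x * p (circles x))"
          using ih ip by simp
        show "integrable lborel (\<lambda>x. \<bar>F x\<bar> * (e / (I + 1)))"
          using F_int by simp
        show "\<bar>F x * h (circles x) - F x * p (circles x)\<bar> \<le> \<bar>F x\<bar> * (e / (I + 1))" for x
          unfolding right_diff_distrib[symmetric] abs_mult
          using p(2)[OF K(2), of x] by (intro mult_left_mono) auto
      qed
      also have "\<dots> = I / (I + 1) * e"
        by (simp add: I_def)
      also have "\<dots> \<le> 1 * e"
        using I e by (intro mult_right_mono) auto
      finally show ?thesis by simp
    qed
    then show ?thesis
      using field_le_epsilon[of "\<bar>LINT x|lborel. F x * h (circles x)\<bar>" 0] by simp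
  qed
  have borel: "(LINT x|lborel. F x * indicator B (circles x)) = 0" if "B \<in> sets borel" for B
    by (rule integral_zero_continuous_imp_borel[OF F_int _ cont that]) simp
  note [measurable] = borel_measurable_Arg2pi
  define A where "A z = (L1 * Arg2pi (fst z) / (2 * pi), L2 * Arg2pi (snd z) / (2 * pi))" for z :: "complex \<times> complex"
  have [measurable]: "A \<in> borel_measurable borel"
    unfolding A_def borel_prod[symmetric] by measurable
  have A_circles: "A (circles x) = x" if "x \<in> Q'" for x
  proof -
    have Arg_cis: "Arg2pi (cis \<theta>) = \<theta>" if "0 \<le> \<theta>" "\<theta> < 2 * pi" for \<theta>
      using that by (intro Arg2pi_unique[of 1]) (auto simp: cis_conv_exp)
    have "0 \<le> fst x" "fst x < L1" "0 \<le> snd x" "snd x < L2"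
      using that by (auto simp: Q'_def period_cell_def)
    then show ?thesis
      using L1_pos L2_pos unfolding A_def circles_def
      by (simp add: Arg_cis prod_eq_iff field_simps)
  qed
  have sets: "(LINT x|lborel. F x * indicator C x) = 0" if C [measurable]: "C \<in> sets borel" for C
  proof -
    have "A -` C \<in> sets borel"
      using measurable_sets[OF \<open>A \<in> borel_measurable borel\<close> C] by simp
    moreover have "F x * indicator C x = F x * indicator (A -` C) (circles x)" for x
      by (cases "x \<in> Q'") (auto simp: F_def A_circles indicator_def)
    ultimately show ?thesis
      using borel[of "A -` C"] by (simp only:)
  qed
  have "AE x in lborel. F x = 0"
    by (rule AE_zero_of_integral_indicator_zero[OF F_int]) (simp add: sets)
  with F_AE show ?thesis
    by eventually_elim (auto simp: indicator_def split: if_splits)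
qed

end

section \<open>Almost orthogonal series and Fourier modes\<close>

text \<open>
  The pattern of the real Fourier modes: \<open>k\<close> and \<open>- k\<close> need not be orthogonal.  Working with this relation
  avoids both complex Hilbert spaces and a choice of one representative of each pair \<open>k\<close>, \<open>- k\<close>.
\<close>

definition almost_orthogonal :: "('i::group_add \<Rightarrow> 'a::real_inner) \<Rightarrow> bool" where
  "almost_orthogonal x \<longleftrightarrow> (\<forall>k l. l \<noteq> k \<longrightarrow> l \<noteq> - k \<longrightarrow> x k \<bullet> x l = 0)"

lemma almost_orthogonal_scaleR:
  "almost_orthogonal x \<Longrightarrow> almost_orthogonal (\<lambda>k. a k *\<^sub>R x k)"
  by (simp add: almost_orthogonal_def)

text \<open>
  Each index meets only itself and its negative, and \<open>x k \<bullet> x l\<close> is at most the mean of the two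
  squared norms; so the cross terms cost at most a factor \<open>2\<close> compared with the theorem of Pythagoras.
\<close>

lemma norm_sum_almost_orthogonal:
  assumes x: "almost_orthogonal x" and F: "finite F"
  shows "(norm (\<Sum>k\<in>F. x k))\<^sup>2 \<le> 2 * (\<Sum>k\<in>F. (norm (x k))\<^sup>2)"
proof -
  define n where "n k = (norm (x k))\<^sup>2" for k
  have n: "0 \<le> n k" for k by (simp add: n_def)
  have "x k \<bullet> x l \<le> (if l = k then n k else 0) + (if l = - k then n k / 2 else 0) + (if k = - l then n l / 2 else 0)" for k l
  proof -
    have "x k \<bullet> x l \<le> n k / 2 + n l / 2"
      using norm_cauchy_schwarz[of "x k" "x l"] sum_squares_bound[of "norm (x k)" "norm (x l)"] by (simp add: n_def)
    moreover have "x k \<bullet> x k = n k"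
      by (simp add: n_def power2_norm_eq_inner)
    moreover have "k = - l \<longleftrightarrow> l = - k" by auto
    moreover have "x k \<bullet> x l = 0" if "l \<noteq> k" "l \<noteq> - k"
      using x that by (simp add: almost_orthogonal_def)
    ultimately show ?thesis
      using n[of k] n[of l] by (cases "l = k"; cases "l = - k") (simp_all split del: if_split)
  qed
  then have "(\<Sum>k\<in>F. \<Sum>l\<in>F. x k \<bullet> x l) \<le>
      (\<Sum>k\<in>F. \<Sum>l\<in>F. (if l = k then n k else 0) + (if l = - k then n k / 2 else 0) + (if k = - l then n l / 2 else 0))"
    by (intro sum_mono)
  also have "\<dots> = (\<Sum>k\<in>F. n k) + (\<Sum>k\<in>F. if - k \<in> F then n k / 2 else 0) + (\<Sum>l\<in>F. if - l \<in> F then n l / 2 else 0)"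
    using F by (simp add: sum.distrib sum.swap[of "\<lambda>k l. if k = - l then n l / 2 else 0"])
  also have "\<dots> \<le> (\<Sum>k\<in>F. n k) + (\<Sum>k\<in>F. n k / 2) + (\<Sum>k\<in>F. n k / 2)"
    using n by (intro add_mono sum_mono) auto
  also have "\<dots> = 2 * (\<Sum>k\<in>F. n k)"
    by (simp add: sum_divide_distrib[symmetric])
  finally show ?thesis
    by (simp add: power2_norm_eq_inner inner_sum_left inner_sum_right n_def sum.swap[of "\<lambda>k l. x l \<bullet> x k"])
qed

text \<open>
  The partial sums form a Cauchy filter because the squared norm of a difference is controlled by a
  piece of the tail of the series of squares.  The series need not converge absolutely: at
  time \<open>0\<close> the Fourier series of the initial datum is only of this kind.
\<close>

lemma summable_almost_orthogonal:
  fixes x :: "'i::group_add \<Rightarrow> 'a::{real_inner, banach}"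
  assumes x: "almost_orthogonal x" and sq: "(\<lambda>k. (norm (x k))\<^sup>2) summable_on UNIV"
  shows "x summable_on UNIV"
proof -
  define S where "S = (\<lambda>F. \<Sum>k\<in>F. (norm (x k))\<^sup>2)"
  obtain L where lim: "(S \<longlongrightarrow> L) (finite_subsets_at_top UNIV)"
    using sq unfolding summable_on_def has_sum_def S_def by blast
  have "\<exists>P. eventually P (finite_subsets_at_top UNIV) \<and>
      (\<forall>F F'. P F \<and> P F' \<longrightarrow> dist (sum x F) (sum x F') < e)" if e: "e > 0" for e
  proof -
    \<comment> \<open>Chosen so that \<open>2 * (2 * d) = (e / 2)\<^sup>2\<close>.\<close>
  define d where "d = e\<^sup>2 / 16"
    have d: "0 < d" using e by (simp add: d_def)
    then have "eventually (\<lambda>F. dist (S F) L < d) (finite_subsets_at_top UNIV)"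
      using lim by (simp add: tendsto_iff)
    then obtain F0 where F0: "finite F0" "\<And>F. finite F \<Longrightarrow> F0 \<subseteq> F \<Longrightarrow> dist (S F) L < d"
      by (auto simp: eventually_finite_subsets_at_top)
    have close: "dist (sum x F) (sum x F0) < e / 2" if F: "finite F" "F0 \<subseteq> F" for F
    proof -
      have "(dist (sum x F) (sum x F0))\<^sup>2 = (norm (sum x (F - F0)))\<^sup>2"
        unfolding dist_norm using F by (subst sum_diff) auto
      also have "\<dots> \<le> 2 * S (F - F0)"
        unfolding S_def using F by (intro norm_sum_almost_orthogonal x) auto
      also have "S (F - F0) = S F - S F0"
        unfolding S_def using F by (subst sum_diff) auto
      also have "2 * \<dots> < 2 * (2 * d)"
        using F0(2)[OF F] F0(2)[OF F0(1) order_refl] by (simp add: dist_real_def)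
      also have "\<dots> = (e / 2)\<^sup>2"
        by (simp add: d_def power2_eq_square)
      finally show ?thesis
        by (rule power_less_imp_less_base) (use e in simp)
    qed
    have "dist (sum x F) (sum x F') < e" if "finite F \<and> F0 \<subseteq> F" "finite F' \<and> F0 \<subseteq> F'" for F F'
      using dist_triangle_half_l[of "sum x F" "sum x F0" e "sum x F'"] close[of F] close[of F'] that
      by (simp add: dist_commute)
    moreover have "eventually (\<lambda>F. finite F \<and> F0 \<subseteq> F) (finite_subsets_at_top UNIV)"
      using F0(1) by (auto simp: eventually_finite_subsets_at_top)
    ultimately show ?thesis by blast
  qed
  then have "cauchy_filter (filtermap (sum x) (finite_subsets_at_top UNIV))"
    by (simp add: cauchy_filter_metric_filtermap)
  moreover have "complete (UNIV::'a set)"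
    by (meson Cauchy_convergent UNIV_I complete_def convergent_def)
  ultimately obtain L' where "(sum x \<longlongrightarrow> L') (finite_subsets_at_top UNIV)"
    using complete_uniform[where S = UNIV] by (force simp add: filterlim_def)
  then show ?thesis
    using summable_on_def has_sum_def by blast
qed

lemma almost_orthogonal_bound:
  fixes x :: "'i::group_add \<Rightarrow> 'a::{real_inner, banach}"
  assumes x: "almost_orthogonal x" and M: "\<And>F. finite F \<Longrightarrow> (\<Sum>k\<in>F. (norm (x k))\<^sup>2) \<le> M"
  shows "x summable_on UNIV" "(norm (\<Sum>\<^sub>\<infinity>k. x k))\<^sup>2 \<le> 2 * M"
proof -
  have "(\<lambda>k. (norm (x k))\<^sup>2) summable_on UNIV"
    by (intro nonneg_bdd_above_summable_on) (use M in \<open>auto simp: bdd_above_def\<close>)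
  then show sum: "x summable_on UNIV"
    by (rule summable_almost_orthogonal[OF x])
  then have "(sum x \<longlongrightarrow> infsum x UNIV) (finite_subsets_at_top UNIV)"
    using has_sum_infsum has_sum_def by blast
  then have "((\<lambda>F. (norm (sum x F))\<^sup>2) \<longlongrightarrow> (norm (infsum x UNIV))\<^sup>2) (finite_subsets_at_top UNIV)"
    by (intro tendsto_intros)
  moreover have "eventually (\<lambda>F. (norm (sum x F))\<^sup>2 \<le> 2 * M) (finite_subsets_at_top UNIV)"
    by (rule eventually_finite_subsets_at_top_weakI)
      (meson M norm_sum_almost_orthogonal[OF x] mult_left_mono order_trans zero_le_numeral)
  ultimately show "(norm (\<Sum>\<^sub>\<infinity>k. x k))\<^sup>2 \<le> 2 * M"
    by (rule tendsto_upperbound) simp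
qed

text \<open>
  The tails are small uniformly in \<open>t\<close>, so this is a uniform limit of finite sums.  It gives the continuity
  of \<open>S t \<phi>0\<close> down to \<open>t = 0\<close> as well as that of \<open>S s f\<close> for integrable \<open>f\<close> and \<open>s > 0\<close>.
\<close>

lemma continuous_on_almost_orthogonal_series:
  fixes x :: "'i::group_add \<Rightarrow> 'a::{real_inner, banach}" and a :: "'i \<Rightarrow> real \<Rightarrow> real"
  assumes x: "almost_orthogonal x" and M: "\<And>F. finite F \<Longrightarrow> (\<Sum>k\<in>F. (norm (x k))\<^sup>2) \<le> M"
    and a: "\<And>k. continuous_on I (a k)" "\<And>k t. t \<in> I \<Longrightarrow> \<bar>a k t\<bar> \<le> K"
  shows "continuous_on I (\<lambda>t. \<Sum>\<^sub>\<infinity>k. a k t *\<^sub>R x k)"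
proof (rule uniform_limit_theorem)
  define S where "S = (\<lambda>F. \<Sum>k\<in>F. (norm (x k))\<^sup>2)"
  show "\<forall>\<^sub>F F in finite_subsets_at_top UNIV. continuous_on I (\<lambda>t. \<Sum>k\<in>F. a k t *\<^sub>R x k)"
    using a(1) by (intro always_eventually allI continuous_intros) auto
  show "uniform_limit I (\<lambda>F t. \<Sum>k\<in>F. a k t *\<^sub>R x k) (\<lambda>t. \<Sum>\<^sub>\<infinity>k. a k t *\<^sub>R x k) (finite_subsets_at_top UNIV)"
  proof (rule uniform_limitI)
    fix e :: real assume e: "0 < e"
    \<comment> \<open>The summand \<open>1\<close> keeps the denominator positive when \<open>K = 0\<close>.\<close>
    define d where "d = (e / 2)\<^sup>2 / (2 * (K\<^sup>2 + 1))"
    have d: "0 < d" using e by (auto simp: d_def intro!: divide_pos_pos add_nonneg_pos)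
    have "(\<lambda>k. (norm (x k))\<^sup>2) summable_on UNIV"
      by (intro nonneg_bdd_above_summable_on) (use M in \<open>auto simp: bdd_above_def\<close>)
    then have sums: "((\<lambda>k. (norm (x k))\<^sup>2) has_sum (\<Sum>\<^sub>\<infinity>k. (norm (x k))\<^sup>2)) UNIV"
      by simp
    moreover have fin: "eventually finite (finite_subsets_at_top (UNIV :: 'i set))"
      by (rule eventually_finite_subsets_at_top_weakI) auto
    ultimately have "eventually (\<lambda>F. dist (S F) (\<Sum>\<^sub>\<infinity>k. (norm (x k))\<^sup>2) < d) (finite_subsets_at_top UNIV)"
      using d by (simp add: has_sum_def tendsto_iff S_def)
    then show "\<forall>\<^sub>F F in finite_subsets_at_top UNIV. \<forall>t\<in>I. dist (\<Sum>k\<in>F. a k t *\<^sub>R x k) (\<Sum>\<^sub>\<infinity>k. a k t *\<^sub>R x k) < e"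
      using fin
    proof eventually_elim
      case (elim F)
      show ?case
      proof
        fix t assume t: "t \<in> I"
        \<comment> \<open>The tail of the series beyond \<open>F\<close>, again almost orthogonal.\<close>
        define y where "y k = (if k \<in> F then 0 else a k t) *\<^sub>R x k" for k
        have y: "almost_orthogonal y"
          unfolding y_def by (rule almost_orthogonal_scaleR[OF x])
        have sum_y: "(\<Sum>k\<in>G. (norm (y k))\<^sup>2) \<le> K\<^sup>2 * d" if G: "finite G" for G
        proof -
          have "(\<Sum>k\<in>G. (norm (y k))\<^sup>2) = (\<Sum>k\<in>G - F. (norm (y k))\<^sup>2)"
            using G by (intro sum.mono_neutral_right) (auto simp: y_def)
          also have "\<dots> \<le> (\<Sum>k\<in>G - F. K\<^sup>2 * (norm (x k))\<^sup>2)"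
            using a(2)[OF t] by (intro sum_mono) (auto simp: y_def power_mult_distrib abs_le_square_iff[symmetric] intro!: mult_right_mono order_trans[OF _ abs_ge_self])
          also have "\<dots> = K\<^sup>2 * (S (F \<union> G) - S F)"
            using elim(2) G sum_diff[of "F \<union> G" F "\<lambda>k. (norm (x k))\<^sup>2"]
            by (simp add: sum_distrib_left[symmetric] S_def Un_Diff)
          also have "S (F \<union> G) \<le> (\<Sum>\<^sub>\<infinity>k. (norm (x k))\<^sup>2)"
            using finite_sum_le_has_sum[OF sums, of "F \<union> G"] elim(2) G by (simp add: S_def)
          also have "(\<Sum>\<^sub>\<infinity>k. (norm (x k))\<^sup>2) - S F \<le> d"
            using elim(1) by (simp add: dist_real_def)
          finally show ?thesis by (simp add: mult_left_mono)
        qed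
        have sy: "y summable_on UNIV" and ny: "(norm (infsum y UNIV))\<^sup>2 \<le> 2 * (K\<^sup>2 * d)"
          using almost_orthogonal_bound[OF y sum_y] by auto
        have "(y has_sum infsum y UNIV) UNIV" using sy by simp
        moreover have "((\<lambda>k. if k \<in> F then a k t *\<^sub>R x k else 0) has_sum (\<Sum>k\<in>F. a k t *\<^sub>R x k)) UNIV"
          using has_sum_finite[OF elim(2), of "\<lambda>k. a k t *\<^sub>R x k"]
          by (subst has_sum_cong_neutral[where T = F and g = "\<lambda>k. a k t *\<^sub>R x k"]) auto
        ultimately have "((\<lambda>k. y k + (if k \<in> F then a k t *\<^sub>R x k else 0)) has_sum infsum y UNIV + (\<Sum>k\<in>F. a k t *\<^sub>R x k)) UNIV"
          by (rule has_sum_add)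
        moreover have "y k + (if k \<in> F then a k t *\<^sub>R x k else 0) = a k t *\<^sub>R x k" for k
          by (simp add: y_def)
        ultimately have "(\<Sum>\<^sub>\<infinity>k. a k t *\<^sub>R x k) = infsum y UNIV + (\<Sum>k\<in>F. a k t *\<^sub>R x k)"
          by (simp add: infsumI)
        then have "(dist (\<Sum>k\<in>F. a k t *\<^sub>R x k) (\<Sum>\<^sub>\<infinity>k. a k t *\<^sub>R x k))\<^sup>2 = (norm (infsum y UNIV))\<^sup>2"
          by (simp add: dist_norm norm_minus_commute)
        also have "\<dots> \<le> 2 * (K\<^sup>2 * d)" by (rule ny)
        also have "\<dots> \<le> 2 * ((K\<^sup>2 + 1) * d)" using d by simp
        also have "\<dots> = (e / 2)\<^sup>2"
        proof -
          have "2 * (c * (q / (2 * c))) = q" if "0 < c" for c q :: real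
            using that by simp
          from this[OF add_nonneg_pos[OF zero_le_power2[of K] zero_less_one]] show ?thesis
            by (simp only: d_def)
        qed
        finally have "dist (\<Sum>k\<in>F. a k t *\<^sub>R x k) (\<Sum>\<^sub>\<infinity>k. a k t *\<^sub>R x k) \<le> e / 2"
          by (rule power2_le_imp_le) (use e in simp)
        then show "dist (\<Sum>k\<in>F. a k t *\<^sub>R x k) (\<Sum>\<^sub>\<infinity>k. a k t *\<^sub>R x k) < e"
          using e by simp
      qed
    qed
  qed
qed simp


lemma Re_mult_cis: "Re (c * cis t) = cmod c * cos (t + Arg c)"
proof -
  have "c * cis t = of_real (cmod c) * cis (t + Arg c)"
    using rcis_cmod_Arg[of c] by (metis add.commute cis_mult mult.assoc rcis_def)
  then show ?thesis by simp
qed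

context torus
begin

lemma square_integrable_cell:
  fixes f :: "plane \<Rightarrow> 'b::euclidean_space"
  assumes f: "continuous_on UNIV f"
  shows "square_integrable (\<lambda>x. indicator Q x *\<^sub>R f x)"
  unfolding square_integrable_def
proof
  have [measurable]: "f \<in> borel_measurable borel"
    by (rule borel_measurable_continuous_onI[OF f])
  show "(\<lambda>x. indicator Q x *\<^sub>R f x) \<in> borel_measurable lborel"
    by measurable
  have "integrable lborel (\<lambda>x. indicator Q x *\<^sub>R (norm (f x))\<^sup>2)"
    by (intro borel_integrable_compact compact_Q continuous_intros continuous_on_subset[OF f]) auto
  moreover have "(\<lambda>x. indicator Q x *\<^sub>R (norm (f x))\<^sup>2) = (\<lambda>x. (norm (indicator Q x *\<^sub>R f x))\<^sup>2)"
    by (auto simp: indicator_def)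
  ultimately show "integrable lborel (\<lambda>x. (norm (indicator Q x *\<^sub>R f x))\<^sup>2)"
    by simp
qed

text \<open>
  The cell has finite measure, and \<open>r \<le> 1 + r\<^sup>2\<close>.
\<close>

lemma set_integrable_square_integrable:
  fixes f :: "plane \<Rightarrow> 'b::euclidean_space"
  assumes f: "square_integrable f"
  shows "set_integrable lborel Q f"
  unfolding set_integrable_def
proof (rule Bochner_Integration.integrable_bound)
  have [measurable]: "f \<in> borel_measurable borel"
    using f by (simp add: square_integrable_def)
  show "integrable lborel (\<lambda>x. indicator Q x + (norm (f x))\<^sup>2)"
    using f emeasure_Q_finite by (intro Bochner_Integration.integrable_add) (auto simp: square_integrable_def)
  have "t \<le> 1 + t\<^sup>2" for t :: real
    using zero_le_power2[of "t - 1"] zero_le_power2[of t] unfolding power2_diff one_power2 by linarith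
  then show "AE x in lborel. norm (indicator Q x *\<^sub>R f x) \<le> norm (indicator Q x + (norm (f x))\<^sup>2 :: real)"
    by (auto simp: indicator_def)
  show "(\<lambda>x. indicator Q x *\<^sub>R f x) \<in> borel_measurable lborel"
    by measurable
qed

lemma inner_to_L2_torus:
  fixes f :: "plane \<Rightarrow> 'b::euclidean_space"
  assumes f: "square_integrable (\<lambda>x. indicator Q x *\<^sub>R f x)"
  shows "u \<bullet> to_L2_torus L1 L2 f = (LINT x:Q|lborel. rep_L2 u x \<bullet> f x)"
  using inner_L2.abs_eq[of "rep_L2 u" "\<lambda>x. indicator Q x *\<^sub>R f x"] f
  by (simp add: to_L2_torus_def set_lebesgue_integral_def)

text \<open>
  The vector \<open>y\<close> makes scalar modes (\<open>y = 1\<close>) and their gradients (\<open>y = wv k\<close>, with \<open>\<i> * c\<close> in place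
  of \<open>c\<close>) instances of one notion.
\<close>

definition mode :: "int \<times> int \<Rightarrow> complex \<Rightarrow> 'b::euclidean_space \<Rightarrow> 'b L2" where
  "mode k c y = to_L2_torus L1 L2 (\<lambda>x. Re (c * cis (wv k \<bullet> x)) *\<^sub>R y)"

lemma square_integrable_mode: "square_integrable (\<lambda>x. indicator Q x *\<^sub>R (Re (c * cis (wv k \<bullet> x)) *\<^sub>R y))"
  by (intro square_integrable_cell continuous_intros)

lemma inner_mode: "mode k c y \<bullet> mode l d z =
  (y \<bullet> z) * (LINT x:Q|lborel. Re (c * cis (wv k \<bullet> x)) * Re (d * cis (wv l \<bullet> x)))"
proof -
  have "mode k c y \<bullet> mode l d z =
    (LINT x|lborel. (indicator Q x *\<^sub>R (Re (c * cis (wv k \<bullet> x)) *\<^sub>R y)) \<bullet> (indicator Q x *\<^sub>R (Re (d * cis (wv l \<bullet> x)) *\<^sub>R z)))"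
    unfolding mode_def to_L2_torus_def
    by (rule inner_L2.abs_eq) (simp_all only: simp_thms square_integrable_mode eventually_True)
  also have "\<dots> = (LINT x|lborel. (y \<bullet> z) * (indicator Q x *\<^sub>R (Re (c * cis (wv k \<bullet> x)) * Re (d * cis (wv l \<bullet> x)))))"
    by (intro Bochner_Integration.integral_cong) (auto simp: indicator_def algebra_simps)
  finally show ?thesis
    by (simp add: set_lebesgue_integral_def)
qed

lemma almost_orthogonal_mode: "almost_orthogonal (\<lambda>k. mode k (c k) (y k))"
  unfolding almost_orthogonal_def
proof (intro allI impI)
  fix k l :: "int \<times> int" assume kl: "l \<noteq> k" "l \<noteq> - k"
  have "(LINT x:Q|lborel. Re (c k * cis (wv k \<bullet> x)) * Re (c l * cis (wv l \<bullet> x))) =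
     (LINT x:Q|lborel. (cmod (c k) * cmod (c l)) * (cos (wv k \<bullet> x + Arg (c k)) * cos (wv l \<bullet> x + Arg (c l))))"
    unfolding Re_mult_cis by (simp add: mult_ac)
  also have "\<dots> = 0"
    using integral_cos_wave_product[OF kl] by simp
  finally show "mode k (c k) (y k) \<bullet> mode l (c l) (y l) = 0"
    by (simp add: inner_mode)
qed

lemma norm_mode: "norm (mode k c y) \<le> cmod c * norm y * sqrt area"
proof -
  have "(norm (mode k c y))\<^sup>2 = (norm y)\<^sup>2 * (LINT x:Q|lborel. (Re (c * cis (wv k \<bullet> x)))\<^sup>2)"
    by (simp add: power2_norm_eq_inner inner_mode) (simp add: power2_eq_square)
  also have "(LINT x:Q|lborel. (Re (c * cis (wv k \<bullet> x)))\<^sup>2) \<le> (LINT x:Q|lborel. (cmod c)\<^sup>2)"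
  proof (rule set_integral_mono)
    show "(Re (c * cis (wv k \<bullet> x)))\<^sup>2 \<le> (cmod c)\<^sup>2" for x
      using abs_Re_le_cmod[of "c * cis (wv k \<bullet> x)"]
      by (simp add: norm_mult abs_le_square_iff[symmetric])
  qed (intro set_integrable_continuous_Q continuous_intros)+
  also have "\<dots> = (cmod c)\<^sup>2 * area"
    using measure_Q emeasure_Q_finite by (simp add: set_lebesgue_integral_def mult.commute)
  finally have "(norm (mode k c y))\<^sup>2 \<le> (norm y)\<^sup>2 * ((cmod c)\<^sup>2 * area)"
    by (simp add: mult_left_mono)
  also have "\<dots> = (cmod c * norm y * sqrt area)\<^sup>2"
    using area_pos by (simp add: power_mult_distrib)
  finally show ?thesis
    by (rule power2_le_imp_le) (use area_pos in simp)
qed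

lemma mode_add: "mode k (c + d) y = mode k c y + mode k d y"
  unfolding mode_def to_L2_torus_def
  by (subst abs_L2_add[OF square_integrable_mode square_integrable_mode]) (simp add: distrib_right scaleR_add_left scaleR_add_right)

lemma mode_scaleR: "mode k (r *\<^sub>R c) y = r *\<^sub>R mode k c y"
  unfolding mode_def to_L2_torus_def
  by (subst abs_L2_scaleR[OF square_integrable_mode]) (simp add: mult_ac)

lemma bounded_linear_mode: "bounded_linear (\<lambda>c. mode k c y)"
  by (rule bounded_linear_intro[where K = "norm y * sqrt area"])
    (use norm_mode[of k _ y] in \<open>simp_all add: mode_add mode_scaleR mult.assoc\<close>)

abbreviation fc :: "(plane \<Rightarrow> real) \<Rightarrow> int \<times> int \<Rightarrow> complex" where
  "fc \<equiv> fourier_coeff L1 L2"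

lemma set_integrable_fourier:
  assumes "set_integrable lborel Q f"
  shows "set_integrable lborel Q (\<lambda>x. f x *\<^sub>R cis (a * (w \<bullet> x)))"
  unfolding set_integrable_def
proof (rule Bochner_Integration.integrable_bound)
  have f: "integrable lborel (\<lambda>x. indicator Q x *\<^sub>R f x)"
    using assms by (simp add: set_integrable_def)
  then show "integrable lborel (\<lambda>x. indicator Q x *\<^sub>R f x)" .
  note [measurable] = borel_measurable_integrable[OF f]
  have "(\<lambda>x::plane. cis (a * (w \<bullet> x))) \<in> borel_measurable borel"
    by (intro borel_measurable_continuous_onI continuous_intros)
  then have "(\<lambda>x. (indicator Q x *\<^sub>R f x) *\<^sub>R cis (a * (w \<bullet> x))) \<in> borel_measurable lborel"
    by measurable
  then show "(\<lambda>x. indicator Q x *\<^sub>R f x *\<^sub>R cis (a * (w \<bullet> x))) \<in> borel_measurable lborel"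
    by (simp add: scaleR_scaleR)
qed auto

text \<open>
  Pairing with a mode recovers the coefficient; this is the only link between coefficients and
  inner products that is needed.
\<close>

lemma fourier_coeff_dual:
  assumes f: "set_integrable lborel Q f"
  shows "area * Re (c * cnj (fc f k)) = (LINT x:Q|lborel. f x * Re (c * cis (wv k \<bullet> x)))"
proof -
  have lin: "bounded_linear (\<lambda>z. Re (c * cnj z))"
    by (intro bounded_linear_compose[OF bounded_linear_Re] bounded_linear_compose[OF bounded_linear_mult_right]
        bounded_linear_cnj)
  have int: "integrable lborel (\<lambda>x. indicator Q x *\<^sub>R f x *\<^sub>R cis (- (wv k \<bullet> x)))"
    using set_integrable_fourier[OF f, of "- 1" "wv k"] by (simp add: set_integrable_def)
  have "Re (c * cnj (fc f k)) = (1 / area) * Re (c * cnj (LINT x:Q|lborel. f x *\<^sub>R cis (- (wv k \<bullet> x))))"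
    by (simp add: fourier_coeff_def area_def algebra_simps)
  also have "Re (c * cnj (LINT x:Q|lborel. f x *\<^sub>R cis (- (wv k \<bullet> x)))) =
     (LINT x|lborel. Re (c * cnj (indicator Q x *\<^sub>R f x *\<^sub>R cis (- (wv k \<bullet> x)))))"
    unfolding set_lebesgue_integral_def by (rule integral_bounded_linear[OF lin int, symmetric])
  also have "\<dots> = (LINT x:Q|lborel. f x * Re (c * cis (wv k \<bullet> x)))"
    unfolding set_lebesgue_integral_def
    by (intro Bochner_Integration.integral_cong) (auto simp: cis_cnj algebra_simps)
  finally show ?thesis
    using area_pos by simp
qed

lemma norm_fourier_coeff:
  assumes "set_integrable lborel Q f"
  shows "cmod (fc f k) \<le> (LINT x:Q|lborel. \<bar>f x\<bar>) / area"
proof -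
  have "cmod (LINT x:Q|lborel. f x *\<^sub>R cis (- (wv k \<bullet> x))) \<le> (LINT x|lborel. norm (indicator Q x *\<^sub>R f x *\<^sub>R cis (- (wv k \<bullet> x))))"
    unfolding set_lebesgue_integral_def by (rule integral_norm_bound)
  also have "\<dots> = (LINT x:Q|lborel. \<bar>f x\<bar>)"
    unfolding set_lebesgue_integral_def by (intro Bochner_Integration.integral_cong) (auto simp: abs_mult)
  finally show ?thesis
    using area_pos by (simp add: fourier_coeff_def area_def[symmetric] norm_divide divide_right_mono)
qed

lemma fourier_coeff_cong:
  assumes "AE x in lborel. x \<in> Q \<longrightarrow> f x = g x"
    and "set_integrable lborel Q f" "set_integrable lborel Q g"
  shows "fc f k = fc g k"
  unfolding fourier_coeff_def set_lebesgue_integral_def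
proof (intro arg_cong[where f = "scaleR _"] integral_cong_AE)
  show "AE x in lborel. indicator Q x *\<^sub>R f x *\<^sub>R cis (- (wv k \<bullet> x)) = indicator Q x *\<^sub>R g x *\<^sub>R cis (- (wv k \<bullet> x))"
    using assms(1) by eventually_elim (auto simp: indicator_def)
qed (use set_integrable_fourier[OF assms(2), of "- 1" "wv k"] set_integrable_fourier[OF assms(3), of "- 1" "wv k"]
    in \<open>auto simp: set_integrable_def dest: borel_measurable_integrable\<close>)

lemma fourier_coeff_add:
  assumes "set_integrable lborel Q f" "set_integrable lborel Q g"
  shows "fc (\<lambda>x. f x + g x) k = fc f k + fc g k"
  using set_integrable_fourier[OF assms(1), of "- 1" "wv k"] set_integrable_fourier[OF assms(2), of "- 1" "wv k"]
  by (simp add: fourier_coeff_def scaleR_add_left set_integral_add scaleR_add_right)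

lemma fourier_coeff_scaleR: "fc (\<lambda>x. r * f x) k = r *\<^sub>R fc f k"
  by (simp add: fourier_coeff_def set_lebesgue_integral_def scaleR_scaleR[symmetric] scaleR_left_commute[of _ r] del: scaleR_scaleR)

text \<open>
  Bessel's inequality up to a factor, by duality: pairing \<open>u\<close> with \<open>x = (\<Sum>k\<in>F. mode k (fc u k) 1)\<close> yields
  \<open>area\<close> times the sum of squares, while \<open>norm_sum_almost_orthogonal\<close> bounds the norm of \<open>x\<close> by the root of
  the same sum.
\<close>

lemma bessel:
  fixes u :: "real L2"
  assumes F: "finite F"
  shows "(\<Sum>k\<in>F. (cmod (fc (rep_L2 u) k))\<^sup>2) \<le> 2 * (norm u)\<^sup>2 / area"
proof -
  define S where "S = (\<Sum>k\<in>F. (cmod (fc (rep_L2 u) k))\<^sup>2)"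
  define x where "x k = mode k (fc (rep_L2 u) k) (1::real)" for k
  have S: "0 \<le> S" by (simp add: S_def sum_nonneg)
  have "u \<bullet> x k = area * (cmod (fc (rep_L2 u) k))\<^sup>2" for k
  proof -
    have "u \<bullet> x k = (LINT x:Q|lborel. rep_L2 u x * Re (fc (rep_L2 u) k * cis (wv k \<bullet> x)))"
      unfolding x_def mode_def by (subst inner_to_L2_torus[OF square_integrable_mode]) simp
    also have "\<dots> = area * Re (fc (rep_L2 u) k * cnj (fc (rep_L2 u) k))"
      by (intro fourier_coeff_dual[symmetric] set_integrable_square_integrable) simp
    finally show ?thesis
      by (simp only: complex_norm_square[symmetric] Re_complex_of_real)
  qed
  then have "area * S = u \<bullet> (\<Sum>k\<in>F. x k)"
    by (simp add: S_def sum_distrib_left inner_sum_right)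
  also have "\<dots> \<le> norm u * norm (\<Sum>k\<in>F. x k)"
    by (rule norm_cauchy_schwarz)
  finally have "(area * S)\<^sup>2 \<le> (norm u * norm (\<Sum>k\<in>F. x k))\<^sup>2"
    using S area_pos by (intro power_mono) auto
  also have "\<dots> \<le> (norm u)\<^sup>2 * (2 * (\<Sum>k\<in>F. (norm (x k))\<^sup>2))"
    unfolding power_mult_distrib
    by (intro mult_left_mono norm_sum_almost_orthogonal F) (simp_all add: x_def almost_orthogonal_mode)
  also have "(\<Sum>k\<in>F. (norm (x k))\<^sup>2) \<le> (\<Sum>k\<in>F. (cmod (fc (rep_L2 u) k))\<^sup>2 * area)"
  proof (rule sum_mono)
    fix k
    have "(norm (x k))\<^sup>2 \<le> (cmod (fc (rep_L2 u) k) * norm (1::real) * sqrt area)\<^sup>2"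
      unfolding x_def by (intro power_mono norm_mode) simp
    then show "(norm (x k))\<^sup>2 \<le> (cmod (fc (rep_L2 u) k))\<^sup>2 * area"
      using area_pos by (simp add: power_mult_distrib)
  qed
  also have "\<dots> = S * area"
    by (simp add: S_def sum_distrib_right)
  finally have "(area * S)\<^sup>2 \<le> (norm u)\<^sup>2 * (2 * (S * area))"
    by (simp add: mult_left_mono)
  then have "(area * S) * (area * S) \<le> (2 * (norm u)\<^sup>2) * (area * S)"
    by (simp add: power2_eq_square mult_ac)
  then have "area * S \<le> 2 * (norm u)\<^sup>2"
    using S area_pos by (cases "S = 0") auto
  then show ?thesis
    using area_pos by (simp add: S_def pos_le_divide_eq mult.commute)
qed

end

section \<open>Smoothing by the symbol\<close>

lemma sum_power_abs_int:
  fixes q :: real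
  assumes q: "0 \<le> q" "q < 1"
  shows "(\<Sum>j\<in>{- int N..int N}. q ^ nat \<bar>j\<bar>) \<le> 2 / (1 - q)"
proof -
  have geo: "(\<Sum>j\<le>N. q ^ j) \<le> 1 / (1 - q)"
    using q sum_gp0[of q N] by (simp add: divide_right_mono)
  have "{- int N..int N} \<subseteq> int ` {..N} \<union> (\<lambda>j. - int j) ` {..N}"
  proof
    fix j assume "j \<in> {- int N..int N}"
    then show "j \<in> int ` {..N} \<union> (\<lambda>j. - int j) ` {..N}"
      by (cases "0 \<le> j") (auto intro!: image_eqI[of _ _ "nat \<bar>j\<bar>"])
  qed
  then have "(\<Sum>j\<in>{- int N..int N}. q ^ nat \<bar>j\<bar>) \<le> (\<Sum>j\<in>int ` {..N} \<union> (\<lambda>j. - int j) ` {..N}. q ^ nat \<bar>j\<bar>)"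
    using q by (intro sum_mono2) auto
  also have "\<dots> \<le> (\<Sum>j\<in>int ` {..N}. q ^ nat \<bar>j\<bar>) + (\<Sum>j\<in>(\<lambda>j. - int j) ` {..N}. q ^ nat \<bar>j\<bar>)"
    using q by (subst sum_Un) (auto intro!: sum_nonneg)
  also have "\<dots> = (\<Sum>j\<le>N. q ^ j) + (\<Sum>j\<le>N. q ^ j)"
    by (simp add: sum.reindex inj_on_def)
  also have "\<dots> \<le> 2 / (1 - q)"
    using geo by simp
  finally show ?thesis .
qed

text \<open>
  The sum factorizes over the two coordinates, and \<open>1 / (1 - exp (- \<rho>)) \<le> 1 + 1 / \<rho>\<close>.
\<close>

lemma lattice_sum_exp:
  assumes F: "finite F" and \<rho>: "0 < \<rho>"
  shows "(\<Sum>k\<in>F. exp (- \<rho> * (\<bar>real_of_int (fst k)\<bar> + \<bar>real_of_int (snd k)\<bar>))) \<le> (2 * (1 + 1 / \<rho>))\<^sup>2"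
proof -
  define q where "q = exp (- \<rho>)"
  have q: "0 \<le> q" "q < 1" using \<rho> by (auto simp: q_def)
  have factor: "exp (- \<rho> * (\<bar>real_of_int (fst k)\<bar> + \<bar>real_of_int (snd k)\<bar>)) = q ^ nat \<bar>fst k\<bar> * q ^ nat \<bar>snd k\<bar>" for k :: "int \<times> int"
  proof -
    have "q ^ nat \<bar>j\<bar> = exp (- \<rho> * \<bar>real_of_int j\<bar>)" for j
      unfolding q_def by (subst exp_of_nat_mult[symmetric]) (simp add: mult.commute)
    then show ?thesis by (simp add: exp_add[symmetric] algebra_simps)
  qed
  obtain N :: nat where N: "F \<subseteq> {- int N..int N} \<times> {- int N..int N}"
  proof -
    define N where "N = (\<Sum>k\<in>F. nat \<bar>fst k\<bar> + nat \<bar>snd k\<bar>)"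
    have "nat \<bar>fst k\<bar> + nat \<bar>snd k\<bar> \<le> N" if "k \<in> F" for k
      unfolding N_def using F that by (intro member_le_sum) auto
    then have "F \<subseteq> {- int N..int N} \<times> {- int N..int N}"
      by (force simp: mem_Times_iff)
    then show ?thesis by (rule that)
  qed
  have "(\<Sum>k\<in>F. q ^ nat \<bar>fst k\<bar> * q ^ nat \<bar>snd k\<bar>) \<le>
      (\<Sum>k\<in>{- int N..int N} \<times> {- int N..int N}. q ^ nat \<bar>fst k\<bar> * q ^ nat \<bar>snd k\<bar>)"
    using N q by (intro sum_mono2) auto
  also have "\<dots> = (\<Sum>j\<in>{- int N..int N}. q ^ nat \<bar>j\<bar>)\<^sup>2"
    by (simp add: power2_eq_square sum_product sum.cartesian_product case_prod_unfold)
  also have "\<dots> \<le> (2 / (1 - q))\<^sup>2"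
    using q by (intro power_mono sum_power_abs_int sum_nonneg) auto
  also have "\<dots> \<le> (2 * (1 + 1 / \<rho>))\<^sup>2"
  proof (intro power_mono)
    have "1 + \<rho> \<le> exp \<rho>" by (rule exp_ge_add_one_self)
    then have "q \<le> 1 / (1 + \<rho>)"
      using \<rho> by (simp add: q_def exp_minus field_simps)
    then have "\<rho> / (1 + \<rho>) \<le> 1 - q"
      using \<rho> by (simp add: field_simps)
    then have "2 / (1 - q) \<le> 2 / (\<rho> / (1 + \<rho>))"
      using \<rho> q by (intro divide_left_mono mult_pos_pos) auto
    also have "\<dots> = 2 * (1 + 1 / \<rho>)"
      using \<rho> by (simp add: field_simps)
    finally show "2 / (1 - q) \<le> 2 * (1 + 1 / \<rho>)" .
  qed (use q in auto)
  finally show ?thesis by (simp only: factor)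
qed

context torus
begin

definition symbol :: "int \<times> int \<Rightarrow> real" where
  "symbol k = norm (wv k) ^ 4 - norm (wv k) ^ 2"

lemma symbol_ge: "- 1 \<le> symbol k"
proof -
  have "0 \<le> ((norm (wv k))\<^sup>2 - 1)\<^sup>2" by simp
  then have "2 * (norm (wv k))\<^sup>2 \<le> norm (wv k) ^ 4 + 1"
    by (simp add: power2_diff power_mult[symmetric])
  moreover have "0 \<le> norm (wv k) ^ 4" by simp
  ultimately show ?thesis unfolding symbol_def by linarith
qed

text \<open>
  The symbol dominates \<open>(\<bar>wv k\<bar>\<^sup>4 - 1) / 2\<close>, and in the rescaled variable \<open>x\<close> a Gaussian-like factor
  \<open>exp (- x ^ 4)\<close> beats any polynomial.  A plain exponential is kept on the right because it turns the sum over
  the lattice into a geometric series.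
\<close>

lemma multiplier_bound:
  assumes s: "0 < s" "s \<le> 1" and x: "x = s powr (1/4) * norm (wv k)"
  shows "exp (- 2 * s * symbol k) \<le> exp 3 * exp (- x)"
    "x\<^sup>2 * exp (- 2 * s * symbol k) \<le> exp 3 * exp (- x)"
proof -
  define r where "r = norm (wv k)"
  have x0: "0 \<le> x" by (simp add: x)
  have "(s powr (1/4)) ^ 4 = s"
    using s by (simp add: powr_realpow[symmetric] powr_powr)
  then have x4: "x ^ 4 = s * r ^ 4"
    by (simp add: x r_def power_mult_distrib)
  have "0 \<le> (r\<^sup>2 - 1)\<^sup>2" by simp
  then have "r ^ 4 - 1 \<le> 2 * symbol k"
    by (simp add: power2_diff power_mult[symmetric] symbol_def r_def)
  then have "s * (r ^ 4 - 1) \<le> s * (2 * symbol k)"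
    using s by (intro mult_left_mono) auto
  then have e: "- 2 * s * symbol k \<le> 1 - x ^ 4"
    using s by (simp add: x4 algebra_simps)
  have q: "0 \<le> (x\<^sup>2 - 1)\<^sup>2" "0 \<le> (x - 1)\<^sup>2" "0 \<le> x\<^sup>2" "0 \<le> x ^ 4"
    by simp_all
  then have q': "2 * x\<^sup>2 \<le> x ^ 4 + 1" "2 * x \<le> x\<^sup>2 + 1"
    by (simp_all add: power2_diff power_mult[symmetric])
  have "- 2 * s * symbol k \<le> 3 + - x"
    using e q' q(3) by linarith
  then show "exp (- 2 * s * symbol k) \<le> exp 3 * exp (- x)"
    by (simp only: exp_add[symmetric] exp_le_cancel_iff)
  have "x\<^sup>2 \<le> exp (x\<^sup>2)"
    using exp_ge_add_one_self[of "x\<^sup>2"] by linarith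
  then have "x\<^sup>2 * exp (- 2 * s * symbol k) \<le> exp (x\<^sup>2) * exp (- 2 * s * symbol k)"
    by (intro mult_right_mono) auto
  also have "\<dots> \<le> exp 3 * exp (- x)"
    using e q' q(3) unfolding exp_add[symmetric] exp_le_cancel_iff by linarith
  finally show "x\<^sup>2 * exp (- 2 * s * symbol k) \<le> exp 3 * exp (- x)" .
qed

text \<open>
  The factor \<open>1/2\<close> lets a sum of two components be compared with the Euclidean norm.
\<close>

definition wmin :: real where "wmin = min (2 * pi / L1) (2 * pi / L2) / 2"

lemma wmin_pos: "0 < wmin"
  using L1_pos L2_pos by (simp add: wmin_def)

lemma norm_wv_ge: "wmin * (\<bar>real_of_int (fst k)\<bar> + \<bar>real_of_int (snd k)\<bar>) \<le> norm (wv k)"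
proof -
  have "2 * wmin * \<bar>real_of_int (fst k)\<bar> \<le> 2 * pi / L1 * \<bar>real_of_int (fst k)\<bar>"
    by (intro mult_right_mono) (auto simp: wmin_def)
  also have "\<dots> = \<bar>fst (wv k)\<bar>"
    using L1_pos by (simp add: wave_vector_def abs_mult)
  also have "\<dots> \<le> norm (wv k)"
    using norm_fst_le[of "fst (wv k)" "snd (wv k)"] by simp
  finally have 1: "2 * wmin * \<bar>real_of_int (fst k)\<bar> \<le> norm (wv k)" .
  have "2 * wmin * \<bar>real_of_int (snd k)\<bar> \<le> 2 * pi / L2 * \<bar>real_of_int (snd k)\<bar>"
    by (intro mult_right_mono) (auto simp: wmin_def)
  also have "\<dots> = \<bar>snd (wv k)\<bar>"
    using L2_pos by (simp add: wave_vector_def abs_mult)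
  also have "\<dots> \<le> norm (wv k)"
    using norm_snd_le[of "snd (wv k)" "fst (wv k)"] by simp
  finally show ?thesis
    using 1 by (simp add: distrib_left)
qed

text \<open>
  Depends on the side lengths only.
\<close>

definition smoothing_constant :: real where
  "smoothing_constant = exp 3 * (1 + (2 * (1 + 1 / wmin))\<^sup>2)"

lemma smoothing_constant_pos: "0 < smoothing_constant"
  unfolding smoothing_constant_def by (intro mult_pos_pos add_pos_nonneg) auto

text \<open>
  With \<open>\<sigma> = s powr (1/4)\<close> there are about \<open>\<sigma> powr (-2)\<close> lattice points with \<open>\<sigma> * \<bar>wv k\<bar> \<le> 1\<close>, and the others
  contribute a comparable amount.  A factor \<open>\<bar>wv k\<bar>\<^sup>2\<close> costs another \<open>\<sigma> powr (-2)\<close>.  The third bound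
  is the supremum in place of the sum; it is used for square summable coefficients.
\<close>

lemma smoothing_sums:
  assumes s: "0 < s" "s \<le> 1"
  shows "finite F \<Longrightarrow> (\<Sum>k\<in>F. exp (- 2 * s * symbol k)) \<le> smoothing_constant * s powr (- (1/2))"
    and "finite F \<Longrightarrow> (\<Sum>k\<in>F. exp (- 2 * s * symbol k) * (norm (wv k))\<^sup>2) \<le> smoothing_constant * s powr (- 1)"
    and "exp (- 2 * s * symbol k) * (norm (wv k))\<^sup>2 \<le> smoothing_constant * s powr (- (1/2))"
proof -
  define \<sigma> where "\<sigma> = s powr (1/4)"
  have \<sigma>: "0 < \<sigma>" "\<sigma> \<le> 1"
    using s powr_mono2[of "1/4" s 1] by (auto simp: \<sigma>_def)
  have inv2: "1 / \<sigma>\<^sup>2 = s powr (- (1/2))"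
  proof -
    have "\<sigma>\<^sup>2 = s powr (1/2)"
      by (simp add: \<sigma>_def power2_eq_square powr_add[symmetric])
    then show ?thesis by (simp add: powr_minus_divide)
  qed
  have inv4: "s powr (- (1/2)) * s powr (- (1/2)) = s powr (- 1)"
    by (simp add: powr_add[symmetric])
  define E where "E k = exp 3 * exp (- (\<sigma> * norm (wv k)))" for k
  have E1: "exp (- 2 * s * symbol k) \<le> E k" for k
    unfolding E_def \<sigma>_def by (rule multiplier_bound(1)[OF s refl])
  have E2: "exp (- 2 * s * symbol k) * (norm (wv k))\<^sup>2 \<le> s powr (- (1/2)) * E k" for k
  proof -
    have "(\<sigma> * norm (wv k))\<^sup>2 * exp (- 2 * s * symbol k) \<le> E k"
      unfolding E_def \<sigma>_def by (rule multiplier_bound(2)[OF s refl])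
    then have "exp (- 2 * s * symbol k) * (norm (wv k))\<^sup>2 \<le> (1 / \<sigma>\<^sup>2) * E k"
      using \<sigma> by (simp add: power_mult_distrib field_simps)
    then show ?thesis by (simp only: inv2)
  qed
  have sumE: "(\<Sum>k\<in>F. E k) \<le> smoothing_constant * s powr (- (1/2))" if "finite F" for F
  proof -
    have "E k \<le> exp 3 * exp (- (\<sigma> * wmin) * (\<bar>real_of_int (fst k)\<bar> + \<bar>real_of_int (snd k)\<bar>))" for k
      using mult_left_mono[OF norm_wv_ge[of k] less_imp_le[OF \<sigma>(1)]] by (simp add: E_def mult.assoc)
    then have "(\<Sum>k\<in>F. E k) \<le> (\<Sum>k\<in>F. exp 3 * exp (- (\<sigma> * wmin) * (\<bar>real_of_int (fst k)\<bar> + \<bar>real_of_int (snd k)\<bar>)))"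
      by (rule sum_mono)
    also have "\<dots> \<le> exp 3 * (2 * (1 + 1 / (\<sigma> * wmin)))\<^sup>2"
      unfolding sum_distrib_left[symmetric]
      using \<sigma> wmin_pos that by (intro mult_left_mono lattice_sum_exp) auto
    also have "\<dots> \<le> exp 3 * (2 * (1 / \<sigma> * (1 + 1 / wmin)))\<^sup>2"
      using \<sigma> wmin_pos by (intro mult_left_mono power_mono) (auto simp: field_simps)
    also have "\<dots> = exp 3 * (2 * (1 + 1 / wmin))\<^sup>2 * (1 / \<sigma>\<^sup>2)"
      by (simp add: power_mult_distrib power_divide)
    also have "\<dots> \<le> smoothing_constant * (1 / \<sigma>\<^sup>2)"
      unfolding smoothing_constant_def using \<sigma> by (intro mult_right_mono) auto
    finally show ?thesis by (simp only: inv2)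
  qed
  show "(\<Sum>k\<in>F. exp (- 2 * s * symbol k)) \<le> smoothing_constant * s powr (- (1/2))" if "finite F"
    using sum_mono[of F, OF E1] sumE[OF that] by (rule order_trans)
  show "(\<Sum>k\<in>F. exp (- 2 * s * symbol k) * (norm (wv k))\<^sup>2) \<le> smoothing_constant * s powr (- 1)" if "finite F"
  proof -
    have "(\<Sum>k\<in>F. exp (- 2 * s * symbol k) * (norm (wv k))\<^sup>2) \<le> s powr (- (1/2)) * (\<Sum>k\<in>F. E k)"
      unfolding sum_distrib_left by (rule sum_mono) (rule E2)
    also have "\<dots> \<le> s powr (- (1/2)) * (smoothing_constant * s powr (- (1/2)))"
      by (intro mult_left_mono sumE that) simp
    also have "\<dots> = smoothing_constant * s powr (- 1)"
      unfolding inv4[symmetric] by (simp only: mult_ac)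
    finally show ?thesis .
  qed
  have "E k \<le> exp 3 * 1"
    unfolding E_def using \<sigma> by (intro mult_left_mono) auto
  also have "\<dots> \<le> smoothing_constant"
    unfolding smoothing_constant_def by (intro mult_left_mono) auto
  finally have "s powr (- (1/2)) * E k \<le> s powr (- (1/2)) * smoothing_constant"
    by (intro mult_left_mono) auto
  with E2[of k] show "exp (- 2 * s * symbol k) * (norm (wv k))\<^sup>2 \<le> smoothing_constant * s powr (- (1/2))"
    by (simp add: mult.commute)
qed

end

section \<open>The semigroup on products of vector fields\<close>

lemma rep_L2_add: "AE x in lborel. rep_L2 (u + v) x = rep_L2 u x + rep_L2 v x"
  using rep_L2_abs_L2[OF square_integrable_add[OF square_integrable_rep_L2[of u] square_integrable_rep_L2[of v]]]
    abs_L2_add[of "rep_L2 u" "rep_L2 v"] by simp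

lemma rep_L2_scaleR: "AE x in lborel. rep_L2 (r *\<^sub>R u) x = r *\<^sub>R rep_L2 u x"
  using rep_L2_abs_L2[OF square_integrable_scaleR[OF square_integrable_rep_L2[of u]]]
    abs_L2_scaleR[of "rep_L2 u" r] by simp

lemma Cauchy_Schwarz_L2:
  fixes g h :: "'b::euclidean_space L2"
  shows "(LINT x|lborel. \<bar>rep_L2 g x \<bullet> rep_L2 h x\<bar>) \<le> norm g * norm h"
proof -
  have n: "square_integrable (\<lambda>x. norm (rep_L2 u x))" for u :: "'b L2"
    using square_integrableD[OF square_integrable_rep_L2[of u]]
    by (intro square_integrable_bound[OF square_integrable_rep_L2[of u]]) auto
  have norm_n: "norm (abs_L2 (\<lambda>x. norm (rep_L2 u x))) = norm u" for u :: "'b L2"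
    using norm_abs_L2[OF n[of u]] norm_abs_L2[OF square_integrable_rep_L2[of u]] by simp
  have "(LINT x|lborel. \<bar>rep_L2 g x \<bullet> rep_L2 h x\<bar>) \<le> (LINT x|lborel. norm (rep_L2 g x) \<bullet> norm (rep_L2 h x))"
    using integrable_inner_square_integrable[OF n[of g] n[of h]]
      integrable_inner_square_integrable[OF square_integrable_rep_L2[of g] square_integrable_rep_L2[of h]]
    by (intro integral_mono integrable_abs) (auto simp: Cauchy_Schwarz_ineq2)
  also have "\<dots> = abs_L2 (\<lambda>x. norm (rep_L2 g x)) \<bullet> abs_L2 (\<lambda>x. norm (rep_L2 h x))"
    using n by (intro inner_L2.abs_eq[symmetric]) auto
  also have "\<dots> \<le> norm g * norm h"
    using norm_cauchy_schwarz[of "abs_L2 (\<lambda>x. norm (rep_L2 g x))" "abs_L2 (\<lambda>x. norm (rep_L2 h x))"]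
    by (simp only: norm_n)
  finally show ?thesis .
qed

text \<open>
  An unconditional sum is the limit along one exhausting sequence of finite sets; measurability of
  sums of modes is derived in this way.
\<close>

lemma tendsto_sum_to_nat:
  fixes f :: "'i::countable \<Rightarrow> 'a::{comm_monoid_add,topological_space}"
  assumes "(f has_sum S) UNIV"
  shows "(\<lambda>n. \<Sum>k | to_nat k \<le> n. f k) \<longlonglongrightarrow> S"
proof -
  have fin: "finite {k::'i. to_nat k \<le> n}" for n
    using finite_vimageI[OF finite_atMost inj_to_nat, of n] by (simp add: vimage_def)
  have "filterlim (\<lambda>n. {k::'i. to_nat k \<le> n}) (finite_subsets_at_top UNIV) sequentially"
    unfolding filterlim_iff
  proof (intro allI impI)
    fix P assume "eventually P (finite_subsets_at_top (UNIV :: 'i set))"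
    then obtain F where F: "finite F" "\<And>G. finite G \<Longrightarrow> F \<subseteq> G \<Longrightarrow> P G"
      by (auto simp: eventually_finite_subsets_at_top)
    have "F \<subseteq> {k. to_nat k \<le> n}" if "Max (insert 0 (to_nat ` F)) \<le> n" for n
      using F(1) that by auto
    then show "eventually (\<lambda>n. P {k. to_nat k \<le> n}) sequentially"
      using F(2) fin by (auto intro!: eventually_sequentiallyI[of "Max (insert 0 (to_nat ` F))"])
  qed
  moreover have "(sum f \<longlongrightarrow> S) (finite_subsets_at_top UNIV)"
    using assms by (simp add: has_sum_def)
  ultimately show ?thesis
    by (rule filterlim_compose[rotated])
qed

context torus
begin

text \<open>
  A Fourier multiplier applied to a sequence \<open>c\<close> of coefficients.  The semigroup has \<open>y = (\<lambda>_. 1)\<close>; its gradient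
  has \<open>y = wv\<close> and \<open>\<i> * c k\<close> in place of \<open>c k\<close>.
\<close>

definition propagate :: "real \<Rightarrow> (int \<times> int \<Rightarrow> complex) \<Rightarrow> (int \<times> int \<Rightarrow> 'b::euclidean_space) \<Rightarrow> 'b L2" where
  "propagate s c y = (\<Sum>\<^sub>\<infinity>k. exp (- s * symbol k) *\<^sub>R mode k (c k) (y k))"

lemma semigroup_KS_eq_propagate: "semigroup_KS L1 L2 t f = propagate t (fc f) (\<lambda>_. 1)"
  by (simp add: semigroup_KS_def propagate_def mode_def symbol_def)

lemma propagate_bound:
  assumes D: "\<And>F. finite F \<Longrightarrow> (\<Sum>k\<in>F. exp (- 2 * s * symbol k) * (cmod (c k))\<^sup>2 * (norm (y k))\<^sup>2) \<le> D"
  shows "(\<lambda>k. exp (- s * symbol k) *\<^sub>R mode k (c k) (y k)) summable_on UNIV"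
    "(norm (propagate s c y))\<^sup>2 \<le> 2 * area * D"
    "\<And>F. finite F \<Longrightarrow> (\<Sum>k\<in>F. (norm (exp (- s * symbol k) *\<^sub>R mode k (c k) (y k)))\<^sup>2) \<le> area * D"
proof -
  show sums: "(\<Sum>k\<in>F. (norm (exp (- s * symbol k) *\<^sub>R mode k (c k) (y k)))\<^sup>2) \<le> area * D" if "finite F" for F
  proof -
    have "(norm (exp (- s * symbol k) *\<^sub>R mode k (c k) (y k)))\<^sup>2 \<le>
        area * (exp (- 2 * s * symbol k) * (cmod (c k))\<^sup>2 * (norm (y k))\<^sup>2)" for k
    proof -
      have "(norm (mode k (c k) (y k)))\<^sup>2 \<le> (cmod (c k) * norm (y k) * sqrt area)\<^sup>2"
        by (intro power_mono norm_mode) auto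
      moreover have "(exp (- s * symbol k))\<^sup>2 = exp (- 2 * s * symbol k)"
        by (simp add: power2_eq_square exp_add[symmetric])
      ultimately show ?thesis
        using area_pos by (simp add: power_mult_distrib mult_left_mono mult_ac)
    qed
    then have "(\<Sum>k\<in>F. (norm (exp (- s * symbol k) *\<^sub>R mode k (c k) (y k)))\<^sup>2) \<le>
        (\<Sum>k\<in>F. area * (exp (- 2 * s * symbol k) * (cmod (c k))\<^sup>2 * (norm (y k))\<^sup>2))"
      by (rule sum_mono)
    also have "\<dots> \<le> area * D"
      unfolding sum_distrib_left[symmetric] using area_pos by (intro mult_left_mono D that) auto
    finally show ?thesis .
  qed
  have orth: "almost_orthogonal (\<lambda>k. exp (- s * symbol k) *\<^sub>R mode k (c k) (y k))"
    by (intro almost_orthogonal_scaleR almost_orthogonal_mode)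
  show "(\<lambda>k. exp (- s * symbol k) *\<^sub>R mode k (c k) (y k)) summable_on UNIV"
    by (rule almost_orthogonal_bound(1)[OF orth sums])
  show "(norm (propagate s c y))\<^sup>2 \<le> 2 * area * D"
    unfolding propagate_def using almost_orthogonal_bound(2)[OF orth sums] by (simp add: mult.assoc)
qed

lemma continuous_on_propagate:
  assumes D: "\<And>F. finite F \<Longrightarrow> (\<Sum>k\<in>F. exp (- 2 * s0 * symbol k) * (cmod (c k))\<^sup>2 * (norm (y k))\<^sup>2) \<le> D"
    and s0: "0 \<le> s0"
  shows "continuous_on {s0..1} (\<lambda>s. propagate s c y)"
proof -
  have "continuous_on {s0..1} (\<lambda>s. \<Sum>\<^sub>\<infinity>k. exp (- (s - s0) * symbol k) *\<^sub>R (exp (- s0 * symbol k) *\<^sub>R mode k (c k) (y k)))"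
  proof (rule continuous_on_almost_orthogonal_series)
    show "almost_orthogonal (\<lambda>k. exp (- s0 * symbol k) *\<^sub>R mode k (c k) (y k))"
      by (intro almost_orthogonal_scaleR almost_orthogonal_mode)
    show "(\<Sum>k\<in>F. (norm (exp (- s0 * symbol k) *\<^sub>R mode k (c k) (y k)))\<^sup>2) \<le> area * D" if "finite F" for F
      by (rule propagate_bound(3)[OF D that])
    show "continuous_on {s0..1} (\<lambda>s. exp (- (s - s0) * symbol k))" for k
      by (intro continuous_intros)
    show "\<bar>exp (- (s - s0) * symbol k)\<bar> \<le> exp 1" if "s \<in> {s0..1}" for s k
    proof -
      have "(s - s0) * (- symbol k) \<le> (s - s0) * 1"
        using that symbol_ge[of k] by (intro mult_left_mono) auto
      also have "\<dots> \<le> 1" using that s0 by simp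
      finally show ?thesis
        by (simp only: abs_exp_cancel exp_le_cancel_iff mult_minus_left mult_minus_right)
    qed
  qed
  moreover have "exp (- (s - s0) * symbol k) *\<^sub>R (exp (- s0 * symbol k) *\<^sub>R mode k (c k) (y k)) =
      exp (- s * symbol k) *\<^sub>R mode k (c k) (y k)" for s k
    by (simp add: exp_add[symmetric] algebra_simps)
  ultimately show ?thesis
    by (simp only: propagate_def)
qed

definition product_coeff :: "plane L2 \<Rightarrow> plane L2 \<Rightarrow> int \<times> int \<Rightarrow> complex" where
  "product_coeff g h = fc (\<lambda>x. rep_L2 g x \<bullet> rep_L2 h x)"

lemma set_integrable_inner:
  fixes g h :: "plane L2"
  shows "set_integrable lborel Q (\<lambda>x. rep_L2 g x \<bullet> rep_L2 h x)"
  unfolding set_integrable_def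
  by (intro integrable_mult_indicator integrable_inner_square_integrable) auto

lemma norm_product_coeff: "cmod (product_coeff g h k) \<le> norm g * norm h / area"
proof -
  have "(LINT x:Q|lborel. \<bar>rep_L2 g x \<bullet> rep_L2 h x\<bar>) \<le> (LINT x|lborel. \<bar>rep_L2 g x \<bullet> rep_L2 h x\<bar>)"
    unfolding set_lebesgue_integral_def
    using integrable_inner_square_integrable[OF square_integrable_rep_L2[of g] square_integrable_rep_L2[of h]]
    by (intro integral_mono integrable_mult_indicator integrable_abs) (auto simp: indicator_def)
  also have "\<dots> \<le> norm g * norm h"
    by (rule Cauchy_Schwarz_L2)
  finally show ?thesis
    unfolding product_coeff_def using norm_fourier_coeff[OF set_integrable_inner[of g h], of k] area_pos
    by (meson divide_right_mono less_imp_le order_trans)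
qed

text \<open>
  Although it is defined through representatives, the coefficient of a product is a continuous bilinear
  function of the classes, which is what makes the measurability of the nonlinearity in time routine.
\<close>

lemma bounded_bilinear_product_coeff: "bounded_bilinear (\<lambda>g h. product_coeff g h k)"
proof
  fix g g' h h' :: "plane L2" and r :: real
  have sum_int: "set_integrable lborel Q (\<lambda>x. rep_L2 g x \<bullet> rep_L2 h x + rep_L2 g' x \<bullet> rep_L2 h' x)" for g g' h h' :: "plane L2"
    using set_integral_add(1)[OF set_integrable_inner[of g h] set_integrable_inner[of g' h']] .
  have scale_int: "set_integrable lborel Q (\<lambda>x. r * (rep_L2 g x \<bullet> rep_L2 h x))" for r and g h :: "plane L2"
    using set_integrable_inner[of g h] by simp
  have "product_coeff (g + g') h k = fc (\<lambda>x. rep_L2 g x \<bullet> rep_L2 h x + rep_L2 g' x \<bullet> rep_L2 h x) k"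
    unfolding product_coeff_def
    by (rule fourier_coeff_cong[OF _ set_integrable_inner sum_int])
      (use rep_L2_add[of g g'] in \<open>eventually_elim, simp add: inner_add_left\<close>)
  then show "product_coeff (g + g') h k = product_coeff g h k + product_coeff g' h k"
    by (simp add: product_coeff_def fourier_coeff_add set_integrable_inner)
  have "product_coeff g (h + h') k = fc (\<lambda>x. rep_L2 g x \<bullet> rep_L2 h x + rep_L2 g x \<bullet> rep_L2 h' x) k"
    unfolding product_coeff_def
    by (rule fourier_coeff_cong[OF _ set_integrable_inner sum_int])
      (use rep_L2_add[of h h'] in \<open>eventually_elim, simp add: inner_add_right\<close>)
  then show "product_coeff g (h + h') k = product_coeff g h k + product_coeff g h' k"
    by (simp add: product_coeff_def fourier_coeff_add set_integrable_inner)
  have "product_coeff (r *\<^sub>R g) h k = fc (\<lambda>x. r * (rep_L2 g x \<bullet> rep_L2 h x)) k"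
    unfolding product_coeff_def
    by (rule fourier_coeff_cong[OF _ set_integrable_inner scale_int])
      (use rep_L2_scaleR[of r g] in \<open>eventually_elim, simp\<close>)
  then show "product_coeff (r *\<^sub>R g) h k = r *\<^sub>R product_coeff g h k"
    by (simp add: product_coeff_def fourier_coeff_scaleR)
  have "product_coeff g (r *\<^sub>R h) k = fc (\<lambda>x. r * (rep_L2 g x \<bullet> rep_L2 h x)) k"
    unfolding product_coeff_def
    by (rule fourier_coeff_cong[OF _ set_integrable_inner scale_int])
      (use rep_L2_scaleR[of r h] in \<open>eventually_elim, simp\<close>)
  then show "product_coeff g (r *\<^sub>R h) k = r *\<^sub>R product_coeff g h k"
    by (simp add: product_coeff_def fourier_coeff_scaleR)
next
  show "\<exists>K. \<forall>g h. cmod (product_coeff g h k) \<le> norm g * norm h * K"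
    using norm_product_coeff[of _ _ k] by (intro exI[of _ "1 / area"]) simp
qed

text \<open>
  States that the multiplier with weights \<open>y\<close> maps integrable functions to square integrable ones with norm
  of order \<open>s powr (- \<alpha>)\<close>.
\<close>

definition smoothing :: "(int \<times> int \<Rightarrow> 'b::euclidean_space) \<Rightarrow> real \<Rightarrow> bool" where
  "smoothing y \<alpha> \<longleftrightarrow> (\<forall>s F. 0 < s \<longrightarrow> s \<le> 1 \<longrightarrow> finite F \<longrightarrow>
     (\<Sum>k\<in>F. exp (- 2 * s * symbol k) * (norm (y k))\<^sup>2) \<le> smoothing_constant * s powr (- 2 * \<alpha>))"

lemma smoothing_one: "smoothing (\<lambda>_. 1 :: real) (1/4)"
  using smoothing_sums(1) by (simp add: smoothing_def)

lemma smoothing_wv: "smoothing wv (1/2)"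
  using smoothing_sums(2) by (simp add: smoothing_def)

text \<open>
  For \<open>d = 1\<close>, \<open>y = (\<lambda>_. 1)\<close> this is \<open>S s (g \<bullet> h)\<close>, for \<open>d = \<i>\<close>, \<open>y = wv\<close> its gradient.  The value \<open>0\<close> outside
  \<open>0 < s \<le> 1\<close>, where nothing is claimed about convergence of the series, makes the map bilinear and
  Borel measurable for every \<open>s\<close>.
\<close>

definition kernel :: "complex \<Rightarrow> (int \<times> int \<Rightarrow> 'b::euclidean_space) \<Rightarrow> real \<Rightarrow> plane L2 \<Rightarrow> plane L2 \<Rightarrow> 'b L2" where
  "kernel d y s g h = (if 0 < s \<and> s \<le> 1 then propagate s (\<lambda>k. d * product_coeff g h k) y else 0)"

definition kernel_constant :: real where
  "kernel_constant = sqrt (2 * smoothing_constant / area)"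

lemma kernel_constant_pos: "0 < kernel_constant"
  using smoothing_constant_pos area_pos by (simp add: kernel_constant_def)

lemma kernel_sums:
  assumes y: "smoothing y \<alpha>" and d: "cmod d = 1" and s: "0 < s" "s \<le> 1" and F: "finite F"
  shows "(\<Sum>k\<in>F. exp (- 2 * s * symbol k) * (cmod (d * product_coeff g h k))\<^sup>2 * (norm (y k))\<^sup>2) \<le>
     (norm g * norm h / area)\<^sup>2 * (smoothing_constant * s powr (- 2 * \<alpha>))"
proof -
  have "(\<Sum>k\<in>F. exp (- 2 * s * symbol k) * (cmod (d * product_coeff g h k))\<^sup>2 * (norm (y k))\<^sup>2) \<le>
      (\<Sum>k\<in>F. (norm g * norm h / area)\<^sup>2 * (exp (- 2 * s * symbol k) * (norm (y k))\<^sup>2))"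
  proof (rule sum_mono)
    fix k
    have "(cmod (d * product_coeff g h k))\<^sup>2 \<le> (norm g * norm h / area)\<^sup>2"
      using norm_product_coeff[of g h k] d by (intro power_mono) (auto simp: norm_mult)
    then have "(cmod (d * product_coeff g h k))\<^sup>2 * (exp (- 2 * s * symbol k) * (norm (y k))\<^sup>2) \<le>
        (norm g * norm h / area)\<^sup>2 * (exp (- 2 * s * symbol k) * (norm (y k))\<^sup>2)"
      by (rule mult_right_mono) simp
    then show "exp (- 2 * s * symbol k) * (cmod (d * product_coeff g h k))\<^sup>2 * (norm (y k))\<^sup>2 \<le>
        (norm g * norm h / area)\<^sup>2 * (exp (- 2 * s * symbol k) * (norm (y k))\<^sup>2)"
      by (simp only: mult_ac)
  qed
  also have "\<dots> \<le> (norm g * norm h / area)\<^sup>2 * (smoothing_constant * s powr (- 2 * \<alpha>))"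
    unfolding sum_distrib_left[symmetric]
    using y s F by (intro mult_left_mono) (auto simp: smoothing_def)
  finally show ?thesis .
qed

lemma summable_kernel:
  assumes "smoothing y \<alpha>" "cmod d = 1" "0 < s" "s \<le> 1"
  shows "(\<lambda>k. exp (- s * symbol k) *\<^sub>R mode k (d * product_coeff g h k) (y k)) summable_on UNIV"
  by (rule propagate_bound(1)[OF kernel_sums[OF assms]])

text \<open>
  Every Fourier coefficient of the product is at most \<open>\<parallel>g\<parallel> \<parallel>h\<parallel> / area\<close>, so almost orthogonality leaves
  just the sum of the multipliers.  Using absolute convergence instead would lose a factor \<open>s powr (-1/4)\<close>,
  and with it the smallness of the nonlinear term for short times.
\<close>

lemma norm_kernel:
  assumes y: "smoothing y \<alpha>" and d: "cmod d = 1" and s: "0 < s" "s \<le> 1"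
  shows "norm (kernel d y s g h) \<le> kernel_constant * s powr (- \<alpha>) * norm g * norm h"
proof -
  have "(norm (kernel d y s g h))\<^sup>2 \<le> 2 * area * ((norm g * norm h / area)\<^sup>2 * (smoothing_constant * s powr (- 2 * \<alpha>)))"
    using propagate_bound(2)[OF kernel_sums[OF assms]] s by (simp add: kernel_def)
  also have "\<dots> = 2 * smoothing_constant / area * (s powr (- \<alpha>) * s powr (- \<alpha>)) * (norm g * norm h)\<^sup>2"
    using area_pos by (simp add: powr_add[symmetric] power_divide power2_eq_square)
  also have "\<dots> = (kernel_constant * s powr (- \<alpha>) * norm g * norm h)\<^sup>2"
  proof -
    have "2 * smoothing_constant / area = kernel_constant\<^sup>2"
      using smoothing_constant_pos area_pos by (simp add: kernel_constant_def)
    then show ?thesis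
      by (simp only: power2_eq_square mult_ac)
  qed
  finally show ?thesis
    by (rule power2_le_imp_le) (use kernel_constant_pos in simp)
qed

lemma bounded_bilinear_kernel:
  fixes y :: "int \<times> int \<Rightarrow> 'b::euclidean_space"
  assumes y: "smoothing y \<alpha>" and d: "cmod d = 1"
  shows "bounded_bilinear (kernel d y s)"
proof (cases "0 < s \<and> s \<le> 1")
  case s: True
  interpret pc: bounded_bilinear "\<lambda>g h. product_coeff g h k" for k
    by (rule bounded_bilinear_product_coeff)
  note sm = summable_kernel[OF y d conjunct1[OF s] conjunct2[OF s]]
  show ?thesis
  proof
    fix g g' h h' :: "plane L2" and r :: real
    show "kernel d y s (g + g') h = kernel d y s g h + kernel d y s g' h"
      "kernel d y s g (h + h') = kernel d y s g h + kernel d y s g h'"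
      using s sm by (simp_all add: kernel_def propagate_def pc.add_left pc.add_right distrib_left mode_add
          scaleR_add_right infsum_add)
    have "exp (- s * symbol k) *\<^sub>R mode k (d * (r *\<^sub>R c)) (y k) = r *\<^sub>R (exp (- s * symbol k) *\<^sub>R mode k (d * c) (y k))" for c k
    proof -
      have "mode k (d * (r *\<^sub>R c)) (y k) = r *\<^sub>R mode k (d * c) (y k)"
        by (simp add: mode_scaleR[symmetric])
      then show ?thesis by (simp only: scaleR_left_commute)
    qed
    then show "kernel d y s (r *\<^sub>R g) h = r *\<^sub>R kernel d y s g h"
      "kernel d y s g (r *\<^sub>R h) = r *\<^sub>R kernel d y s g h"
      using s by (simp_all only: kernel_def propagate_def pc.scaleR_left pc.scaleR_right
          infsum_scaleR_right simp_thms if_True)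
  next
    show "\<exists>K. \<forall>g h. norm (kernel d y s g h) \<le> norm g * norm h * K"
      using norm_kernel[OF y d conjunct1[OF s] conjunct2[OF s]]
      by (intro exI[of _ "kernel_constant * s powr (- \<alpha>)"]) (simp add: mult_ac)
  qed
next
  case False
  then have "kernel d y s = (\<lambda>g h. 0)"
    by (auto simp: kernel_def fun_eq_iff)
  moreover have "bounded_bilinear (\<lambda>(g :: plane L2) (h :: plane L2). 0 :: 'b L2)"
    by unfold_locales (auto intro: exI[of _ 0])
  ultimately show ?thesis by simp
qed

lemma measurable_kernel:
  assumes y: "smoothing y \<alpha>" and d: "cmod d = 1"
  shows "(\<lambda>(s, g, h). kernel d y s g h) \<in> borel_measurable borel"
proof (rule borel_measurable_LIMSEQ_metric)
  define I where "I = {p :: real \<times> plane L2 \<times> plane L2. 0 < fst p \<and> fst p \<le> 1}"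
  define f where "f n p = indicator I p *\<^sub>R (\<Sum>k | to_nat k \<le> n. exp (- fst p * symbol k) *\<^sub>R
      mode k (d * product_coeff (fst (snd p)) (snd (snd p)) k) (y k))" for n p
  have I: "I \<in> sets borel"
  proof -
    have "I = fst -` {0<..} \<inter> fst -` {..1}" by (auto simp: I_def)
    moreover have "open (fst -` {0<..} :: (real \<times> plane L2 \<times> plane L2) set)"
      by (intro open_vimage continuous_intros open_greaterThan)
    moreover have "closed (fst -` {..1} :: (real \<times> plane L2 \<times> plane L2) set)"
      by (intro closed_vimage continuous_intros closed_atMost)
    ultimately show ?thesis by auto
  qed
  show "f n \<in> borel_measurable borel" for n
    unfolding f_def
  proof (intro borel_measurable_scaleR borel_measurable_indicator I borel_measurable_continuous_onI)
    show "continuous_on UNIV (\<lambda>p. \<Sum>k | to_nat k \<le> n. exp (- fst p * symbol k) *\<^sub>R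
      mode k (d * product_coeff (fst (snd p)) (snd (snd p)) k) (y k))"
      by (intro continuous_intros bounded_linear.continuous_on[OF bounded_linear_mode]
        bounded_bilinear.continuous_on[OF bounded_bilinear_product_coeff])
  qed
  fix p :: "real \<times> plane L2 \<times> plane L2"
  obtain s g h where p: "p = (s, g, h)" by (cases p) auto
  show "(\<lambda>n. f n p) \<longlonglongrightarrow> (case p of (s, g, h) \<Rightarrow> kernel d y s g h)"
  proof (cases "0 < s \<and> s \<le> 1")
    case True
    then have "((\<lambda>k. exp (- s * symbol k) *\<^sub>R mode k (d * product_coeff g h k) (y k)) has_sum kernel d y s g h) UNIV"
      using summable_kernel[OF y d, of s g h] by (simp add: kernel_def propagate_def)
    then show ?thesis
      using tendsto_sum_to_nat True by (fastforce simp: p f_def I_def)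
  next
    case False
    then show ?thesis by (auto simp: p f_def I_def kernel_def)
  qed
qed

text \<open>
  From time \<open>s0\<close> on, the series is an almost orthogonal series with the bounded coefficients
  \<open>exp (- (s - s0) * symbol k)\<close>.
\<close>

lemma continuous_on_kernel:
  assumes y: "smoothing y \<alpha>" and d: "cmod d = 1" and s0: "0 < s0"
  shows "continuous_on {s0..1} (\<lambda>s. kernel d y s g h)"
proof (cases "s0 \<le> 1")
  case True
  have "continuous_on {s0..1} (\<lambda>s. propagate s (\<lambda>k. d * product_coeff g h k) y)"
    by (rule continuous_on_propagate[OF kernel_sums[OF y d s0 True]]) (use s0 in simp_all)
  then show ?thesis
    by (rule continuous_on_eq) (use s0 in \<open>simp add: kernel_def\<close>)
qed simp

lemma square_summable_fourier:
  fixes u :: "real L2"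
  assumes "finite F" "cmod d = 1" and K: "\<And>k. exp (- 2 * s * symbol k) * (norm (y k))\<^sup>2 \<le> K"
  shows "(\<Sum>k\<in>F. exp (- 2 * s * symbol k) * (cmod (d * fc (rep_L2 u) k))\<^sup>2 * (norm (y k))\<^sup>2) \<le> K * (2 * (norm u)\<^sup>2 / area)"
proof -
  have K0: "0 \<le> K" by (rule order_trans[OF _ K[of undefined]]) simp
  have "(\<Sum>k\<in>F. exp (- 2 * s * symbol k) * (cmod (d * fc (rep_L2 u) k))\<^sup>2 * (norm (y k))\<^sup>2) \<le>
      (\<Sum>k\<in>F. K * (cmod (fc (rep_L2 u) k))\<^sup>2)"
  proof (rule sum_mono)
    fix k
    have "(exp (- 2 * s * symbol k) * (norm (y k))\<^sup>2) * (cmod (fc (rep_L2 u) k))\<^sup>2 \<le> K * (cmod (fc (rep_L2 u) k))\<^sup>2"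
      by (intro mult_right_mono K) simp
    then show "exp (- 2 * s * symbol k) * (cmod (d * fc (rep_L2 u) k))\<^sup>2 * (norm (y k))\<^sup>2 \<le> K * (cmod (fc (rep_L2 u) k))\<^sup>2"
      using assms(2) by (simp add: norm_mult mult_ac)
  qed
  also have "\<dots> \<le> K * (2 * (norm u)\<^sup>2 / area)"
    unfolding sum_distrib_left[symmetric] by (intro mult_left_mono bessel assms K0)
  finally show ?thesis .
qed

lemma initial_sums:
  fixes u :: "real L2"
  assumes "0 \<le> s" "s \<le> 1" "finite F"
  shows "(\<Sum>k\<in>F. exp (- 2 * s * symbol k) * (cmod (fc (rep_L2 u) k))\<^sup>2 * (norm (1::real))\<^sup>2) \<le> exp 2 * (2 * (norm u)\<^sup>2 / area)"
proof -
  have "- 2 * s * symbol k \<le> 2" for k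
  proof -
    have "(2 * s) * (- symbol k) \<le> (2 * s) * 1"
      using symbol_ge[of k] assms by (intro mult_left_mono) auto
    then show ?thesis using assms by simp
  qed
  then show ?thesis
    using square_summable_fourier[OF assms(3), of 1 s "\<lambda>_. 1 :: real" "exp 2" u] by simp
qed

lemma summable_semigroup_KS:
  fixes u :: "real L2"
  assumes "0 \<le> s" "s \<le> 1"
  shows "(\<lambda>k. exp (- s * symbol k) *\<^sub>R mode k (fc (rep_L2 u) k) (1::real)) summable_on UNIV"
  by (rule propagate_bound(1)[OF initial_sums[OF assms]])

lemma continuous_on_semigroup_KS: "continuous_on {0..1} (\<lambda>s. semigroup_KS L1 L2 s (rep_L2 u))"
  unfolding semigroup_KS_eq_propagate
  by (rule continuous_on_propagate[OF initial_sums[of 0]]) auto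

definition grad_semigroup :: "real L2 \<Rightarrow> real \<Rightarrow> plane L2" where
  "grad_semigroup u s = (if 0 < s \<and> s \<le> 1 then propagate s (\<lambda>k. \<i> * fc (rep_L2 u) k) wv else 0)"

lemma grad_semigroup_sums:
  assumes "0 < s" "s \<le> 1" "finite F"
  shows "(\<Sum>k\<in>F. exp (- 2 * s * symbol k) * (cmod (\<i> * fc (rep_L2 u) k))\<^sup>2 * (norm (wv k))\<^sup>2) \<le>
    smoothing_constant * s powr (- (1/2)) * (2 * (norm u)\<^sup>2 / area)"
  by (rule square_summable_fourier[OF assms(3) _ smoothing_sums(3)[OF assms(1,2)]]) simp

lemma summable_grad_semigroup:
  assumes "0 < s" "s \<le> 1"
  shows "(\<lambda>k. exp (- s * symbol k) *\<^sub>R mode k (\<i> * fc (rep_L2 u) k) (wv k)) summable_on UNIV"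
  by (rule propagate_bound(1)[OF grad_semigroup_sums[OF assms]])

text \<open>
  This bound is why the weight in the solution space is \<open>t powr (1/4)\<close>.
\<close>

lemma norm_grad_semigroup:
  assumes "0 < s" "s \<le> 1"
  shows "norm (grad_semigroup u s) \<le> 2 * sqrt smoothing_constant * norm u * s powr (- (1/4))"
proof -
  have "(norm (grad_semigroup u s))\<^sup>2 \<le> 2 * area * (smoothing_constant * s powr (- (1/2)) * (2 * (norm u)\<^sup>2 / area))"
    using propagate_bound(2)[OF grad_semigroup_sums[OF assms]] assms by (simp add: grad_semigroup_def)
  also have "\<dots> = 4 * smoothing_constant * (norm u)\<^sup>2 * (s powr (- (1/4)) * s powr (- (1/4)))"
    using area_pos by (simp add: powr_add[symmetric])
  also have "\<dots> = (2 * sqrt smoothing_constant * norm u * s powr (- (1/4)))\<^sup>2"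
    using smoothing_constant_pos by (simp add: power_mult_distrib power2_eq_square)
  finally show ?thesis
    by (rule power2_le_imp_le) (use smoothing_constant_pos in simp)
qed

lemma measurable_grad_semigroup: "grad_semigroup u \<in> borel_measurable borel"
proof (rule borel_measurable_LIMSEQ_metric)
  define f where "f n s = indicator {0<..1} s *\<^sub>R (\<Sum>k | to_nat k \<le> n. exp (- s * symbol k) *\<^sub>R
      mode k (\<i> * fc (rep_L2 u) k) (wv k))" for n s
  show "f n \<in> borel_measurable borel" for n
    unfolding f_def
    by (intro borel_measurable_scaleR borel_measurable_indicator borel_measurable_continuous_onI continuous_intros) auto
  fix s :: real
  show "(\<lambda>n. f n s) \<longlonglongrightarrow> grad_semigroup u s"
  proof (cases "0 < s \<and> s \<le> 1")
    case True
    then have "((\<lambda>k. exp (- s * symbol k) *\<^sub>R mode k (\<i> * fc (rep_L2 u) k) (wv k)) has_sum grad_semigroup u s) UNIV"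
      using summable_grad_semigroup[of s u] by (simp add: grad_semigroup_def propagate_def)
    then show ?thesis
      using tendsto_sum_to_nat True by (fastforce simp: f_def)
  qed (auto simp: f_def grad_semigroup_def)
qed

end

section \<open>Volterra equations with a singular bilinear kernel\<close>

text \<open>
  A bound for the value \<open>Beta (1 - a) (1 - b)\<close> of the integral of \<open>(1 - \<tau>) powr (- a) * \<tau> powr (- b)\<close>.
\<close>

definition singular_constant :: "real \<Rightarrow> real \<Rightarrow> real" where
  "singular_constant a b = 2 powr a / (1 - b) + 2 powr b / (1 - a)"

lemma singular_constant_pos: "a < 1 \<Longrightarrow> b < 1 \<Longrightarrow> 0 < singular_constant a b"
  by (simp add: singular_constant_def add_pos_pos)

lemma has_bochner_integral_powr:
  assumes b: "b < 1" and t: "0 \<le> (t::real)"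
  shows "has_bochner_integral lborel (\<lambda>\<tau>. indicator {0..t} \<tau> * \<tau> powr (- b)) (t powr (1 - b) / (1 - b))"
proof (rule has_bochner_integral_nn_integral)
  have "((\<lambda>\<tau>. \<tau> powr (- b)) has_integral (t powr (1 - b) / (1 - b))) {0..t}"
    using has_integral_powr_from_0[of "- b" t] assms by (simp add: add.commute)
  then have "((\<lambda>\<tau>. indicator {0..t} \<tau> * \<tau> powr (- b)) has_integral (t powr (1 - b) / (1 - b))) UNIV"
  proof -
    have "(\<lambda>\<tau>. indicator {0..t} \<tau> * \<tau> powr (- b)) = (\<lambda>\<tau>. if \<tau> \<in> {0..t} then \<tau> powr (- b) else 0)"
      by (auto simp: indicator_def)
    with \<open>((\<lambda>\<tau>. \<tau> powr (- b)) has_integral _) {0..t}\<close> show ?thesis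
      by (simp only: has_integral_restrict_UNIV)
  qed
  from nn_integral_has_integral_lborel[OF _ _ this]
  show "(\<integral>\<^sup>+\<tau>. ennreal (indicator {0..t} \<tau> * \<tau> powr (- b)) \<partial>lborel) = ennreal (t powr (1 - b) / (1 - b))"
    by simp
qed (use assms in auto)

lemma has_bochner_integral_powr_reflected:
  assumes a: "a < 1" and t: "0 \<le> (t::real)"
  shows "has_bochner_integral lborel (\<lambda>\<tau>. indicator {0..t} \<tau> * (t - \<tau>) powr (- a)) (t powr (1 - a) / (1 - a))"
proof -
  have "indicator {0..t} (t + (- 1) * \<tau>) * (t + (- 1) * \<tau>) powr (- a) = indicator {0..t} \<tau> * (t - \<tau>) powr (- a)" for \<tau>
    by (auto simp: indicator_def)
  then have "(\<lambda>\<tau>. indicator {0..t} (t + (- 1) * \<tau>) * (t + (- 1) * \<tau>) powr (- a)) = (\<lambda>\<tau>. indicator {0..t} \<tau> * (t - \<tau>) powr (- a))"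
    by (rule ext)
  moreover have "has_bochner_integral lborel (\<lambda>\<tau>. indicator {0..t} (t + (- 1) * \<tau>) * (t + (- 1) * \<tau>) powr (- a))
      (t powr (1 - a) / (1 - a) /\<^sub>R \<bar>- 1\<bar>)"
    using has_bochner_integral_powr[OF assms]
    by (subst lborel_has_bochner_integral_real_affine_iff[symmetric]) simp_all
  ultimately show ?thesis by simp
qed

text \<open>
  On each half of the interval one of the two factors is at most its value at the midpoint.
\<close>

lemma singular_integral:
  assumes a: "0 \<le> a" "a < 1" and b: "0 \<le> b" "b < 1" and t: "0 \<le> (t::real)"
  shows "set_integrable lborel {0<..<t} (\<lambda>\<tau>. (t - \<tau>) powr (- a) * \<tau> powr (- b))"
    "(LINT \<tau>:{0<..<t}|lborel. (t - \<tau>) powr (- a) * \<tau> powr (- b)) \<le> singular_constant a b * t powr (1 - a - b)"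
proof -
  define g where "g \<tau> = (t / 2) powr (- a) * (indicator {0..t} \<tau> * \<tau> powr (- b)) +
      (t / 2) powr (- b) * (indicator {0..t} \<tau> * (t - \<tau>) powr (- a))" for \<tau>
  have g: "has_bochner_integral lborel g ((t / 2) powr (- a) * (t powr (1 - b) / (1 - b)) + (t / 2) powr (- b) * (t powr (1 - a) / (1 - a)))"
    unfolding g_def
    by (intro has_bochner_integral_add has_bochner_integral_mult_right has_bochner_integral_powr
        has_bochner_integral_powr_reflected assms)
  have le: "indicator {0<..<t} \<tau> *\<^sub>R ((t - \<tau>) powr (- a) * \<tau> powr (- b)) \<le> g \<tau>" for \<tau>
  proof (cases "\<tau> \<in> {0<..<t}")
    case True
    show ?thesis
    proof (cases "\<tau> \<le> t / 2")
      case le: True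
      have "(t - \<tau>) powr (- a) \<le> (t / 2) powr (- a)"
        using le True a by (intro powr_mono2') auto
      then have "(t - \<tau>) powr (- a) * \<tau> powr (- b) \<le> (t / 2) powr (- a) * \<tau> powr (- b)"
        by (intro mult_right_mono) auto
      then show ?thesis using True by (simp add: g_def add_increasing2)
    next
      case False
      have "\<tau> powr (- b) \<le> (t / 2) powr (- b)"
        using False True b by (intro powr_mono2') auto
      then have "\<tau> powr (- b) * (t - \<tau>) powr (- a) \<le> (t / 2) powr (- b) * (t - \<tau>) powr (- a)"
        by (intro mult_right_mono) auto
      then show ?thesis using True by (simp add: g_def add_increasing mult.commute)
    qed
  qed (simp add: g_def)
  have int: "integrable lborel (\<lambda>\<tau>. indicator {0<..<t} \<tau> *\<^sub>R ((t - \<tau>) powr (- a) * \<tau> powr (- b)))"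
  proof (rule Bochner_Integration.integrable_bound)
    show "integrable lborel g" using g by (rule integrable.intros)
    show "AE \<tau> in lborel. norm (indicator {0<..<t} \<tau> *\<^sub>R ((t - \<tau>) powr (- a) * \<tau> powr (- b))) \<le> norm (g \<tau>)"
    proof (rule AE_I2)
      fix \<tau>
      have "norm (indicator {0<..<t} \<tau> *\<^sub>R ((t - \<tau>) powr (- a) * \<tau> powr (- b))) = indicator {0<..<t} \<tau> *\<^sub>R ((t - \<tau>) powr (- a) * \<tau> powr (- b))"
        by simp
      also have "\<dots> \<le> g \<tau>" by (rule le)
      also have "\<dots> \<le> norm (g \<tau>)" by simp
      finally show "norm (indicator {0<..<t} \<tau> *\<^sub>R ((t - \<tau>) powr (- a) * \<tau> powr (- b))) \<le> norm (g \<tau>)" .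
    qed
  qed measurable
  then show "set_integrable lborel {0<..<t} (\<lambda>\<tau>. (t - \<tau>) powr (- a) * \<tau> powr (- b))"
    by (simp add: set_integrable_def)
  have "(LINT \<tau>:{0<..<t}|lborel. (t - \<tau>) powr (- a) * \<tau> powr (- b)) \<le> integral\<^sup>L lborel g"
    unfolding set_lebesgue_integral_def
    by (rule integral_mono[OF int integrable.intros[OF g] le])
  also have "\<dots> = (t / 2) powr (- a) * (t powr (1 - b) / (1 - b)) + (t / 2) powr (- b) * (t powr (1 - a) / (1 - a))"
    using g by (rule has_bochner_integral_integral_eq)
  also have "\<dots> = singular_constant a b * t powr (1 - a - b)"
  proof -
    have half: "(t / 2) powr (- c) = 2 powr c * t powr (- c)" for c
    proof -
      have "(t / 2) powr (- c) = t powr (- c) / 2 powr (- c)"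
        by (rule powr_divide)
      then show ?thesis by (simp add: powr_minus_divide[of 2])
    qed
    have merge: "2 powr c * t powr (- c) * (t powr (1 - d) / (1 - d)) = 2 powr c / (1 - d) * t powr (1 - c - d)" for c d
    proof -
      have "1 - c - d = - c + (1 - d)" by simp
      then have "t powr (1 - c - d) = t powr (- c) * t powr (1 - d)"
        by (simp only: powr_add)
      then show ?thesis by simp
    qed
    have "1 - b - a = 1 - a - b" by simp
    then show ?thesis
      by (simp only: half merge singular_constant_def distrib_right)
  qed
  finally show "(LINT \<tau>:{0<..<t}|lborel. (t - \<tau>) powr (- a) * \<tau> powr (- b)) \<le> singular_constant a b * t powr (1 - a - b)" .
qed

lemma set_integral_singular_bound:
  fixes F :: "real \<Rightarrow> 'b::{banach, second_countable_topology}"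
  assumes a: "0 \<le> a" "a < 1" and b: "0 \<le> b" "b < 1" and t: "0 \<le> (t::real)"
    and F: "set_borel_measurable lborel {0<..<t} F"
    and bound: "\<And>\<tau>. 0 < \<tau> \<Longrightarrow> \<tau> < t \<Longrightarrow> norm (F \<tau>) \<le> M * ((t - \<tau>) powr (- a) * \<tau> powr (- b))"
  shows "set_integrable lborel {0<..<t} F"
    "0 \<le> M \<Longrightarrow> norm (LINT \<tau>:{0<..<t}|lborel. F \<tau>) \<le> M * singular_constant a b * t powr (1 - a - b)"
proof -
  have int: "set_integrable lborel {0<..<t} (\<lambda>\<tau>. M * ((t - \<tau>) powr (- a) * \<tau> powr (- b)))"
    using singular_integral(1)[OF a b t] by simp
  show F_int: "set_integrable lborel {0<..<t} F"
    unfolding set_integrable_def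
  proof (rule Bochner_Integration.integrable_bound[OF int[unfolded set_integrable_def]])
    show "(\<lambda>\<tau>. indicator {0<..<t} \<tau> *\<^sub>R F \<tau>) \<in> borel_measurable lborel"
      using F by (simp add: set_borel_measurable_def)
    show "AE \<tau> in lborel. norm (indicator {0<..<t} \<tau> *\<^sub>R F \<tau>)
        \<le> norm (indicator {0<..<t} \<tau> *\<^sub>R (M * ((t - \<tau>) powr (- a) * \<tau> powr (- b))))"
      using bound by (intro AE_I2) (auto simp: indicator_def intro: order_trans[OF _ abs_ge_self])
  qed
  assume M: "0 \<le> M"
  have "norm (LINT \<tau>:{0<..<t}|lborel. F \<tau>) \<le> (LINT \<tau>|lborel. norm (indicator {0<..<t} \<tau> *\<^sub>R F \<tau>))"
    unfolding set_lebesgue_integral_def by (rule integral_norm_bound)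
  also have "\<dots> \<le> (LINT \<tau>:{0<..<t}|lborel. M * ((t - \<tau>) powr (- a) * \<tau> powr (- b)))"
    unfolding set_lebesgue_integral_def
    using F_int int bound
    by (intro integral_mono integrable_norm) (auto simp: set_integrable_def indicator_def)
  also have "\<dots> = M * (LINT \<tau>:{0<..<t}|lborel. (t - \<tau>) powr (- a) * \<tau> powr (- b))"
    by simp
  also have "\<dots> \<le> M * (singular_constant a b * t powr (1 - a - b))"
    by (intro mult_left_mono singular_integral a b t M)
  finally show "norm (LINT \<tau>:{0<..<t}|lborel. F \<tau>) \<le> M * singular_constant a b * t powr (1 - a - b)"
    by (simp add: mult.assoc)
qed

text \<open>
  The abstract form of \<open>S s (g \<bullet> h)\<close> (\<open>a = 1/4\<close>) and of \<open>\<nabla> S s (g \<bullet> h)\<close> (\<open>a = 1/2\<close>).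
\<close>

locale singular_bilinear =
  fixes B :: "real \<Rightarrow> 'a::{banach, second_countable_topology} \<Rightarrow> 'a \<Rightarrow> 'b::{banach, second_countable_topology}"
    and C a :: real
  assumes bilinear: "bounded_bilinear (B s)"
    and measurable_B: "(\<lambda>(s, g, h). B s g h) \<in> borel_measurable borel"
    and bound_B: "0 < s \<Longrightarrow> s \<le> 1 \<Longrightarrow> norm (B s g h) \<le> C * s powr (- a) * norm g * norm h"
    and a: "0 \<le> a" "a < 1" and C: "0 < C"
begin

sublocale B: bounded_bilinear "B s" for s
  by (rule bilinear)

definition duhamel :: "(real \<Rightarrow> 'a) \<Rightarrow> (real \<Rightarrow> 'a) \<Rightarrow> real \<Rightarrow> 'b" where
  "duhamel p q t = (LINT \<tau>:{0<..<t}|lborel. B (t - \<tau>) (p \<tau>) (q \<tau>))"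

lemma measurable_duhamel_integrand:
  assumes [measurable]: "p \<in> borel_measurable borel" "q \<in> borel_measurable borel"
  shows "(\<lambda>(t, \<tau>). B (t - \<tau>) (p \<tau>) (q \<tau>)) \<in> borel_measurable (borel \<Otimes>\<^sub>M borel)"
proof -
  have "(\<lambda>(t, \<tau>). (t - \<tau>, p \<tau>, q \<tau>)) \<in> borel \<Otimes>\<^sub>M borel \<rightarrow>\<^sub>M borel \<Otimes>\<^sub>M (borel \<Otimes>\<^sub>M borel)"
    by measurable
  then have "(\<lambda>(t, \<tau>). (t - \<tau>, p \<tau>, q \<tau>)) \<in> borel \<Otimes>\<^sub>M borel \<rightarrow>\<^sub>M borel"
    by (simp add: borel_prod)
  from measurable_compose[OF this measurable_B] show ?thesis
    by (simp add: case_prod_unfold)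
qed

lemma set_measurable_duhamel:
  assumes "p \<in> borel_measurable borel" "q \<in> borel_measurable borel"
  shows "set_borel_measurable lborel {0<..<t} (\<lambda>\<tau>. B (t - \<tau>) (p \<tau>) (q \<tau>))"
proof -
  have "(\<lambda>\<tau>. B (t - \<tau>) (p \<tau>) (q \<tau>)) \<in> borel_measurable borel"
    using measurable_Pair2[OF measurable_duhamel_integrand[OF assms], of t] by simp
  then show ?thesis
    by (auto simp: set_borel_measurable_def intro!: borel_measurable_scaleR)
qed

lemma measurable_duhamel:
  assumes "p \<in> borel_measurable borel" "q \<in> borel_measurable borel"
  shows "duhamel p q \<in> borel_measurable borel"
proof -
  note [measurable] = measurable_duhamel_integrand[OF assms]
  have "(\<lambda>t. LINT \<tau>|lborel. indicator {z. 0 < snd z \<and> snd z < fst z} (t, \<tau>) *\<^sub>R B (t - \<tau>) (p \<tau>) (q \<tau>)) \<in> borel_measurable borel"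
    by (rule lborel.borel_measurable_lebesgue_integral) (simp add: case_prod_unfold[symmetric], measurable)
  moreover have "indicator {z. 0 < snd z \<and> snd z < fst z} (t, \<tau>) = (indicator {0<..<t} \<tau> :: real)" for t \<tau> :: real
    by (simp add: indicator_def)
  ultimately show ?thesis
    by (simp add: duhamel_def[abs_def] set_lebesgue_integral_def)
qed

lemma duhamel_cong_AE:
  assumes "p \<in> borel_measurable borel" "q \<in> borel_measurable borel"
    and "p' \<in> borel_measurable borel" "q' \<in> borel_measurable borel"
    and eq: "AE \<tau> in lborel. \<tau> \<in> {0<..<t} \<longrightarrow> p \<tau> = p' \<tau> \<and> q \<tau> = q' \<tau>"
  shows "duhamel p q t = duhamel p' q' t"
  unfolding duhamel_def set_lebesgue_integral_def
proof (rule integral_cong_AE)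
  show "AE \<tau> in lborel. indicator {0<..<t} \<tau> *\<^sub>R B (t - \<tau>) (p \<tau>) (q \<tau>) =
      indicator {0<..<t} \<tau> *\<^sub>R B (t - \<tau>) (p' \<tau>) (q' \<tau>)"
    using eq by eventually_elim (auto simp: indicator_def)
qed (use set_measurable_duhamel[OF assms(1,2), of t] set_measurable_duhamel[OF assms(3,4), of t]
    in \<open>simp_all add: set_borel_measurable_def\<close>)

lemma duhamel_bound:
  assumes p: "p \<in> borel_measurable borel" and q: "q \<in> borel_measurable borel"
    and t: "0 \<le> t" "t \<le> 1" and b: "0 \<le> b" "b < 1" and M: "0 \<le> M"
    and bound: "\<And>\<tau>. 0 < \<tau> \<Longrightarrow> \<tau> < t \<Longrightarrow> norm (p \<tau>) * norm (q \<tau>) \<le> M * \<tau> powr (- b)"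
  shows "set_integrable lborel {0<..<t} (\<lambda>\<tau>. B (t - \<tau>) (p \<tau>) (q \<tau>))"
    "norm (duhamel p q t) \<le> C * M * singular_constant a b * t powr (1 - a - b)"
proof -
  have "norm (B (t - \<tau>) (p \<tau>) (q \<tau>)) \<le> (C * M) * ((t - \<tau>) powr (- a) * \<tau> powr (- b))" if "0 < \<tau>" "\<tau> < t" for \<tau>
  proof -
    have "norm (B (t - \<tau>) (p \<tau>) (q \<tau>)) \<le> C * (t - \<tau>) powr (- a) * (norm (p \<tau>) * norm (q \<tau>))"
      using bound_B[of "t - \<tau>" "p \<tau>" "q \<tau>"] that t by (simp add: mult.assoc)
    also have "\<dots> \<le> C * (t - \<tau>) powr (- a) * (M * \<tau> powr (- b))"
      using C by (intro mult_left_mono bound that) auto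
    finally show ?thesis by (simp add: mult_ac)
  qed
  note * = set_integral_singular_bound[OF a b t(1) set_measurable_duhamel[OF p q] this]
  show "set_integrable lborel {0<..<t} (\<lambda>\<tau>. B (t - \<tau>) (p \<tau>) (q \<tau>))"
    by (rule *(1))
  show "norm (duhamel p q t) \<le> C * M * singular_constant a b * t powr (1 - a - b)"
    unfolding duhamel_def by (rule *(2)) (use C M in simp_all)
qed

text \<open>
  The data \<open>p\<close>, \<open>q\<close> are only measurable in time, so continuity must come from the kernel.  Cutting off the times
  within \<open>\<delta>\<close> of the singularity \<open>\<tau> = t\<close> leaves an integral that is continuous by dominated
  convergence; the part cut off is small uniformly in \<open>t\<close>, since the exponent \<open>a\<close> can be raised slightly.
\<close>

lemma continuous_on_duhamel:
  assumes p: "p \<in> borel_measurable borel" and q: "q \<in> borel_measurable borel"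
    and T: "T \<le> 1" and b: "0 \<le> b" "a + b < 1" and M: "0 \<le> M"
    and bound: "\<And>\<tau>. 0 < \<tau> \<Longrightarrow> \<tau> < T \<Longrightarrow> norm (p \<tau>) * norm (q \<tau>) \<le> M * \<tau> powr (- b)"
    and cont: "\<And>s0 g h. 0 < s0 \<Longrightarrow> continuous_on {s0..1} (\<lambda>s. B s g h)"
  shows "continuous_on {0..T} (duhamel p q)"
proof (rule uniform_limit_theorem)
  define \<delta> where "\<delta> n = 1 / real (Suc n)" for n
  have \<delta>: "0 < \<delta> n" for n by (simp add: \<delta>_def)
  define f where "f n t \<tau> = indicator {0<..<t - \<delta> n} \<tau> *\<^sub>R B (t - \<tau>) (p \<tau>) (q \<tau>)" for n t \<tau>
  define D where "D n t = (LINT \<tau>|lborel. f n t \<tau>)" for n t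
  have meas: "(\<lambda>\<tau>. B (t - \<tau>) (p \<tau>) (q \<tau>)) \<in> borel_measurable borel" for t
    using measurable_Pair2[OF measurable_duhamel_integrand[OF p q], of t] by simp
  have f_meas [measurable]: "f n t \<in> borel_measurable lborel" for n t
    using meas[of t] unfolding f_def by (auto intro!: borel_measurable_scaleR)
  have B_le: "norm (B (t - \<tau>) (p \<tau>) (q \<tau>)) \<le> C * (t - \<tau>) powr (- a) * (M * \<tau> powr (- b))"
    if "0 < \<tau>" "\<tau> < t" "t \<le> T" for t \<tau>
  proof -
    have "norm (B (t - \<tau>) (p \<tau>) (q \<tau>)) \<le> C * (t - \<tau>) powr (- a) * (norm (p \<tau>) * norm (q \<tau>))"
      using bound_B[of "t - \<tau>" "p \<tau>" "q \<tau>"] that T by (simp add: mult.assoc)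
    also have "\<dots> \<le> C * (t - \<tau>) powr (- a) * (M * \<tau> powr (- b))"
      using C that by (intro mult_left_mono bound) auto
    finally show ?thesis .
  qed
  have b1: "b < 1" using a b by simp
  have "continuous_on {0..T} (D n)" for n
  proof (rule continuous_on_sequentiallyI)
    fix x t assume x: "\<forall>m. x m \<in> {0..T}" and t: "t \<in> {0..T}" and lim: "x \<longlonglongrightarrow> t"
    show "(\<lambda>m. D n (x m)) \<longlonglongrightarrow> D n t"
      unfolding D_def
    proof (rule integral_dominated_convergence)
      show "integrable lborel (\<lambda>\<tau>. C * \<delta> n powr (- a) * M * (indicator {0..1} \<tau> * \<tau> powr (- b)))"
        using has_bochner_integral_powr[OF b1, of 1]
        by (intro integrable_mult_right) (auto intro: integrable.intros)
      show "AE \<tau> in lborel. norm (f n (x m) \<tau>) \<le> C * \<delta> n powr (- a) * M * (indicator {0..1} \<tau> * \<tau> powr (- b))" for m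
      proof (rule AE_I2)
        fix \<tau> :: real
        show "norm (f n (x m) \<tau>) \<le> C * \<delta> n powr (- a) * M * (indicator {0..1} \<tau> * \<tau> powr (- b))"
        proof (cases "\<tau> \<in> {0<..<x m - \<delta> n}")
          case True
          have xm: "x m \<in> {0..T}" using x by blast
          have "norm (f n (x m) \<tau>) \<le> C * (x m - \<tau>) powr (- a) * (M * \<tau> powr (- b))"
            using B_le[of \<tau> "x m"] True \<delta>[of n] xm by (simp add: f_def)
          also have "\<dots> \<le> C * \<delta> n powr (- a) * (M * \<tau> powr (- b))"
            using True \<delta>[of n] a C M by (intro mult_right_mono mult_left_mono powr_mono2') auto
          finally show ?thesis
            using True \<delta>[of n] xm T by (simp add: mult.assoc)
        next
          case False
          then show ?thesis using C M by (simp add: f_def)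
        qed
      qed
      \<comment> \<open>The cut-off jumps at this single time.\<close>
      have "AE \<tau> in lborel. \<tau> \<noteq> t - \<delta> n"
        by (rule AE_lborel_singleton)
      then show "AE \<tau> in lborel. (\<lambda>m. f n (x m) \<tau>) \<longlonglongrightarrow> f n t \<tau>"
      proof eventually_elim
        case (elim \<tau>)
        have lim': "(\<lambda>m. x m - \<delta> n) \<longlonglongrightarrow> t - \<delta> n"
          by (intro tendsto_intros lim)
        consider "\<tau> \<le> 0" | "0 < \<tau>" "\<tau> < t - \<delta> n" | "t - \<delta> n < \<tau>"
          using elim by linarith
        then show ?case
        proof cases
          case 1
          then show ?thesis by (simp add: f_def)
        next
          case 2
          have ev: "eventually (\<lambda>m. \<tau> < x m - \<delta> n) sequentially"
            using order_tendstoD(1)[OF lim' 2(2)] .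
          have "(\<lambda>m. B (x m - \<tau>) (p \<tau>) (q \<tau>)) \<longlonglongrightarrow> B (t - \<tau>) (p \<tau>) (q \<tau>)"
          proof (rule continuous_on_tendsto_compose[OF cont[OF \<delta>[of n]]])
            show "(\<lambda>m. x m - \<tau>) \<longlonglongrightarrow> t - \<tau>" by (intro tendsto_intros lim)
            show "t - \<tau> \<in> {\<delta> n..1}" using 2 t T by auto
            show "\<forall>\<^sub>F m in sequentially. x m - \<tau> \<in> {\<delta> n..1}"
              using ev
            proof eventually_elim
              case (elim m)
              have "x m \<in> {0..T}" using x by blast
              then show ?case using elim 2 T by auto
            qed
          qed
          moreover have "\<forall>\<^sub>F m in sequentially. B (x m - \<tau>) (p \<tau>) (q \<tau>) = f n (x m) \<tau>"
            using ev by eventually_elim (simp add: f_def 2)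
          ultimately show ?thesis
            using 2 by (simp add: f_def[of n t \<tau>]) (rule Lim_transform_eventually)
        next
          case 3
          then have "eventually (\<lambda>m. x m - \<delta> n < \<tau>) sequentially"
            using order_tendstoD(2)[OF lim'] by blast
          then have "\<forall>\<^sub>F m in sequentially. f n (x m) \<tau> = f n t \<tau>"
            using 3 by (auto elim!: eventually_mono simp: f_def)
          then show ?thesis by (rule tendsto_eventually)
        qed
      qed
    qed auto
  qed
  then show "\<forall>\<^sub>F n in sequentially. continuous_on {0..T} (D n)"
    by (intro always_eventually) auto
  \<comment> \<open>Half of the gap: \<open>a + \<epsilon>\<close> is still an integrable exponent, and \<open>(t - \<tau>) powr \<epsilon>\<close> is small near the singularity.\<close>
  define \<epsilon> where "\<epsilon> = (1 - a - b) / 2"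
  have \<epsilon>: "0 < \<epsilon>" "a + \<epsilon> < 1"
  proof -
    have "2 * \<epsilon> = 1 - a - b" by (simp add: \<epsilon>_def)
    then show "0 < \<epsilon>" "a + \<epsilon> < 1" using a b by linarith+
  qed
  define K where "K = C * M * singular_constant (a + \<epsilon>) b"
  have K: "0 \<le> K"
    unfolding K_def using C M less_imp_le[OF singular_constant_pos[OF \<epsilon>(2) b1]] by simp
  have close: "norm (D n t - duhamel p q t) \<le> \<delta> n powr \<epsilon> * K" if t: "t \<in> {0..T}" for n t
  proof -
    define r where "r \<tau> = indicator {t - \<delta> n..} \<tau> *\<^sub>R B (t - \<tau>) (p \<tau>) (q \<tau>)" for \<tau>
    have r_meas: "set_borel_measurable lborel {0<..<t} r"
      using meas[of t] unfolding r_def set_borel_measurable_def by (auto intro!: borel_measurable_scaleR)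
    have r_le: "norm (r \<tau>) \<le> (\<delta> n powr \<epsilon> * (C * M)) * ((t - \<tau>) powr (- (a + \<epsilon>)) * \<tau> powr (- b))" if "0 < \<tau>" "\<tau> < t" for \<tau>
    proof (cases "t - \<delta> n \<le> \<tau>")
      case True
      have "norm (r \<tau>) \<le> C * (t - \<tau>) powr (- a) * (M * \<tau> powr (- b))"
        using B_le[OF that] t True by (simp add: r_def)
      also have "(t - \<tau>) powr (- a) = (t - \<tau>) powr \<epsilon> * (t - \<tau>) powr (- (a + \<epsilon>))"
        by (simp add: powr_add[symmetric])
      also have "C * ((t - \<tau>) powr \<epsilon> * (t - \<tau>) powr (- (a + \<epsilon>))) * (M * \<tau> powr (- b)) \<le>
          C * (\<delta> n powr \<epsilon> * (t - \<tau>) powr (- (a + \<epsilon>))) * (M * \<tau> powr (- b))"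
        using True that \<epsilon> C M by (intro mult_right_mono mult_left_mono powr_mono2) auto
      finally show ?thesis by (simp add: mult_ac)
    next
      case False
      then show ?thesis using C M by (simp add: r_def)
    qed
    have "D n t = (LINT \<tau>|lborel. (indicator {0<..<t} \<tau> *\<^sub>R B (t - \<tau>) (p \<tau>) (q \<tau>)) - (indicator {0<..<t} \<tau> *\<^sub>R r \<tau>))"
      unfolding D_def using \<delta>[of n]
      by (intro Bochner_Integration.integral_cong) (auto simp: f_def r_def indicator_def)
    also have "\<dots> = duhamel p q t - (LINT \<tau>:{0<..<t}|lborel. r \<tau>)"
      unfolding duhamel_def set_lebesgue_integral_def
    proof (rule Bochner_Integration.integral_diff)
      show "integrable lborel (\<lambda>\<tau>. indicator {0<..<t} \<tau> *\<^sub>R B (t - \<tau>) (p \<tau>) (q \<tau>))"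
        using duhamel_bound(1)[OF p q, of t b M] t T b(1) b1 M bound by (simp add: set_integrable_def)
      show "integrable lborel (\<lambda>\<tau>. indicator {0<..<t} \<tau> *\<^sub>R r \<tau>)"
        using set_integral_singular_bound(1)[OF _ \<epsilon>(2) b(1) b1 _ r_meas r_le] a \<epsilon> t by (simp add: set_integrable_def)
    qed
    finally have "norm (D n t - duhamel p q t) = norm (LINT \<tau>:{0<..<t}|lborel. r \<tau>)"
      by simp
    also have "\<dots> \<le> (\<delta> n powr \<epsilon> * (C * M)) * singular_constant (a + \<epsilon>) b * t powr (1 - (a + \<epsilon>) - b)"
      by (rule set_integral_singular_bound(2)[OF _ \<epsilon>(2) b(1) b1 _ r_meas r_le]) (use a \<epsilon> t C M in auto)
    also have "\<dots> = \<delta> n powr \<epsilon> * K * t powr (1 - (a + \<epsilon>) - b)"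
      by (simp add: K_def)
    also have "\<dots> \<le> \<delta> n powr \<epsilon> * K * 1"
    proof (rule mult_left_mono)
      have eq: "1 - (a + \<epsilon>) - b = \<epsilon>" by (simp add: \<epsilon>_def field_simps)
      show "t powr (1 - (a + \<epsilon>) - b) \<le> 1"
        unfolding eq using t T \<epsilon> powr_mono2[of \<epsilon> t 1] by simp
    qed (use K in simp)
    finally show ?thesis by simp
  qed
  have "(\<lambda>n. \<delta> n powr \<epsilon>) \<longlonglongrightarrow> 0 powr \<epsilon>"
    unfolding \<delta>_def using \<epsilon> LIMSEQ_inverse_real_of_nat
    by (intro tendsto_powr') (auto simp: inverse_eq_divide)
  then have "(\<lambda>n. \<delta> n powr \<epsilon> * K) \<longlonglongrightarrow> 0"
    using \<epsilon> tendsto_mult_left_zero by fastforce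
  then show "uniform_limit {0..T} D (duhamel p q) sequentially"
    unfolding uniform_limit_iff dist_norm
  proof (intro allI impI)
    fix e :: real assume "0 < e"
    with \<open>(\<lambda>n. \<delta> n powr \<epsilon> * K) \<longlonglongrightarrow> 0\<close> have "eventually (\<lambda>n. \<delta> n powr \<epsilon> * K < e) sequentially"
      by (rule order_tendstoD(2))
    then show "\<forall>\<^sub>F n in sequentially. \<forall>t\<in>{0..T}. norm (D n t - duhamel p q t) < e"
      by eventually_elim (auto intro!: le_less_trans[OF close])
  qed
qed simp

end


lemma one_le_powr_minus:
  fixes t :: real
  assumes "0 < t" "t \<le> 1" "0 \<le> c"
  shows "1 \<le> t powr (- c)"
  using powr_mono2'[of "- c" t 1] assms by simp

text \<open>
  The equation to be solved is \<open>u = u0 - forcing u\<close>.  If \<open>u\<close> is of size \<open>t powr (-1/4)\<close>, the singularities of the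
  integrand at \<open>\<tau> = 0\<close> and at \<open>\<tau> = t\<close> both have the exponent \<open>1/2\<close>, so that \<open>forcing u\<close> is bounded uniformly in
  \<open>t\<close>; compared with \<open>t powr (-1/4)\<close> this gains a factor \<open>t powr (1/4)\<close>.
\<close>

locale volterra = singular_bilinear B C "1/2"
  for B :: "real \<Rightarrow> 'a::{banach, second_countable_topology} \<Rightarrow> 'a \<Rightarrow> 'a" and C +
  fixes v :: "real \<Rightarrow> 'a" and V :: real
  assumes v [measurable]: "v \<in> borel_measurable borel" and v_bound: "\<And>t. norm (v t) \<le> V"
begin

lemma V_nonneg: "0 \<le> V"
  using norm_ge_zero v_bound by (rule order_trans)

definition forcing :: "(real \<Rightarrow> 'a) \<Rightarrow> real \<Rightarrow> 'a" where
  "forcing u = duhamel (\<lambda>\<tau>. (1/2) *\<^sub>R u \<tau> + v \<tau>) u"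

definition admissible :: "real \<Rightarrow> real \<Rightarrow> (real \<Rightarrow> 'a) \<Rightarrow> bool" where
  "admissible T R u \<longleftrightarrow> u \<in> borel_measurable borel \<and> (\<forall>t. 0 < t \<longrightarrow> t \<le> T \<longrightarrow> norm (u t) \<le> R * t powr (- (1/4)))"

lemma product_le:
  assumes u: "admissible T R u" and T: "T \<le> 1" and R: "0 \<le> R" and \<tau>: "0 < \<tau>" "\<tau> \<le> T"
  shows "norm ((1/2) *\<^sub>R u \<tau> + v \<tau>) \<le> (R / 2 + V) * \<tau> powr (- (1/4))"
proof -
  have "norm ((1/2) *\<^sub>R u \<tau> + v \<tau>) \<le> norm (u \<tau>) / 2 + norm (v \<tau>)"
    by (rule order_trans[OF norm_triangle_ineq]) simp
  also have "\<dots> \<le> R * \<tau> powr (- (1/4)) / 2 + V * \<tau> powr (- (1/4))"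
  proof (intro add_mono divide_right_mono)
    show "norm (u \<tau>) \<le> R * \<tau> powr (- (1/4))" using u \<tau> by (simp add: admissible_def)
    have "V * 1 \<le> V * \<tau> powr (- (1/4))"
      using \<tau> T by (intro mult_left_mono one_le_powr_minus V_nonneg) auto
    then show "norm (v \<tau>) \<le> V * \<tau> powr (- (1/4))" using v_bound[of \<tau>] by simp
  qed simp
  finally show ?thesis by (simp add: distrib_right)
qed

lemma forcing_bound:
  assumes u: "admissible T R u" and T: "T \<le> 1" and R: "0 \<le> R" and t: "0 \<le> t" "t \<le> T"
  shows "set_integrable lborel {0<..<t} (\<lambda>\<tau>. B (t - \<tau>) ((1/2) *\<^sub>R u \<tau> + v \<tau>) (u \<tau>))"
    "norm (forcing u t) \<le> C * singular_constant (1/2) (1/2) * ((R / 2 + V) * R)"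
proof -
  have [measurable]: "u \<in> borel_measurable borel" using u by (simp add: admissible_def)
  have M: "0 \<le> (R / 2 + V) * R" using R V_nonneg by simp
  have "norm ((1/2) *\<^sub>R u \<tau> + v \<tau>) * norm (u \<tau>) \<le> ((R / 2 + V) * R) * \<tau> powr (- (1/2))"
    if "0 < \<tau>" "\<tau> < t" for \<tau>
  proof -
    have "norm ((1/2) *\<^sub>R u \<tau> + v \<tau>) * norm (u \<tau>) \<le> ((R / 2 + V) * \<tau> powr (- (1/4))) * (R * \<tau> powr (- (1/4)))"
      using that t u R V_nonneg
      by (intro mult_mono product_le[OF u T R]) (auto simp: admissible_def)
    also have "\<dots> = ((R / 2 + V) * R) * (\<tau> powr (- (1/4)) * \<tau> powr (- (1/4)))"
      by (simp only: mult_ac)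
    finally show ?thesis by (simp add: powr_add[symmetric])
  qed
  note * = duhamel_bound[OF _ _ t(1) order_trans[OF t(2) T] _ _ M this]
  show "set_integrable lborel {0<..<t} (\<lambda>\<tau>. B (t - \<tau>) ((1/2) *\<^sub>R u \<tau> + v \<tau>) (u \<tau>))"
    by (rule *(1)) auto
  have "norm (forcing u t) \<le> C * ((R / 2 + V) * R) * singular_constant (1/2) (1/2) * t powr (1 - 1/2 - 1/2)"
    unfolding forcing_def by (rule *(2)) auto
  also have "\<dots> \<le> C * ((R / 2 + V) * R) * singular_constant (1/2) (1/2) * 1"
    using M C less_imp_le[OF singular_constant_pos[of "1/2" "1/2"]] by (intro mult_left_mono) auto
  finally show "norm (forcing u t) \<le> C * singular_constant (1/2) (1/2) * ((R / 2 + V) * R)"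
    by (simp add: mult_ac)
qed

lemma measurable_forcing: "u \<in> borel_measurable borel \<Longrightarrow> forcing u \<in> borel_measurable borel"
  unfolding forcing_def by (rule measurable_duhamel) auto

text \<open>
  The exponent \<open>a'\<close> leaves room for both uses: \<open>a' = 1/2\<close> with the plain weighted norm for existence, and
  \<open>a' = 5/8\<close>, after trading an exponential weight for a power of \<open>t - \<tau>\<close>, for uniqueness.
\<close>

lemma forcing_diff_bound:
  assumes u: "admissible T R u" and u': "admissible T R u'" and T: "T \<le> 1" and R: "0 \<le> R"
    and t: "0 \<le> t" "t \<le> T" and a': "0 \<le> a'" "a' < 1" and W: "0 \<le> W"
    and diff: "\<And>\<tau>. 0 < \<tau> \<Longrightarrow> \<tau> < t \<Longrightarrow>
      (t - \<tau>) powr (- (1/2)) * norm (u \<tau> - u' \<tau>) \<le> W * (t - \<tau>) powr (- a') * \<tau> powr (- (1/4))"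
  shows "norm (forcing u t - forcing u' t) \<le> C * (R + V) * W * singular_constant a' (1/2) * t powr (1/2 - a')"
proof -
  define F where "F \<tau> = B (t - \<tau>) ((1/2) *\<^sub>R u \<tau> + v \<tau>) (u \<tau>) - B (t - \<tau>) ((1/2) *\<^sub>R u' \<tau> + v \<tau>) (u' \<tau>)" for \<tau>
  note int = forcing_bound(1)[OF u T R t] forcing_bound(1)[OF u' T R t]
  have "set_integrable lborel {0<..<t} F"
    unfolding F_def by (rule set_integral_diff(1)[OF int])
  then have F_meas: "set_borel_measurable lborel {0<..<t} F"
    by (auto simp: set_integrable_def set_borel_measurable_def)
  have F_le: "norm (F \<tau>) \<le> (C * (R + V) * W) * ((t - \<tau>) powr (- a') * \<tau> powr (- (1/2)))" if \<tau>: "0 < \<tau>" "\<tau> < t" for \<tau>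
  proof -
    define w where "w = u \<tau> - u' \<tau>"
    have ts: "0 < t - \<tau>" "t - \<tau> \<le> 1" using \<tau> t T by auto
    have "F \<tau> = B (t - \<tau>) ((1/2) *\<^sub>R w) (u \<tau>) + B (t - \<tau>) ((1/2) *\<^sub>R u' \<tau> + v \<tau>) w"
      by (simp add: F_def w_def B.add_left B.diff_left B.diff_right scaleR_diff_right)
    then have "norm (F \<tau>) \<le> norm (B (t - \<tau>) ((1/2) *\<^sub>R w) (u \<tau>)) + norm (B (t - \<tau>) ((1/2) *\<^sub>R u' \<tau> + v \<tau>) w)"
      by (simp add: norm_triangle_ineq)
    also have "\<dots> \<le> C * (t - \<tau>) powr (- (1/2)) * norm ((1/2) *\<^sub>R w) * norm (u \<tau>) +
        C * (t - \<tau>) powr (- (1/2)) * norm ((1/2) *\<^sub>R u' \<tau> + v \<tau>) * norm w"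
      by (intro add_mono bound_B ts)
    also have "\<dots> = C * ((t - \<tau>) powr (- (1/2)) * norm w) * (norm (u \<tau>) / 2 + norm ((1/2) *\<^sub>R u' \<tau> + v \<tau>))"
      by (simp add: algebra_simps)
    also have "\<dots> \<le> C * (W * (t - \<tau>) powr (- a') * \<tau> powr (- (1/4))) * (R * \<tau> powr (- (1/4)) / 2 + (R / 2 + V) * \<tau> powr (- (1/4)))"
    proof (rule mult_mono)
      show "C * ((t - \<tau>) powr (- (1/2)) * norm w) \<le> C * (W * (t - \<tau>) powr (- a') * \<tau> powr (- (1/4)))"
        unfolding w_def using C by (intro mult_left_mono diff[OF \<tau>]) auto
      have "norm (u \<tau>) \<le> R * \<tau> powr (- (1/4))"
        using u \<tau> t by (simp add: admissible_def)
      moreover have "norm ((1/2) *\<^sub>R u' \<tau> + v \<tau>) \<le> (R / 2 + V) * \<tau> powr (- (1/4))"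
        using \<tau> t by (intro product_le[OF u' T R]) auto
      ultimately show "norm (u \<tau>) / 2 + norm ((1/2) *\<^sub>R u' \<tau> + v \<tau>) \<le>
          R * \<tau> powr (- (1/4)) / 2 + (R / 2 + V) * \<tau> powr (- (1/4))"
        by linarith
    qed (use C W in auto)
    also have "\<dots> = (C * (R + V) * W) * ((t - \<tau>) powr (- a') * (\<tau> powr (- (1/4)) * \<tau> powr (- (1/4))))"
      by (simp add: field_simps)
    finally show ?thesis by (simp add: powr_add[symmetric])
  qed
  have "forcing u t - forcing u' t = (LINT \<tau>:{0<..<t}|lborel. F \<tau>)"
    unfolding F_def forcing_def duhamel_def by (rule set_integral_diff(2)[OF int, symmetric])
  also have "norm \<dots> \<le> (C * (R + V) * W) * singular_constant a' (1/2) * t powr (1 - a' - 1/2)"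
    by (rule set_integral_singular_bound(2)[OF a' _ _ t(1) F_meas F_le]) (use C R V_nonneg W in auto)
  also have "1 - a' - 1/2 = 1/2 - a'" by simp
  finally show ?thesis .
qed

lemma contraction:
  assumes u: "admissible T R u" and u': "admissible T R u'" and T: "T \<le> 1" and R: "0 \<le> R"
    and small: "C * singular_constant (1/2) (1/2) * (R + V) * T powr (1/4) \<le> 1/2"
    and W: "0 \<le> W" and diff: "\<And>\<tau>. 0 < \<tau> \<Longrightarrow> \<tau> \<le> T \<Longrightarrow> norm (u \<tau> - u' \<tau>) \<le> W * \<tau> powr (- (1/4))"
    and t: "0 < t" "t \<le> T"
  shows "norm (forcing u t - forcing u' t) \<le> W / 2 * t powr (- (1/4))"
proof -
  have "norm (forcing u t - forcing u' t) \<le> C * (R + V) * W * singular_constant (1/2) (1/2) * t powr (1/2 - 1/2)"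
  proof (rule forcing_diff_bound[OF u u' T R _ t(2) _ _ W])
    fix \<tau> assume "0 < \<tau>" "\<tau> < t"
    then have "(t - \<tau>) powr (- (1/2)) * norm (u \<tau> - u' \<tau>) \<le> (t - \<tau>) powr (- (1/2)) * (W * \<tau> powr (- (1/4)))"
      using t by (intro mult_left_mono diff) auto
    then show "(t - \<tau>) powr (- (1/2)) * norm (u \<tau> - u' \<tau>) \<le> W * (t - \<tau>) powr (- (1/2)) * \<tau> powr (- (1/4))"
      by (simp only: mult_ac)
  qed (use t in auto)
  also have "\<dots> = C * singular_constant (1/2) (1/2) * (R + V) * W * (t powr (1/4) * t powr (- (1/4)))"
    using t by (simp add: powr_add[symmetric])
  also have "\<dots> \<le> C * singular_constant (1/2) (1/2) * (R + V) * W * (T powr (1/4) * t powr (- (1/4)))"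
    using C R V_nonneg W t less_imp_le[OF singular_constant_pos[of "1/2" "1/2"]]
    by (intro mult_left_mono mult_right_mono powr_mono2) auto
  also have "\<dots> = (C * singular_constant (1/2) (1/2) * (R + V) * T powr (1/4)) * (W * t powr (- (1/4)))"
    by (simp only: mult_ac)
  also have "\<dots> \<le> 1/2 * (W * t powr (- (1/4)))"
    using W by (intro mult_right_mono small) auto
  finally show ?thesis by simp
qed

text \<open>
  Picard iteration in the ball of radius \<open>A + 1\<close> of the weighted norm.  The iterates converge pointwise, uniformly
  with respect to the weight, so the limit is Borel measurable and solves the equation.
\<close>

lemma existence:
  assumes u0: "admissible T A u0" and T: "0 < T" "T \<le> 1" and A: "0 \<le> A"
    and small: "C * singular_constant (1/2) (1/2) * (A + 1 + V) * (A + 1) * T powr (1/4) \<le> 1/2"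
  shows "\<exists>u. admissible T (A + 1) u \<and> (\<forall>t. 0 < t \<longrightarrow> t \<le> T \<longrightarrow> u t = u0 t - forcing u t)"
proof -
  define R where "R = A + 1"
  define K where "K = C * singular_constant (1/2) (1/2)"
  have R: "0 \<le> R" "1 \<le> R" using A by (auto simp: R_def)
  have K: "0 \<le> K" using C less_imp_le[OF singular_constant_pos[of "1/2" "1/2"]] by (simp add: K_def)
  have smallR: "K * (R + V) * T powr (1/4) * R \<le> 1/2"
    using small by (simp add: K_def R_def mult_ac)
  have small1: "K * (R + V) * T powr (1/4) \<le> 1/2"
  proof -
    have "K * (R + V) * T powr (1/4) * 1 \<le> K * (R + V) * T powr (1/4) * R"
      using K R V_nonneg by (intro mult_left_mono) auto
    then show ?thesis using smallR by simp
  qed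
  define \<Phi> where "\<Phi> u t = u0 t - forcing u t" for u t
  have \<Phi>: "admissible T R (\<Phi> u)" if u: "admissible T R u" for u
    unfolding admissible_def
  proof (intro conjI allI impI)
    have [measurable]: "u \<in> borel_measurable borel" "u0 \<in> borel_measurable borel"
      using u u0 by (simp_all add: admissible_def)
    show "\<Phi> u \<in> borel_measurable borel"
      unfolding \<Phi>_def[abs_def] using measurable_forcing by measurable
    fix t assume t: "0 < t" "t \<le> T"
    have "norm (forcing u t) \<le> K * ((R / 2 + V) * R)"
      using forcing_bound(2)[OF u T(2) R(1)] t by (simp add: K_def)
    also have "\<dots> \<le> K * ((R + V) * R)"
      using K R by (intro mult_left_mono mult_right_mono) auto
    also have "\<dots> = K * (R + V) * R * (t powr (1/4) * t powr (- (1/4)))"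
      using t by (simp add: powr_add[symmetric])
    also have "\<dots> \<le> K * (R + V) * R * (T powr (1/4) * t powr (- (1/4)))"
      using K R V_nonneg t by (intro mult_left_mono mult_right_mono powr_mono2) auto
    also have "\<dots> = (K * (R + V) * T powr (1/4) * R) * t powr (- (1/4))"
      by (simp only: mult_ac)
    also have "\<dots> \<le> 1 * t powr (- (1/4))"
      using smallR by (intro mult_right_mono) auto
    finally have "norm (\<Phi> u t) \<le> A * t powr (- (1/4)) + 1 * t powr (- (1/4))"
      using u0 t unfolding \<Phi>_def by (intro norm_triangle_le_diff add_mono) (auto simp: admissible_def)
    then show "norm (\<Phi> u t) \<le> R * t powr (- (1/4))"
      by (simp add: R_def distrib_right)
  qed
  define w where "w n = (\<Phi> ^^ n) (\<lambda>t. 0)" for n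
  have w_Suc: "w (Suc n) = \<Phi> (w n)" for n by (simp add: w_def)
  have w: "admissible T R (w n)" for n
  proof (induction n)
    case 0
    then show ?case using R by (simp add: w_def admissible_def)
  next
    case (Suc n)
    then show ?case by (simp add: w_Suc \<Phi>)
  qed
  \<comment> \<open>Contraction, applied \<open>n\<close> times to the distance of two elements of the ball.\<close>
  have close: "norm (w (m + n) t - w n t) \<le> 2 * R / 2 ^ n * t powr (- (1/4))" if "0 < t" "t \<le> T" for m n t
    using that
  proof (induction n arbitrary: t)
    case 0
    have "norm (w m t - w 0 t) \<le> R * t powr (- (1/4)) + R * t powr (- (1/4))"
      using w[of m] w[of 0] 0 by (intro norm_triangle_le_diff add_mono) (auto simp: admissible_def)
    then show ?case by simp
  next
    case (Suc n)
    have "norm (forcing (w (m + n)) t - forcing (w n) t) \<le> (2 * R / 2 ^ n) / 2 * t powr (- (1/4))"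
      by (rule contraction[OF w w T(2) R(1) _ _ Suc.IH Suc.prems]) (use small1 R in \<open>simp_all add: K_def\<close>)
    then show ?case
      by (simp add: w_Suc \<Phi>_def norm_minus_commute mult.commute)
  qed
  have zero: "(\<lambda>n. 2 * R / 2 ^ n * c) \<longlonglongrightarrow> 0" for c
  proof -
    have "(\<lambda>n. (2 * R * c) * (1 / 2) ^ n) \<longlonglongrightarrow> (2 * R * c) * 0"
      by (intro tendsto_intros LIMSEQ_power_zero) simp
    then show ?thesis by (simp add: power_divide mult_ac)
  qed
  define u where "u t = (if 0 < t \<and> t \<le> T then lim (\<lambda>n. w n t) else 0)" for t
  have lim: "(\<lambda>n. w n t) \<longlonglongrightarrow> u t" if t: "0 < t" "t \<le> T" for t
  proof -
    have "Cauchy (\<lambda>n. w n t)"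
    proof (rule metric_CauchyI)
      fix e :: real assume "0 < e"
      then have "eventually (\<lambda>n. 2 * R / 2 ^ n * t powr (- (1/4)) < e / 2) sequentially"
        by (intro order_tendstoD(2)[OF zero]) simp
      then obtain N where N: "2 * R / 2 ^ N * t powr (- (1/4)) < e / 2"
        by (auto simp: eventually_sequentially)
      have "dist (w n t) (w N t) < e / 2" if "N \<le> n" for n
        using close[OF t, of "n - N" N] N that by (simp add: dist_norm)
      then show "\<exists>M. \<forall>m\<ge>M. \<forall>n\<ge>M. dist (w m t) (w n t) < e"
        by (intro exI[of _ N]) (meson dist_triangle_half_l)
    qed
    then show ?thesis
      using t by (simp add: u_def Cauchy_convergent_iff convergent_LIMSEQ_iff)
  qed
  have u: "admissible T R u"
    unfolding admissible_def
  proof (intro conjI allI impI)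
    have [measurable]: "w n \<in> borel_measurable borel" for n
      using w by (simp add: admissible_def)
    show "u \<in> borel_measurable borel"
    proof (rule borel_measurable_LIMSEQ_metric)
      show "(\<lambda>t. indicator {0<..T} t *\<^sub>R w n t) \<in> borel_measurable borel" for n by measurable
      show "(\<lambda>n. indicator {0<..T} t *\<^sub>R w n t) \<longlonglongrightarrow> u t" for t
        using lim[of t] by (cases "0 < t \<and> t \<le> T") (auto simp: u_def)
    qed
    fix t assume t: "0 < t" "t \<le> T"
    show "norm (u t) \<le> R * t powr (- (1/4))"
      by (rule tendsto_upperbound[OF tendsto_norm[OF lim[OF t]]]) (use w t in \<open>auto simp: admissible_def\<close>)
  qed
  have near: "norm (u t - w n t) \<le> 2 * R / 2 ^ n * t powr (- (1/4))" if t: "0 < t" "t \<le> T" for n t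
  proof (rule tendsto_upperbound)
    show "(\<lambda>m. norm (w (m + n) t - w n t)) \<longlonglongrightarrow> norm (u t - w n t)"
      by (intro tendsto_intros LIMSEQ_ignore_initial_segment lim t)
  qed (use close[OF t] in auto)
  have "u t = u0 t - forcing u t" if t: "0 < t" "t \<le> T" for t
  proof -
    have "norm (u t - \<Phi> u t) \<le> 2 * R / 2 ^ n * t powr (- (1/4))" for n
    proof -
      have "norm (forcing u t - forcing (w n) t) \<le> (2 * R / 2 ^ n) / 2 * t powr (- (1/4))"
        by (rule contraction[OF u w T(2) R(1) _ _ near t]) (use small1 R in \<open>simp_all add: K_def\<close>)
      moreover have "norm (u t - w (Suc n) t) \<le> (2 * R / 2 ^ n) / 2 * t powr (- (1/4))"
        using near[OF t, of "Suc n"] by (simp add: mult.commute)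
      moreover have "u t - \<Phi> u t = (u t - w (Suc n) t) + (forcing u t - forcing (w n) t)"
        by (simp add: w_Suc \<Phi>_def)
      ultimately have "norm (u t - \<Phi> u t) \<le> (2 * R / 2 ^ n) / 2 * t powr (- (1/4)) + (2 * R / 2 ^ n) / 2 * t powr (- (1/4))"
        by (simp only:) (intro norm_triangle_le add_mono)
      then show ?thesis by simp
    qed
    then have "norm (u t - \<Phi> u t) \<le> 0"
      by (intro tendsto_lowerbound[OF zero[of "t powr (- (1/4))"]]) auto
    then show ?thesis by (simp add: \<Phi>_def)
  qed
  with u show ?thesis by (auto simp: R_def)
qed

text \<open>
  As \<open>R\<close> is arbitrary, the plain weighted norm need not give a contraction up to time \<open>T\<close>.  With the weight
  \<open>exp (\<mu> * t)\<close> the kernel gains the factor \<open>exp (- \<mu> * (t - \<tau>)) \<le> (\<mu> * (t - \<tau>)) powr (-1/8)\<close>: the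
  singularity becomes slightly stronger, but the constant becomes small as \<open>\<mu>\<close> grows.
\<close>

lemma uniqueness:
  assumes u: "admissible T R u" and u': "admissible T R u'" and T: "T \<le> 1" and R: "0 \<le> R"
    and eq: "\<And>t. 0 < t \<Longrightarrow> t \<le> T \<Longrightarrow> u t = u0 t - forcing u t"
    and eq': "\<And>t. 0 < t \<Longrightarrow> t \<le> T \<Longrightarrow> u' t = u0 t - forcing u' t"
    and t: "0 < t" "t \<le> T"
  shows "u t = u' t"
proof -
  define K where "K = C * (R + V) * singular_constant (5/8) (1/2)"
  have K: "0 \<le> K"
    using C R V_nonneg less_imp_le[OF singular_constant_pos[of "5/8" "1/2"]] by (simp add: K_def)
  \<comment> \<open>Makes \<open>K * \<mu> powr (-1/8) \<le> 1/2\<close>.\<close>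
  define \<mu> where "\<mu> = (2 * K + 1) powr 8"
  have mu: "0 < \<mu>" using K by (simp add: \<mu>_def)
  have mu_powr: "\<mu> powr (- (1/8)) = 1 / (2 * K + 1)"
  proof -
    have "\<mu> powr (1/8) = 2 * K + 1"
      unfolding \<mu>_def powr_powr using K by simp
    then show ?thesis by (simp add: powr_minus_divide)
  qed
  have exp_le: "exp (- y) \<le> y powr (- (1/8))" if "0 < y" for y :: real
  proof -
    have "ln y \<le> y - 1" using that by (rule ln_le_minus_one)
    then have "- y \<le> - (1/8) * ln y"
      using that by (cases "0 \<le> ln y") (linarith, simp)
    then show ?thesis using that by (simp add: powr_def)
  qed
  have step: "norm (u t - u' t) \<le> W / 2 * exp (\<mu> * t) * t powr (- (1/4))"
    if W: "0 \<le> W" and IH: "\<And>t. 0 < t \<Longrightarrow> t \<le> T \<Longrightarrow> norm (u t - u' t) \<le> W * exp (\<mu> * t) * t powr (- (1/4))"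
      and t: "0 < t" "t \<le> T" for W t
  proof -
    define W' where "W' = W * exp (\<mu> * t) * \<mu> powr (- (1/8))"
    have W': "0 \<le> W'" using W by (simp add: W'_def)
    have "norm (u t - u' t) = norm (forcing u t - forcing u' t)"
      using eq[OF t] eq'[OF t] by (simp add: norm_minus_commute)
    also have "\<dots> \<le> C * (R + V) * W' * singular_constant (5/8) (1/2) * t powr (1/2 - 5/8)"
    proof (rule forcing_diff_bound[OF u u' T R _ t(2) _ _ W'])
      fix \<tau> assume \<tau>: "0 < \<tau>" "\<tau> < t"
      have "exp (\<mu> * \<tau>) = exp (\<mu> * t) * exp (- (\<mu> * (t - \<tau>)))"
        by (simp add: exp_add[symmetric] algebra_simps)
      also have "\<dots> \<le> exp (\<mu> * t) * (\<mu> * (t - \<tau>)) powr (- (1/8))"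
        using \<tau> mu by (intro mult_left_mono exp_le) auto
      also have "\<dots> = exp (\<mu> * t) * \<mu> powr (- (1/8)) * (t - \<tau>) powr (- (1/8))"
        using \<tau> mu by (simp add: powr_mult)
      finally have e: "exp (\<mu> * \<tau>) \<le> exp (\<mu> * t) * \<mu> powr (- (1/8)) * (t - \<tau>) powr (- (1/8))" .
      have "(t - \<tau>) powr (- (1/2)) * norm (u \<tau> - u' \<tau>) \<le> (t - \<tau>) powr (- (1/2)) * (W * exp (\<mu> * \<tau>) * \<tau> powr (- (1/4)))"
        using \<tau> t by (intro mult_left_mono IH) auto
      also have "\<dots> \<le> (t - \<tau>) powr (- (1/2)) * (W * (exp (\<mu> * t) * \<mu> powr (- (1/8)) * (t - \<tau>) powr (- (1/8))) * \<tau> powr (- (1/4)))"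
        using W by (intro mult_left_mono mult_right_mono e) auto
      also have "\<dots> = W' * ((t - \<tau>) powr (- (1/2)) * (t - \<tau>) powr (- (1/8))) * \<tau> powr (- (1/4))"
        by (simp only: W'_def mult_ac)
      finally show "(t - \<tau>) powr (- (1/2)) * norm (u \<tau> - u' \<tau>) \<le> W' * (t - \<tau>) powr (- (5/8)) * \<tau> powr (- (1/4))"
        by (simp add: powr_add[symmetric])
    qed (use t in auto)
    also have "\<dots> = (K * \<mu> powr (- (1/8))) * (W * exp (\<mu> * t) * t powr (1/2 - 5/8))"
      by (simp only: W'_def K_def mult_ac)
    also have "\<dots> \<le> 1/2 * (W * exp (\<mu> * t) * t powr (- (1/4)))"
    proof (rule mult_mono)
      show "K * \<mu> powr (- (1/8)) \<le> 1/2"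
        using K by (simp add: mu_powr field_simps)
      show "W * exp (\<mu> * t) * t powr (1/2 - 5/8) \<le> W * exp (\<mu> * t) * t powr (- (1/4))"
        using W t T by (intro mult_left_mono powr_mono') auto
    qed (use W in auto)
    finally show ?thesis by simp
  qed
  have "norm (u t - u' t) \<le> 2 * R / 2 ^ n * exp (\<mu> * t) * t powr (- (1/4))" if "0 < t" "t \<le> T" for n t
    using that
  proof (induction n arbitrary: t)
    case 0
    have "norm (u t - u' t) \<le> R * t powr (- (1/4)) + R * t powr (- (1/4))"
      using u u' 0 by (intro norm_triangle_le_diff add_mono) (auto simp: admissible_def)
    also have "\<dots> = 1 * (2 * R * t powr (- (1/4)))" by simp
    also have "\<dots> \<le> exp (\<mu> * t) * (2 * R * t powr (- (1/4)))"
      using R mu 0 by (intro mult_right_mono) auto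
    finally show ?case by (simp add: mult_ac)
  next
    case (Suc n)
    then show ?case
      using step[of "2 * R / 2 ^ n" t] R by (simp add: mult_ac)
  qed
  note bound = this[OF t]
  have "(\<lambda>n. (2 * R * exp (\<mu> * t) * t powr (- (1/4))) * (1 / 2) ^ n) \<longlonglongrightarrow> (2 * R * exp (\<mu> * t) * t powr (- (1/4))) * 0"
    by (intro tendsto_intros LIMSEQ_power_zero) simp
  then have "(\<lambda>n. 2 * R / 2 ^ n * exp (\<mu> * t) * t powr (- (1/4))) \<longlonglongrightarrow> 0"
    by (simp add: power_divide mult_ac)
  then have "norm (u t - u' t) \<le> 0"
    using bound by (intro tendsto_lowerbound) auto
  then show ?thesis by simp
qed

end

section \<open>Square integrable functions depending on time\<close>

text \<open>
  Choosing representatives separately for every \<open>t\<close> says nothing about joint measurability.  Approximate \<open>u t\<close>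
  within \<open>(1/2) ^ n\<close> by the first suitable member of a dense sequence.  The approximations take countably many
  values, hence are jointly measurable, and for fixed \<open>t\<close> they converge almost everywhere because the
  squared distances are summable.
\<close>

lemma measurable_representative:
  fixes u :: "real \<Rightarrow> 'b::euclidean_space L2"
  assumes u [measurable]: "u \<in> borel_measurable borel"
  shows "\<exists>G. (\<lambda>(t, x). G t x) \<in> borel_measurable (borel \<Otimes>\<^sub>M borel) \<and>
     (\<forall>t. AE x in lborel. G t x = rep_L2 (u t) x)"
proof -
  obtain D :: "'b L2 set" where D: "countable D" "closure D = UNIV"
    using L2_countable_dense by blast
  then have "D \<noteq> {}" by auto
  then obtain d :: "nat \<Rightarrow> 'b L2" where d: "range d = D"
    using D(1) by (metis range_from_nat_into)
  have near: "\<exists>i. dist (u t) (d i) < e" if "0 < e" for t e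
  proof -
    have "u t \<in> closure D" using D(2) by simp
    then show ?thesis
      using that d unfolding closure_approachable by (metis dist_commute rangeE)
  qed
  \<comment> \<open>The least index, not an arbitrary one: the choice has to be measurable in \<open>t\<close>.\<close>
  define i where "i n t = (LEAST i. dist (u t) (d i) < (1/2) ^ n)" for n :: nat and t
  have i: "dist (u t) (d (i n t)) < (1/2) ^ n" for n t
    unfolding i_def using near[of "(1/2) ^ n" t] by (rule LeastI_ex) simp
  have [measurable]: "i n \<in> borel \<rightarrow>\<^sub>M count_space UNIV" for n
    unfolding i_def[abs_def] by measurable
  define g where "g n t x = rep_L2 (d (i n t)) x" for n t x
  have [measurable]: "rep_L2 v \<in> borel_measurable borel" for v :: "'b L2"
    using square_integrableD[OF square_integrable_rep_L2[of v]] by simp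
  have g_meas [measurable]: "(\<lambda>p. g n (fst p) (snd p)) \<in> borel_measurable (borel \<Otimes>\<^sub>M borel)" for n
    unfolding g_def
    by (rule measurable_compose_countable[where g = "\<lambda>p. i n (fst p)" and f = "\<lambda>j p. rep_L2 (d j) (snd p)"]) measurable
  define G where "G t x = lim (\<lambda>n. g n t x)" for t x
  have "(\<lambda>(t, x). G t x) \<in> borel_measurable (borel \<Otimes>\<^sub>M borel)"
    unfolding G_def case_prod_unfold by (rule borel_measurable_lim_metric) measurable
  moreover have "AE x in lborel. G t x = rep_L2 (u t) x" for t
  proof -
    have sq: "square_integrable (\<lambda>x. g n t x - rep_L2 (u t) x)" for n
      unfolding g_def by (intro square_integrable_diff) auto
    have "(\<integral>\<^sup>+x. ennreal ((norm (g n t x - rep_L2 (u t) x))\<^sup>2) \<partial>lborel) \<le> ennreal ((1/2) ^ n)" for n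
    proof -
      have "(\<integral>\<^sup>+x. ennreal ((norm (g n t x - rep_L2 (u t) x))\<^sup>2) \<partial>lborel)
          = ennreal (LINT x|lborel. (norm (g n t x - rep_L2 (u t) x))\<^sup>2)"
        by (rule nn_integral_eq_integral) (use sq[of n] in \<open>auto simp: square_integrable_def\<close>)
      also have "(LINT x|lborel. (norm (g n t x - rep_L2 (u t) x))\<^sup>2) = (dist (d (i n t)) (u t))\<^sup>2"
        using norm_abs_L2[OF sq[of n]] abs_L2_diff[of "rep_L2 (d (i n t))" "rep_L2 (u t)"]
        by (simp add: g_def dist_norm)
      also have "\<dots> \<le> ((1/2) ^ n)\<^sup>2"
        using i[of t n] by (intro power_mono) (auto simp: dist_commute)
      also have "\<dots> \<le> (1/2) ^ n"
        by (simp add: power2_eq_square mult_left_le power_le_one)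
      finally show ?thesis by (simp add: ennreal_leI)
    qed
    then have "(\<Sum>n. \<integral>\<^sup>+x. ennreal ((norm (g n t x - rep_L2 (u t) x))\<^sup>2) \<partial>lborel) \<le> (\<Sum>n. ennreal ((1/2) ^ n))"
      by (intro suminf_le) auto
    also have "\<dots> = ennreal (\<Sum>n. (1/2) ^ n)"
      by (intro suminf_ennreal2 summable_geometric) auto
    also have "\<dots> < \<infinity>" by simp
    finally have "(\<integral>\<^sup>+x. (\<Sum>n. ennreal ((norm (g n t x - rep_L2 (u t) x))\<^sup>2)) \<partial>lborel) < \<infinity>"
      by (subst nn_integral_suminf) (auto simp: g_def)
    then have "AE x in lborel. (\<Sum>n. ennreal ((norm (g n t x - rep_L2 (u t) x))\<^sup>2)) \<noteq> \<infinity>"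
      by (intro nn_integral_PInf_AE) (auto simp: g_def)
    then show ?thesis
    proof eventually_elim
      case (elim x)
      then have "summable (\<lambda>n. (norm (g n t x - rep_L2 (u t) x))\<^sup>2)"
        by (intro summable_suminf_not_top) auto
      then have "(\<lambda>n. (norm (g n t x - rep_L2 (u t) x))\<^sup>2) \<longlonglongrightarrow> 0"
        by (rule summable_LIMSEQ_zero)
      then have "(\<lambda>n. sqrt ((norm (g n t x - rep_L2 (u t) x))\<^sup>2)) \<longlonglongrightarrow> sqrt 0"
        by (rule tendsto_real_sqrt)
      then have "(\<lambda>n. norm (g n t x - rep_L2 (u t) x)) \<longlonglongrightarrow> 0"
        by simp
      then have "(\<lambda>n. g n t x) \<longlonglongrightarrow> rep_L2 (u t) x"
        by (rule LIM_zero_cancel[OF tendsto_norm_zero_cancel])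
      then show ?case by (simp add: G_def limI)
    qed
  qed
  ultimately show ?thesis by blast
qed

text \<open>
  In a second countable space every open set is a countable union of balls.
\<close>

lemma borel_measurable_from_dist:
  fixes f :: "'a \<Rightarrow> 'b::{metric_space, second_countable_topology}"
  assumes "\<And>d. (\<lambda>x. dist (f x) d) \<in> borel_measurable M"
  shows "f \<in> borel_measurable M"
proof (rule borel_measurableI)
  fix S :: "'b set" assume S: "open S"
  define \<F> where "\<F> = {ball d e | d e. ball d e \<subseteq> S}"
  obtain \<F>' where \<F>': "\<F>' \<subseteq> \<F>" "countable \<F>'" "\<Union>\<F>' = \<Union>\<F>"
    by (rule Lindelof[of \<F>]) (auto simp: \<F>_def)
  have "\<Union>\<F> = S"
    using S by (auto simp: \<F>_def open_contains_ball) (metis centre_in_ball)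
  with \<F>'(3) have "S = \<Union>\<F>'" by simp
  then have "f -` S \<inter> space M = (\<Union>b\<in>\<F>'. f -` b \<inter> space M)"
    by auto
  also have "\<dots> \<in> sets M"
  proof (rule sets.countable_UN''[OF \<F>'(2)])
    fix b assume "b \<in> \<F>'"
    then obtain d e where b: "b = ball d e"
      using \<F>'(1) by (auto simp: \<F>_def)
    have "f -` b \<inter> space M = {x \<in> space M. dist (f x) d < e}"
      by (auto simp: b dist_commute)
    then show "f -` b \<inter> space M \<in> sets M"
      using assms[of d] by simp
  qed
  finally show "f -` S \<inter> space M \<in> sets M" .
qed

text \<open>
  The distance to a fixed class is an integral over \<open>x\<close>, thus measurable in \<open>t\<close> by Fubini.
\<close>

lemma measurable_abs_L2:
  fixes H :: "real \<Rightarrow> plane \<Rightarrow> 'b::euclidean_space"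
  assumes H [measurable]: "(\<lambda>(t, x). H t x) \<in> borel_measurable (borel \<Otimes>\<^sub>M borel)"
    and sq: "\<And>t. square_integrable (H t)"
  shows "(\<lambda>t. abs_L2 (H t)) \<in> borel_measurable borel"
proof (rule borel_measurable_from_dist)
  fix d :: "'b L2"
  have [measurable]: "rep_L2 d \<in> borel_measurable borel"
    using square_integrableD[OF square_integrable_rep_L2[of d]] by simp
  have "dist (abs_L2 (H t)) d = sqrt (LINT x|lborel. (norm (H t x - rep_L2 d x))\<^sup>2)" for t
    using abs_L2_diff[OF sq[of t] square_integrable_rep_L2[of d]]
      norm_abs_L2[OF square_integrable_diff[OF sq[of t] square_integrable_rep_L2[of d]]]
    by (simp add: dist_norm)
  moreover have "(\<lambda>t. LINT x|lborel. (norm (H t x - rep_L2 d x))\<^sup>2) \<in> borel_measurable borel"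
    by (rule lborel.borel_measurable_lebesgue_integral) measurable
  ultimately show "(\<lambda>t. dist (abs_L2 (H t)) d) \<in> borel_measurable borel"
    by simp
qed

context torus
begin

lemma set_integrable_representative:
  fixes u :: "real \<Rightarrow> 'b::euclidean_space L2"
  assumes G [measurable]: "(\<lambda>(t, x). G t x) \<in> borel_measurable (borel \<Otimes>\<^sub>M borel)"
    and G_eq: "\<And>t. AE x in lborel. G t x = rep_L2 (u t) x"
    and bound: "\<And>t. t \<in> {a..b} \<Longrightarrow> norm (u t) \<le> M"
  shows "set_integrable lborel ({a..b} \<times> Q) (\<lambda>(t, x). G t x)"
  unfolding set_integrable_def
proof (rule integrableI_bounded)
  have [measurable]: "rep_L2 w \<in> borel_measurable borel" for w :: "'b L2"
    using square_integrableD[OF square_integrable_rep_L2[of w]] by simp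
  have "(\<lambda>z. indicator ({a..b} \<times> Q) z *\<^sub>R (case z of (t, x) \<Rightarrow> G t x)) \<in> borel_measurable (borel \<Otimes>\<^sub>M borel)"
    by measurable
  then show meas: "(\<lambda>z. indicator ({a..b} \<times> Q) z *\<^sub>R (case z of (t, x) \<Rightarrow> G t x)) \<in> borel_measurable lborel"
    by (simp add: borel_prod)
  \<comment> \<open>Bounds \<open>\<integral> norm (G t x) dx\<close> over the cell, by \<open>r \<le> 1 + r\<^sup>2\<close>.\<close>
  define c where "c = area + M\<^sup>2"
  have slice: "(\<integral>\<^sup>+x. ennreal (norm (indicator ({a..b} \<times> Q) (t, x) *\<^sub>R G t x)) \<partial>lborel) \<le> ennreal c * indicator {a..b} t" for t
  proof (cases "t \<in> {a..b}")
    case True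
    have "(\<integral>\<^sup>+x. ennreal (norm (indicator ({a..b} \<times> Q) (t, x) *\<^sub>R G t x)) \<partial>lborel)
        \<le> (\<integral>\<^sup>+x. indicator Q x + ennreal ((norm (rep_L2 (u t) x))\<^sup>2) \<partial>lborel)"
    proof (rule nn_integral_mono_AE)
      have le: "r \<le> 1 + r\<^sup>2" for r :: real
        using zero_le_power2[of "r - 1"] zero_le_power2[of r] unfolding power2_diff one_power2 by linarith
      show "AE x in lborel. ennreal (norm (indicator ({a..b} \<times> Q) (t, x) *\<^sub>R G t x))
          \<le> indicator Q x + ennreal ((norm (rep_L2 (u t) x))\<^sup>2)"
        using G_eq[of t]
      proof eventually_elim
        case (elim x)
        have "ennreal (norm (rep_L2 (u t) x)) \<le> ennreal (1 + (norm (rep_L2 (u t) x))\<^sup>2)"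
          by (rule ennreal_leI) (rule le)
        then show ?case
          using True by (auto simp: elim indicator_def ennreal_plus simp flip: ennreal_1)
      qed
    qed
    also have "\<dots> = ennreal area + ennreal ((norm (u t))\<^sup>2)"
    proof -
      have "emeasure lborel Q = ennreal area"
        using emeasure_eq_ennreal_measure[of lborel Q] emeasure_Q_finite by (simp add: measure_Q)
      moreover have "(\<integral>\<^sup>+x. ennreal ((norm (rep_L2 (u t) x))\<^sup>2) \<partial>lborel) = ennreal ((norm (u t))\<^sup>2)"
        using norm_abs_L2[OF square_integrable_rep_L2[of "u t"]] square_integrable_rep_L2[of "u t"]
        by (subst nn_integral_eq_integral) (auto simp: square_integrable_def)
      ultimately show ?thesis
        by (subst nn_integral_add) auto
    qed
    also have "\<dots> = ennreal (area + (norm (u t))\<^sup>2)"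
      using area_pos by (simp add: ennreal_plus)
    also have "\<dots> \<le> ennreal c"
      unfolding c_def using bound[OF True] by (intro ennreal_leI add_left_mono power_mono) auto
    finally show ?thesis using True by simp
  next
    case False
    then have "indicator ({a..b} \<times> Q) (t, x) = (0 :: real)" for x
      by (auto simp: indicator_def)
    then show ?thesis by simp
  qed
  have "(\<integral>\<^sup>+z. ennreal (norm (indicator ({a..b} \<times> Q) z *\<^sub>R (case z of (t, x) \<Rightarrow> G t x))) \<partial>lborel)
      = (\<integral>\<^sup>+t. \<integral>\<^sup>+x. ennreal (norm (indicator ({a..b} \<times> Q) (t, x) *\<^sub>R G t x)) \<partial>lborel \<partial>lborel)"
  proof -
    have "(\<lambda>z. ennreal (norm (indicator ({a..b} \<times> Q) z *\<^sub>R (case z of (t, x) \<Rightarrow> G t x)))) \<in> borel_measurable (lborel \<Otimes>\<^sub>M lborel)"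
      unfolding lborel_prod by (rule measurable_compose[OF meas]) measurable
    from lborel.nn_integral_fst[OF this] show ?thesis
      by (simp add: lborel_prod)
  qed
  also have "\<dots> \<le> (\<integral>\<^sup>+t. ennreal c * indicator {a..b} t \<partial>lborel)"
    by (intro nn_integral_mono slice)
  also have "\<dots> < \<infinity>"
    using emeasure_bounded_finite[of "{a..b}"] by (simp add: nn_integral_cmult_indicator ennreal_mult_less_top)
  finally show "(\<integral>\<^sup>+z. ennreal (norm (indicator ({a..b} \<times> Q) z *\<^sub>R (case z of (t, x) \<Rightarrow> G t x))) \<partial>lborel) < \<infinity>" .
qed

text \<open>
  Exhaust the open interval by the compact intervals on which integrability is assumed.
\<close>

lemma measurable_of_locally_integrable:
  fixes G :: "real \<Rightarrow> plane \<Rightarrow> 'b::euclidean_space"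
  assumes T: "0 < T"
    and loc: "\<And>a b. 0 < a \<Longrightarrow> a \<le> b \<Longrightarrow> b < T \<Longrightarrow> set_integrable lborel ({a..b} \<times> Q) (\<lambda>(t, x). G t x)"
  shows "(\<lambda>(t, x). indicator ({0<..<T} \<times> Q) (t, x) *\<^sub>R G t x) \<in> borel_measurable (borel \<Otimes>\<^sub>M borel)"
proof (rule borel_measurable_LIMSEQ_metric)
  define H where "H t x = indicator ({0<..<T} \<times> Q) (t, x) *\<^sub>R G t x" for t x
  \<comment> \<open>The offset \<open>3\<close> ensures \<open>a n \<le> T - a n\<close> for every \<open>n\<close>.\<close>
  define a where "a n = T / real (n + 3)" for n
  have a: "0 < a n" "a n \<le> T - a n" "T - a n < T" for n
    using T by (auto simp: a_def field_simps)
  show "(\<lambda>z. indicator ({a n..T - a n} \<times> Q) z *\<^sub>R (case z of (t, x) \<Rightarrow> G t x)) \<in> borel_measurable (borel \<Otimes>\<^sub>M borel)" for n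
    using borel_measurable_integrable[OF loc[OF a, unfolded set_integrable_def], of n] by (simp add: borel_prod)
  fix z :: "real \<times> plane"
  obtain t x where z: "z = (t, x)" by (cases z) auto
  show "(\<lambda>n. indicator ({a n..T - a n} \<times> Q) z *\<^sub>R (case z of (t, x) \<Rightarrow> G t x)) \<longlonglongrightarrow> (case z of (t, x) \<Rightarrow> indicator ({0<..<T} \<times> Q) (t, x) *\<^sub>R G t x)"
  proof (cases "t \<in> {0<..<T}")
    case True
    have "(\<lambda>n. T * inverse (real (Suc n))) \<longlonglongrightarrow> T * 0"
      by (intro tendsto_intros LIMSEQ_inverse_real_of_nat)
    then have "(\<lambda>n. T / real (Suc n)) \<longlonglongrightarrow> 0"
      by (simp add: divide_inverse)
    from LIMSEQ_ignore_initial_segment[OF this, of 2] have "a \<longlonglongrightarrow> 0"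
      by (simp add: a_def[abs_def] numeral_3_eq_3 numeral_2_eq_2)
    then have "\<forall>\<^sub>F n in sequentially. a n < min t (T - t)"
      by (rule order_tendstoD(2)) (use True in auto)
    then have "\<forall>\<^sub>F n in sequentially. indicator ({a n..T - a n} \<times> Q) z *\<^sub>R (case z of (t, x) \<Rightarrow> G t x) = (case z of (t, x) \<Rightarrow> H t x)"
      by eventually_elim (use True in \<open>auto simp: z H_def indicator_def\<close>)
    then show ?thesis unfolding H_def by (rule tendsto_eventually)
  next
    case False
    have "indicator ({a n..T - a n} \<times> Q) z *\<^sub>R (case z of (t, x) \<Rightarrow> G t x) = (case z of (t, x) \<Rightarrow> H t x)" for n
      using False a[of n] by (auto simp: z H_def indicator_def)
    then show ?thesis unfolding H_def by simp
  qed
qed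

lemma square_integrable_restrict:
  fixes f :: "plane \<Rightarrow> 'b::euclidean_space"
  assumes f: "square_integrable f"
  shows "square_integrable (\<lambda>x. indicator Q x *\<^sub>R f x)"
proof (rule square_integrable_bound[OF f])
  have "f \<in> borel_measurable borel" using f by (simp add: square_integrable_def)
  then show "(\<lambda>x. indicator Q x *\<^sub>R f x) \<in> borel_measurable lborel" by measurable
qed (auto simp: indicator_def)

definition restrict_cell :: "'b::euclidean_space L2 \<Rightarrow> 'b L2" where
  "restrict_cell u = to_L2_torus L1 L2 (rep_L2 u)"

lemma bounded_linear_restrict_cell: "bounded_linear (restrict_cell :: 'b::euclidean_space L2 \<Rightarrow> 'b L2)"
proof (rule bounded_linear_intro[where K = 1])
  note sq = square_integrable_restrict[OF square_integrable_rep_L2]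
  fix u v :: "'b L2" and r :: real
  show "restrict_cell (u + v) = restrict_cell u + restrict_cell v"
    unfolding restrict_cell_def to_L2_torus_def abs_L2_add[OF sq sq]
    by (subst abs_L2_eq_iff[OF sq square_integrable_add[OF sq sq]])
      (use rep_L2_add[of u v] in \<open>eventually_elim, simp add: scaleR_add_right\<close>)
  show "restrict_cell (r *\<^sub>R u) = r *\<^sub>R restrict_cell u"
    unfolding restrict_cell_def to_L2_torus_def abs_L2_scaleR[OF sq]
    by (subst abs_L2_eq_iff[OF sq square_integrable_scaleR[OF sq]])
      (use rep_L2_scaleR[of r u] in \<open>eventually_elim, simp add: scaleR_left_commute\<close>)
  have "(LINT x|lborel. (norm (indicator Q x *\<^sub>R rep_L2 u x))\<^sup>2) \<le> (LINT x|lborel. (norm (rep_L2 u x))\<^sup>2)"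
    using sq[of u] square_integrable_rep_L2[of u] unfolding square_integrable_def
    by (intro integral_mono) (auto simp: indicator_def)
  then show "norm (restrict_cell u) \<le> norm u * 1"
    using norm_abs_L2[OF sq[of u]] norm_abs_L2[OF square_integrable_rep_L2[of u]]
    by (simp add: restrict_cell_def to_L2_torus_def)
qed

text \<open>
  \<open>L2_torus\<close> is the set of fixed points of a bounded linear projection; it is therefore stable under infinite
  sums and Bochner integrals.
\<close>

lemma L2_torus_iff: "u \<in> L2_torus L1 L2 \<longleftrightarrow> restrict_cell u = u"
proof -
  have "restrict_cell u = u \<longleftrightarrow> (AE x in lborel. indicator Q x *\<^sub>R rep_L2 u x = rep_L2 u x)"
    using abs_L2_eq_iff[OF square_integrable_restrict[OF square_integrable_rep_L2] square_integrable_rep_L2, of u u]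
    by (simp add: restrict_cell_def to_L2_torus_def)
  also have "\<dots> \<longleftrightarrow> u \<in> L2_torus L1 L2"
    unfolding L2_torus_def mem_Collect_eq by (intro AE_cong) (auto simp: indicator_def)
  finally show ?thesis by simp
qed

lemma L2_torus_eqI:
  assumes "u \<in> L2_torus L1 L2" "w \<in> L2_torus L1 L2"
    and "AE x in lborel. x \<in> Q \<longrightarrow> rep_L2 u x = rep_L2 w x"
  shows "u = w"
proof -
  have "AE x in lborel. rep_L2 u x = rep_L2 w x"
    using assms(1,2)[unfolded L2_torus_def mem_Collect_eq] assms(3) by eventually_elim auto
  then show ?thesis
    using abs_L2_eq_iff[OF square_integrable_rep_L2 square_integrable_rep_L2, of u w] by simp
qed

lemma to_L2_torus_in_L2_torus:
  assumes "square_integrable (\<lambda>x. indicator Q x *\<^sub>R f x)"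
  shows "to_L2_torus L1 L2 f \<in> L2_torus L1 L2"
  using rep_L2_abs_L2[OF assms] unfolding L2_torus_def mem_Collect_eq to_L2_torus_def
  by eventually_elim (simp add: indicator_def)

lemma L2_torus_mode: "mode k c y \<in> L2_torus L1 L2"
  unfolding mode_def by (intro to_L2_torus_in_L2_torus square_integrable_mode)

lemma L2_torus_diff: "u \<in> L2_torus L1 L2 \<Longrightarrow> v \<in> L2_torus L1 L2 \<Longrightarrow> u - v \<in> L2_torus L1 L2"
  using linear_diff[OF bounded_linear.linear[OF bounded_linear_restrict_cell], of u v] by (simp add: L2_torus_iff)

lemma L2_torus_scaleR: "u \<in> L2_torus L1 L2 \<Longrightarrow> r *\<^sub>R u \<in> L2_torus L1 L2"
  using linear_scale[OF bounded_linear.linear[OF bounded_linear_restrict_cell], of r u] by (simp add: L2_torus_iff)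

lemma L2_torus_zero: "0 \<in> L2_torus L1 L2"
  using linear_0[OF bounded_linear.linear[OF bounded_linear_restrict_cell]] by (simp add: L2_torus_iff)

lemma L2_torus_infsum:
  assumes "\<And>k. x k \<in> L2_torus L1 L2"
  shows "(\<Sum>\<^sub>\<infinity>k. x k) \<in> L2_torus L1 L2"
proof (cases "x summable_on UNIV")
  case True
  have "((\<lambda>k. restrict_cell (x k)) has_sum restrict_cell (\<Sum>\<^sub>\<infinity>k. x k)) UNIV"
    by (rule has_sum_bounded_linear[OF bounded_linear_restrict_cell has_sum_infsum[OF True]])
  moreover have "restrict_cell (x k) = x k" for k
    using assms[of k] by (simp only: L2_torus_iff)
  ultimately have "(x has_sum restrict_cell (\<Sum>\<^sub>\<infinity>k. x k)) UNIV"
    by (simp only:)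
  from infsumI[OF this] show ?thesis
    unfolding L2_torus_iff by (rule sym)
qed (simp add: infsum_not_exists L2_torus_zero)

lemma L2_torus_propagate: "propagate s c y \<in> L2_torus L1 L2"
  unfolding propagate_def by (intro L2_torus_infsum L2_torus_scaleR L2_torus_mode)

lemma L2_torus_kernel: "kernel d y s g h \<in> L2_torus L1 L2"
  by (simp add: kernel_def L2_torus_propagate L2_torus_zero)

lemma L2_torus_integral:
  assumes "\<And>t. F t \<in> L2_torus L1 L2" "integrable M F"
  shows "integral\<^sup>L M F \<in> L2_torus L1 L2"
proof -
  have fixed: "(\<lambda>t. restrict_cell (F t)) = F"
    by (rule ext) (use assms(1) in \<open>simp only: L2_torus_iff\<close>)
  from integral_bounded_linear[OF bounded_linear_restrict_cell assms(2)] show ?thesis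
    unfolding fixed L2_torus_iff by (rule sym)
qed

section \<open>Weak gradients\<close>

definition is_gradient :: "real L2 \<Rightarrow> plane L2 \<Rightarrow> bool" where
  "is_gradient \<phi> u \<longleftrightarrow> weak_gradient L1 L2 (rep_L2 \<phi>) (rep_L2 u)"

lemma test_functionE:
  assumes "test_function L1 L2 \<psi>"
  obtains D1 D2 where "\<And>x. (\<psi> has_derivative (\<lambda>h. fst h * D1 x + snd h * D2 x)) (at x)"
    "continuous_on UNIV D1" "continuous_on UNIV D2" "continuous_on UNIV \<psi>"
    "\<And>x h. frechet_derivative \<psi> (at x) h = fst h * D1 x + snd h * D2 x"
    "\<And>x. \<psi> (x + (L1, 0)) = \<psi> x" "\<And>x. \<psi> (x + (0, L2)) = \<psi> x"
proof -
  obtain D :: "nat \<Rightarrow> nat \<Rightarrow> plane \<Rightarrow> real" where D0: "D 0 0 = \<psi>"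
    and D': "\<forall>i j x. (D i j has_derivative (\<lambda>h. fst h * D (Suc i) j x + snd h * D i (Suc j) x)) (at x)"
    using assms unfolding test_function_def by (elim conjE exE) (rule that)
  have "\<forall>x. \<psi> (x + (L1, 0)) = \<psi> x \<and> \<psi> (x + (0, L2)) = \<psi> x"
    using assms unfolding test_function_def by (rule conjunct1)
  then have per: "\<psi> (x + (L1, 0)) = \<psi> x" "\<psi> (x + (0, L2)) = \<psi> x" for x
    by (simp_all only:)
  note D = D0 D'[rule_format]
  have cont: "continuous_on UNIV (D i j)" for i j
    using D(2) by (intro has_derivative_continuous_on) (auto intro: has_derivative_at_withinI)
  have der: "(\<psi> has_derivative (\<lambda>h. fst h * D 1 0 x + snd h * D 0 1 x)) (at x)" for x
    using D(2)[of 0 0 x] by (simp add: D(1))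
  have fr: "frechet_derivative \<psi> (at x) h = fst h * D 1 0 x + snd h * D 0 1 x" for x h
    by (rule fun_cong[OF frechet_derivative_at[OF der], symmetric])
  show ?thesis
    by (rule that[OF der cont cont cont[of 0 0, unfolded D(1)] fr per])
qed

lemma weak_gradient_cong:
  assumes "weak_gradient L1 L2 f (rep_L2 g)" and eq: "AE x in lborel. G x = rep_L2 g x"
    and [measurable]: "G \<in> borel_measurable borel"
  shows "weak_gradient L1 L2 f G"
  unfolding weak_gradient_def
proof (intro conjI allI impI ballI)
  have [measurable]: "rep_L2 g \<in> borel_measurable borel"
    using square_integrableD[OF square_integrable_rep_L2[of g]] by simp
  have "set_integrable lborel Q (rep_L2 g)"
    by (intro set_integrable_square_integrable) simp
  then show "set_integrable lborel Q G"
    unfolding set_integrable_def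
    by (subst integrable_cong_AE[where g = "\<lambda>x. indicator Q x *\<^sub>R rep_L2 g x"]) (use eq in \<open>auto elim: eventually_mono\<close>)
  fix \<psi> and h :: plane assume \<psi>: "test_function L1 L2 \<psi>" and h: "h \<in> Basis"
  obtain D1 D2 where D: "\<And>x. (\<psi> has_derivative (\<lambda>h. fst h * D1 x + snd h * D2 x)) (at x)"
    "continuous_on UNIV D1" "continuous_on UNIV D2" "continuous_on UNIV \<psi>"
    "\<And>x h. frechet_derivative \<psi> (at x) h = fst h * D1 x + snd h * D2 x"
    "\<And>x. \<psi> (x + (L1, 0)) = \<psi> x" "\<And>x. \<psi> (x + (0, L2)) = \<psi> x"
    by (rule test_functionE[OF \<psi>]) (rule that)
  have [measurable]: "\<psi> \<in> borel_measurable borel"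
    by (rule borel_measurable_continuous_onI[OF D(4)])
  have "(LINT x:Q|lborel. (G x \<bullet> h) * \<psi> x) = (LINT x:Q|lborel. (rep_L2 g x \<bullet> h) * \<psi> x)"
    unfolding set_lebesgue_integral_def
    by (rule integral_cong_AE) (use eq in \<open>auto elim: eventually_mono\<close>)
  then show "(LINT x:Q|lborel. f x * frechet_derivative \<psi> (at x) h) = - (LINT x:Q|lborel. (G x \<bullet> h) * \<psi> x)"
    using assms(1) \<psi> h by (simp add: weak_gradient_def)
qed

text \<open>
  For each test function the defining identity is the vanishing of a continuous linear functional of the pair,
  so \<open>is_gradient\<close> is a closed linear relation.
\<close>

lemma is_gradient_iff:
  "is_gradient \<phi> u \<longleftrightarrow> (\<forall>\<psi>. test_function L1 L2 \<psi> \<longrightarrow> (\<forall>h\<in>Basis.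
     \<phi> \<bullet> to_L2_torus L1 L2 (\<lambda>x. frechet_derivative \<psi> (at x) h) + u \<bullet> to_L2_torus L1 L2 (\<lambda>x. \<psi> x *\<^sub>R h) = 0))"
proof -
  have 1: "\<phi> \<bullet> to_L2_torus L1 L2 (\<lambda>x. frechet_derivative \<psi> (at x) h) =
      (LINT x:Q|lborel. rep_L2 \<phi> x * frechet_derivative \<psi> (at x) h)"
    and 2: "u \<bullet> to_L2_torus L1 L2 (\<lambda>x. \<psi> x *\<^sub>R h) = (LINT x:Q|lborel. (rep_L2 u x \<bullet> h) * \<psi> x)"
    if \<psi>: "test_function L1 L2 \<psi>" for \<psi> h
  proof -
    obtain D1 D2 where D: "\<And>x. (\<psi> has_derivative (\<lambda>h. fst h * D1 x + snd h * D2 x)) (at x)"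
      "continuous_on UNIV D1" "continuous_on UNIV D2" "continuous_on UNIV \<psi>"
      "\<And>x h. frechet_derivative \<psi> (at x) h = fst h * D1 x + snd h * D2 x"
        "\<And>x. \<psi> (x + (L1, 0)) = \<psi> x" "\<And>x. \<psi> (x + (0, L2)) = \<psi> x"
      by (rule test_functionE[OF \<psi>]) (rule that)
    have "square_integrable (\<lambda>x. indicator Q x *\<^sub>R frechet_derivative \<psi> (at x) h)"
      unfolding D(5) by (intro square_integrable_cell continuous_intros D)
    then show "\<phi> \<bullet> to_L2_torus L1 L2 (\<lambda>x. frechet_derivative \<psi> (at x) h) =
      (LINT x:Q|lborel. rep_L2 \<phi> x * frechet_derivative \<psi> (at x) h)"
      by (subst inner_to_L2_torus) simp_all
    have "square_integrable (\<lambda>x. indicator Q x *\<^sub>R (\<psi> x *\<^sub>R h))"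
      by (intro square_integrable_cell continuous_intros D)
    then show "u \<bullet> to_L2_torus L1 L2 (\<lambda>x. \<psi> x *\<^sub>R h) = (LINT x:Q|lborel. (rep_L2 u x \<bullet> h) * \<psi> x)"
      by (subst inner_to_L2_torus) (simp_all add: mult.commute)
  qed
  show ?thesis
    unfolding is_gradient_def weak_gradient_def
    using set_integrable_square_integrable[OF square_integrable_rep_L2[of u]]
    by (auto simp: 1 2 add_eq_0_iff2)
qed

lemma is_gradient_diff:
  assumes "is_gradient \<phi> u" "is_gradient \<phi>' u'"
  shows "is_gradient (\<phi> - \<phi>') (u - u')"
proof -
  have "(\<phi> - \<phi>') \<bullet> a + (u - u') \<bullet> b = (\<phi> \<bullet> a + u \<bullet> b) - (\<phi>' \<bullet> a + u' \<bullet> b)" for a b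
    by (simp add: inner_diff_left)
  note split = this
  show ?thesis
    unfolding is_gradient_iff split
    by (intro allI impI ballI) (simp only: assms[unfolded is_gradient_iff, rule_format] diff_self)
qed

lemma is_gradient_scaleR:
  assumes "is_gradient \<phi> u"
  shows "is_gradient (r *\<^sub>R \<phi>) (r *\<^sub>R u)"
proof -
  have "(r *\<^sub>R \<phi>) \<bullet> a + (r *\<^sub>R u) \<bullet> b = r * (\<phi> \<bullet> a + u \<bullet> b)" for a b
    by (simp add: distrib_left)
  note split = this
  show ?thesis
    unfolding is_gradient_iff split
    by (intro allI impI ballI) (simp only: assms[unfolded is_gradient_iff, rule_format] mult_zero_right)
qed

lemma is_gradient_infsum:
  assumes "\<And>k. is_gradient (x k) (y k)" "x summable_on UNIV" "y summable_on UNIV"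
  shows "is_gradient (\<Sum>\<^sub>\<infinity>k. x k) (\<Sum>\<^sub>\<infinity>k. y k)"
  unfolding is_gradient_iff
proof (intro allI impI ballI)
  fix \<psi> and h :: plane assume \<psi>: "test_function L1 L2 \<psi>" and h: "h \<in> Basis"
  let ?a = "to_L2_torus L1 L2 (\<lambda>x. frechet_derivative \<psi> (at x) h)" and ?b = "to_L2_torus L1 L2 (\<lambda>x. \<psi> x *\<^sub>R h)"
  have sums: "((\<lambda>k. x k \<bullet> ?a + y k \<bullet> ?b) has_sum (\<Sum>\<^sub>\<infinity>k. x k) \<bullet> ?a + (\<Sum>\<^sub>\<infinity>k. y k) \<bullet> ?b) UNIV"
    using assms by (intro has_sum_add has_sum_bounded_linear[OF bounded_linear_inner_left] has_sum_infsum)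
  have zero: "(\<lambda>k. x k \<bullet> ?a + y k \<bullet> ?b) = (\<lambda>k. 0)"
    using assms(1) \<psi> h unfolding is_gradient_iff by blast
  from infsumI[OF sums] show "(\<Sum>\<^sub>\<infinity>k. x k) \<bullet> ?a + (\<Sum>\<^sub>\<infinity>k. y k) \<bullet> ?b = 0"
    unfolding zero by simp
qed

lemma is_gradient_integral:
  assumes "\<And>t. is_gradient (F t) (G t)" "integrable M F" "integrable M G"
  shows "is_gradient (integral\<^sup>L M F) (integral\<^sup>L M G)"
  unfolding is_gradient_iff
proof (intro allI impI ballI)
  fix \<psi> and h :: plane assume \<psi>: "test_function L1 L2 \<psi>" and h: "h \<in> Basis"
  let ?a = "to_L2_torus L1 L2 (\<lambda>x. frechet_derivative \<psi> (at x) h)" and ?b = "to_L2_torus L1 L2 (\<lambda>x. \<psi> x *\<^sub>R h)"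
  have "integral\<^sup>L M F \<bullet> ?a + integral\<^sup>L M G \<bullet> ?b = (LINT t|M. F t \<bullet> ?a + G t \<bullet> ?b)"
    using assms(2,3) by simp
  also have "(\<lambda>t. F t \<bullet> ?a + G t \<bullet> ?b) = (\<lambda>t. 0)"
    using assms(1) \<psi> h unfolding is_gradient_iff by blast
  finally show "integral\<^sup>L M F \<bullet> ?a + integral\<^sup>L M G \<bullet> ?b = 0" by simp
qed

lemma is_gradient_zero: "is_gradient 0 0"
  by (simp add: is_gradient_iff)

text \<open>
  Integration by parts: the derivatives of the periodic function \<open>f * \<psi>\<close> have integral \<open>0\<close>.
\<close>

lemma is_gradient_mode: "is_gradient (mode k c 1) (mode k (\<i> * c) (wv k))"
  unfolding is_gradient_iff
proof (intro allI impI ballI)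
  fix \<psi> and h :: plane assume \<psi>: "test_function L1 L2 \<psi>" and h: "h \<in> Basis"
  obtain D1 D2 where D: "\<And>x. (\<psi> has_derivative (\<lambda>h. fst h * D1 x + snd h * D2 x)) (at x)"
      "continuous_on UNIV D1" "continuous_on UNIV D2" "continuous_on UNIV \<psi>"
      "\<And>x h. frechet_derivative \<psi> (at x) h = fst h * D1 x + snd h * D2 x"
    and per: "\<And>x. \<psi> (x + (L1, 0)) = \<psi> x" "\<And>x. \<psi> (x + (0, L2)) = \<psi> x"
    by (rule test_functionE[OF \<psi>]) (rule that)
  define f f' where "f x = Re (c * cis (wv k \<bullet> x))" and "f' x = Re (\<i> * c * cis (wv k \<bullet> x))" for x
  have f: "f x = cmod c * cos (wv k \<bullet> x + Arg c)" for x
    unfolding f_def by (rule Re_mult_cis)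
  have f': "f' x = cmod c * cos (wv k \<bullet> x + (Arg c + pi / 2))" for x
  proof -
    have "cis (wv k \<bullet> x + pi / 2) = cis (wv k \<bullet> x) * cis (pi / 2)"
      by (simp only: cis_mult)
    then have "\<i> * c * cis (wv k \<bullet> x) = c * cis (wv k \<bullet> x + pi / 2)"
      by simp
    then show ?thesis
      by (simp only: f'_def Re_mult_cis) (simp only: ac_simps)
  qed
  have cont: "continuous_on UNIV f" "continuous_on UNIV f'"
    unfolding f_def f'_def by (intro continuous_intros)+
  have "((\<lambda>x. f x * \<psi> x) has_derivative
      (\<lambda>h. fst h * (fst (wv k) * f' x * \<psi> x + f x * D1 x) + snd h * (snd (wv k) * f' x * \<psi> x + f x * D2 x))) (at x)" for x
    unfolding f[abs_def] f'[abs_def]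
    by (rule has_derivative_eq_rhs[OF has_derivative_mult[OF has_derivative_mult_right[OF has_derivative_cos_wave] D(1)]])
      (simp add: fun_eq_iff algebra_simps)
  moreover have "f (x + (L1, 0)) * \<psi> (x + (L1, 0)) = f x * \<psi> x" "f (x + (0, L2)) * \<psi> (x + (0, L2)) = f x * \<psi> x" for x
    by (simp_all only: f cos_wave_periodic per)
  moreover have "continuous_on UNIV (\<lambda>x. fst (wv k) * f' x * \<psi> x + f x * D1 x)"
    "continuous_on UNIV (\<lambda>x. snd (wv k) * f' x * \<psi> x + f x * D2 x)"
    by (intro continuous_intros cont D)+
  ultimately have zero: "(LINT x:Q|lborel. fst (wv k) * f' x * \<psi> x + f x * D1 x) = 0"
    "(LINT x:Q|lborel. snd (wv k) * f' x * \<psi> x + f x * D2 x) = 0"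
    by (rule integral_periodic_derivative)+
  have int: "set_integrable lborel Q (\<lambda>x. f x * E x)" "set_integrable lborel Q (\<lambda>x. a * f' x * \<psi> x)"
    if "continuous_on UNIV E" for E and a :: real
    by (intro set_integrable_continuous_Q continuous_intros cont that D)+
  have *: "(LINT x:Q|lborel. f x * E x) + (LINT x:Q|lborel. a * f' x * \<psi> x) = 0"
    if "(LINT x:Q|lborel. a * f' x * \<psi> x + f x * E x) = 0" "continuous_on UNIV E" for E and a :: real
    using that set_integral_add(2)[OF int(2)[OF that(2), of a] int(1)[OF that(2)]] by simp
  have sq: "square_integrable (\<lambda>x. indicator Q x *\<^sub>R frechet_derivative \<psi> (at x) h)"
    "square_integrable (\<lambda>x. indicator Q x *\<^sub>R (\<psi> x *\<^sub>R h))"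
    unfolding D(5) by (intro square_integrable_cell continuous_intros D)+
  have modes: "mode k c (1::real) \<bullet> to_L2_torus L1 L2 (\<lambda>x. frechet_derivative \<psi> (at x) h) =
      (LINT x:Q|lborel. f x * frechet_derivative \<psi> (at x) h)"
    "mode k (\<i> * c) (wv k) \<bullet> to_L2_torus L1 L2 (\<lambda>x. \<psi> x *\<^sub>R h) = (LINT x:Q|lborel. (wv k \<bullet> h) * f' x * \<psi> x)"
  proof -
    have "mode k c (1::real) \<bullet> to_L2_torus L1 L2 (\<lambda>x. frechet_derivative \<psi> (at x) h) =
        (LINT x|lborel. (indicator Q x *\<^sub>R (Re (c * cis (wv k \<bullet> x)) *\<^sub>R 1)) \<bullet> (indicator Q x *\<^sub>R frechet_derivative \<psi> (at x) h))"
      unfolding mode_def to_L2_torus_def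
      by (rule inner_L2.abs_eq) (simp_all only: simp_thms square_integrable_mode eventually_True sq)
    then show "mode k c (1::real) \<bullet> to_L2_torus L1 L2 (\<lambda>x. frechet_derivative \<psi> (at x) h) =
      (LINT x:Q|lborel. f x * frechet_derivative \<psi> (at x) h)"
      unfolding set_lebesgue_integral_def
      by (simp only:) (intro Bochner_Integration.integral_cong, auto simp: indicator_def f_def)
    have "mode k (\<i> * c) (wv k) \<bullet> to_L2_torus L1 L2 (\<lambda>x. \<psi> x *\<^sub>R h) =
        (LINT x|lborel. (indicator Q x *\<^sub>R (Re (\<i> * c * cis (wv k \<bullet> x)) *\<^sub>R wv k)) \<bullet> (indicator Q x *\<^sub>R (\<psi> x *\<^sub>R h)))"
      unfolding mode_def to_L2_torus_def
      by (rule inner_L2.abs_eq) (simp_all only: simp_thms square_integrable_mode eventually_True sq)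
    then show "mode k (\<i> * c) (wv k) \<bullet> to_L2_torus L1 L2 (\<lambda>x. \<psi> x *\<^sub>R h) = (LINT x:Q|lborel. (wv k \<bullet> h) * f' x * \<psi> x)"
      unfolding set_lebesgue_integral_def
      by (simp only:) (intro Bochner_Integration.integral_cong, auto simp: indicator_def f'_def)
  qed
  have "h = (1, 0) \<or> h = (0, 1)"
    using h by (auto simp: Basis_prod_def)
  then show "mode k c 1 \<bullet> to_L2_torus L1 L2 (\<lambda>x. frechet_derivative \<psi> (at x) h) +
      mode k (\<i> * c) (wv k) \<bullet> to_L2_torus L1 L2 (\<lambda>x. \<psi> x *\<^sub>R h) = 0"
    unfolding modes unfolding D(5)
    using *[OF zero(1) D(2)] *[OF zero(2) D(3)] by (auto simp: inner_prod_def)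
qed

lemma is_gradient_propagate:
  assumes "(\<lambda>k. exp (- s * symbol k) *\<^sub>R mode k (c k) (1::real)) summable_on UNIV"
    "(\<lambda>k. exp (- s * symbol k) *\<^sub>R mode k (\<i> * c k) (wv k)) summable_on UNIV"
  shows "is_gradient (propagate s c (\<lambda>_. 1)) (propagate s (\<lambda>k. \<i> * c k) wv)"
  unfolding propagate_def
  by (intro is_gradient_infsum is_gradient_scaleR is_gradient_mode assms)

lemma is_gradient_kernel: "is_gradient (kernel 1 (\<lambda>_. 1) s g h) (kernel \<i> wv s g h)"
proof (cases "0 < s \<and> s \<le> 1")
  case True
  then show ?thesis
    using summable_kernel[OF smoothing_one, of 1 s g h] summable_kernel[OF smoothing_wv, of \<i> s g h]
    by (simp add: kernel_def is_gradient_propagate)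
next
  case False
  then show ?thesis by (auto simp: kernel_def is_gradient_zero)
qed

lemma is_gradient_semigroup:
  assumes "0 < s" "s \<le> 1"
  shows "is_gradient (semigroup_KS L1 L2 s (rep_L2 u)) (grad_semigroup u s)"
  using assms summable_semigroup_KS[of s u] summable_grad_semigroup[of s u]
  by (simp add: semigroup_KS_eq_propagate grad_semigroup_def is_gradient_propagate)

text \<open>
  The waves are test functions, so the components of the difference have vanishing Fourier coefficients.
\<close>

lemma weak_gradient_unique:
  assumes g: "weak_gradient L1 L2 f g" and g': "weak_gradient L1 L2 f g'"
  shows "AE x in lborel. x \<in> Q \<longrightarrow> g x = g' x"
proof -
  have int: "set_integrable lborel Q g" "set_integrable lborel Q g'"
    using g g' by (auto simp: weak_gradient_def)
  have "AE x in lborel. x \<in> Q \<longrightarrow> (g x - g' x) \<bullet> h = 0" if h: "h \<in> Basis" for h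
  proof (rule fourier_complete)
    have inner_int: "set_integrable lborel Q (\<lambda>x. g x \<bullet> h)" if "set_integrable lborel Q g" for g :: "plane \<Rightarrow> plane"
      using integrable_inner_left[of h lborel "\<lambda>x. indicator Q x *\<^sub>R g x"] that by (simp add: set_integrable_def)
    show "set_integrable lborel Q (\<lambda>x. (g x - g' x) \<bullet> h)"
      by (intro inner_int set_integral_diff int)
    fix k \<theta>
    have cos_int: "set_integrable lborel Q (\<lambda>x. (g x \<bullet> h) * cos (wv k \<bullet> x + \<theta>))" if "set_integrable lborel Q g" for g :: "plane \<Rightarrow> plane"
      unfolding set_integrable_def
    proof (rule Bochner_Integration.integrable_bound)
      show i: "integrable lborel (\<lambda>x. indicator Q x *\<^sub>R (g x \<bullet> h))"
        using inner_int[OF that] by (simp add: set_integrable_def)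
      have "(\<lambda>x. (indicator Q x *\<^sub>R (g x \<bullet> h)) * cos (wv k \<bullet> x + \<theta>)) \<in> borel_measurable lborel"
        using borel_measurable_integrable[OF i] by measurable
      then show "(\<lambda>x. indicator Q x *\<^sub>R (g x \<bullet> h * cos (wv k \<bullet> x + \<theta>))) \<in> borel_measurable lborel"
        by (simp add: mult.assoc)
      show "AE x in lborel. norm (indicator Q x *\<^sub>R (g x \<bullet> h * cos (wv k \<bullet> x + \<theta>))) \<le> norm (indicator Q x *\<^sub>R (g x \<bullet> h))"
        by (intro AE_I2) (auto simp: indicator_def abs_mult intro: mult_left_le)
    qed
    have "(LINT x:Q|lborel. (g x - g' x) \<bullet> h * cos (wv k \<bullet> x + \<theta>)) =
        (LINT x:Q|lborel. (g x \<bullet> h) * cos (wv k \<bullet> x + \<theta>)) - (LINT x:Q|lborel. (g' x \<bullet> h) * cos (wv k \<bullet> x + \<theta>))"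
      using set_integral_diff(2)[OF cos_int[OF int(1)] cos_int[OF int(2)]] by (simp add: inner_diff_left left_diff_distrib)
    also have "\<dots> = 0"
      using g g' test_function_cos_wave[of k \<theta>] h unfolding weak_gradient_def by fastforce
    finally show "(LINT x:Q|lborel. (g x - g' x) \<bullet> h * cos (wv k \<bullet> x + \<theta>)) = 0" .
  qed
  then have "AE x in lborel. \<forall>h\<in>Basis. x \<in> Q \<longrightarrow> (g x - g' x) \<bullet> h = 0"
    by (intro AE_finite_allI) auto
  then show ?thesis
    by eventually_elim (metis euclidean_all_zero_iff eq_iff_diff_eq_0)
qed

end

section \<open>Mild solutions and the equation for the gradient\<close>

lemma Linf_L2_representative:
  assumes v: "v \<in> Linf_L2 L1 L2"
  obtains v1 where "v1 \<in> borel_measurable borel" "\<And>t. 0 < t \<Longrightarrow> v1 t = v t"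
    "AE t in lborel. 0 < t \<longrightarrow> norm (v t) \<le> Linf_L2_norm v"
proof -
  have "v \<in> borel_measurable (restrict_space lborel {0<..})"
    using v by (simp add: Linf_L2_def)
  then have m: "(\<lambda>t. indicator {0<..} t *\<^sub>R v t) \<in> borel_measurable borel"
    by (subst (asm) borel_measurable_restrict_space_iff) simp_all
  define e where "e = esssup (restrict_space lborel {0<..}) (\<lambda>t. ereal (norm (v t)))"
  have e: "e < \<infinity>"
    using v by (simp add: Linf_L2_def e_def)
  have "AE t in restrict_space lborel {0<..}. ereal (norm (v t)) \<le> e"
    unfolding e_def by (rule esssup_AE)
  then have "AE t in lborel. 0 < t \<longrightarrow> ereal (norm (v t)) \<le> e"
    by (subst (asm) AE_restrict_space_iff) simp_all
  then have "AE t in lborel. 0 < t \<longrightarrow> norm (v t) \<le> Linf_L2_norm v"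
  proof eventually_elim
    case (elim t)
    show ?case
    proof
      assume "0 < t"
      with elim e obtain r where "e = ereal r" "norm (v t) \<le> r"
        by (cases e) auto
      then show "norm (v t) \<le> Linf_L2_norm v"
        by (simp add: Linf_L2_norm_def e_def[symmetric])
    qed
  qed
  with m show ?thesis
    by (intro that[of "\<lambda>t. indicator {0<..} t *\<^sub>R v t"]) auto
qed

context torus
begin

lemma singular_bilinear_heat: "singular_bilinear (kernel 1 (\<lambda>_. 1 :: real)) kernel_constant (1/4)"
  by (intro singular_bilinear.intro bounded_bilinear_kernel[OF smoothing_one]
      measurable_kernel[OF smoothing_one] norm_kernel[OF smoothing_one] kernel_constant_pos) auto

lemma singular_bilinear_gradient: "singular_bilinear (kernel \<i> wv) kernel_constant (1/2)"
  by (intro singular_bilinear.intro bounded_bilinear_kernel[OF smoothing_wv]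
      measurable_kernel[OF smoothing_wv] norm_kernel[OF smoothing_wv] kernel_constant_pos) auto

text \<open>
  The semigroup depends on its argument only through the Fourier coefficients, hence through the class.
\<close>

lemma semigroup_KS_inner:
  assumes s: "0 < s" "s \<le> 1"
    and f: "AE x in lborel. x \<in> Q \<longrightarrow> f x = rep_L2 g x \<bullet> rep_L2 h x" "set_integrable lborel Q f"
  shows "semigroup_KS L1 L2 s f = kernel 1 (\<lambda>_. 1) s g h"
proof -
  have "fc f = product_coeff g h"
    unfolding product_coeff_def using fourier_coeff_cong[OF f set_integrable_inner] by (rule ext)
  then show ?thesis
    using s by (simp add: semigroup_KS_eq_propagate kernel_def)
qed

end

text \<open>
  The velocity with its essential bound made pointwise; a change on a null set of times does not affect the
  integrals over time.
\<close>

locale torus_flow = torus +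
  fixes v :: "real \<Rightarrow> plane L2" and V :: real
  assumes measurable_v: "v \<in> borel_measurable borel" and v_le: "\<And>t. norm (v t) \<le> V"
begin

sublocale heat: singular_bilinear "kernel 1 (\<lambda>_. 1 :: real)" kernel_constant "1/4"
  by (rule singular_bilinear_heat)

sublocale flow: volterra "kernel \<i> wv" kernel_constant v V
  by (intro volterra.intro volterra_axioms.intro singular_bilinear_gradient measurable_v v_le)

text \<open>
  The right-hand side of the mild formulation when the gradient is \<open>u\<close>.
\<close>

definition profile :: "real L2 \<Rightarrow> (real \<Rightarrow> plane L2) \<Rightarrow> real \<Rightarrow> real L2" where
  "profile \<phi>0 u t = semigroup_KS L1 L2 t (rep_L2 \<phi>0) - (1/2) *\<^sub>R heat.duhamel u u t - heat.duhamel v u t"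

context
  fixes T R :: real and u :: "real \<Rightarrow> plane L2"
  assumes T: "T \<le> 1" and R: "0 \<le> R" and u: "flow.admissible T R u"
begin

lemma admissible_measurable: "u \<in> borel_measurable borel"
  using u by (simp add: flow.admissible_def)

lemma square_bound:
  assumes "0 < \<tau>" "\<tau> \<le> T"
  shows "norm (u \<tau>) * norm (u \<tau>) \<le> R\<^sup>2 * \<tau> powr (- (1/2))"
proof -
  have "norm (u \<tau>) * norm (u \<tau>) \<le> (R * \<tau> powr (- (1/4))) * (R * \<tau> powr (- (1/4)))"
    using u R assms by (intro mult_mono) (auto simp: flow.admissible_def)
  also have "\<dots> = R\<^sup>2 * (\<tau> powr (- (1/4)) * \<tau> powr (- (1/4)))"
    by (simp add: power2_eq_square)
  finally show ?thesis by (simp add: powr_add[symmetric])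
qed

lemma transport_bound:
  assumes "0 < \<tau>" "\<tau> \<le> T"
  shows "norm (v \<tau>) * norm (u \<tau>) \<le> (V * R) * \<tau> powr (- (1/4))"
proof -
  have "norm (v \<tau>) * norm (u \<tau>) \<le> V * (R * \<tau> powr (- (1/4)))"
    using u R assms flow.V_nonneg by (intro mult_mono v_le) (auto simp: flow.admissible_def)
  then show ?thesis by simp
qed

lemma heat_integrable:
  assumes t: "0 \<le> t" "t \<le> T"
  shows "set_integrable lborel {0<..<t} (\<lambda>\<tau>. kernel 1 (\<lambda>_. 1 :: real) (t - \<tau>) (u \<tau>) (u \<tau>))"
    "set_integrable lborel {0<..<t} (\<lambda>\<tau>. kernel 1 (\<lambda>_. 1 :: real) (t - \<tau>) (v \<tau>) (u \<tau>))"
proof -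
  show "set_integrable lborel {0<..<t} (\<lambda>\<tau>. kernel 1 (\<lambda>_. 1 :: real) (t - \<tau>) (u \<tau>) (u \<tau>))"
    by (rule heat.duhamel_bound(1)[where b = "1/2" and M = "R\<^sup>2"])
      (use admissible_measurable square_bound t T in auto)
  show "set_integrable lborel {0<..<t} (\<lambda>\<tau>. kernel 1 (\<lambda>_. 1 :: real) (t - \<tau>) (v \<tau>) (u \<tau>))"
    by (rule heat.duhamel_bound(1)[where b = "1/4" and M = "V * R"])
      (use admissible_measurable measurable_v transport_bound t T R flow.V_nonneg in auto)
qed

lemma continuous_on_profile: "continuous_on {0..T} (profile \<phi>0 u)"
proof -
  have cont: "0 < s0 \<Longrightarrow> continuous_on {s0..1} (\<lambda>s. kernel 1 (\<lambda>_. 1 :: real) s g h)" for s0 g h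
    by (rule continuous_on_kernel[OF smoothing_one]) auto
  have "continuous_on {0..T} (heat.duhamel u u)"
    by (rule heat.continuous_on_duhamel[where b = "1/2" and M = "R\<^sup>2"])
      (use admissible_measurable square_bound T cont in auto)
  moreover have "continuous_on {0..T} (heat.duhamel v u)"
    by (rule heat.continuous_on_duhamel[where b = "1/4" and M = "V * R"])
      (use admissible_measurable measurable_v transport_bound T R flow.V_nonneg cont in auto)
  moreover have "continuous_on {0..T} (\<lambda>t. semigroup_KS L1 L2 t (rep_L2 \<phi>0))"
    by (rule continuous_on_subset[OF continuous_on_semigroup_KS]) (use T in auto)
  ultimately show ?thesis
    unfolding profile_def[abs_def] by (intro continuous_intros)
qed

lemma profile_in_L2_torus:
  assumes t: "0 \<le> t" "t \<le> T"
  shows "profile \<phi>0 u t \<in> L2_torus L1 L2"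
proof -
  have "heat.duhamel u u t \<in> L2_torus L1 L2" "heat.duhamel v u t \<in> L2_torus L1 L2"
    unfolding heat.duhamel_def set_lebesgue_integral_def
    using heat_integrable[OF t] by (auto simp: set_integrable_def intro!: L2_torus_integral L2_torus_scaleR L2_torus_kernel)
  then show ?thesis
    unfolding profile_def semigroup_KS_eq_propagate
    by (intro L2_torus_diff L2_torus_scaleR L2_torus_propagate)
qed

lemma forcing_in_L2_torus:
  assumes t: "0 \<le> t" "t \<le> T"
  shows "flow.forcing u t \<in> L2_torus L1 L2"
  unfolding flow.forcing_def flow.duhamel_def set_lebesgue_integral_def
  using flow.forcing_bound(1)[OF u T R t]
  by (auto simp: set_integrable_def intro!: L2_torus_integral L2_torus_scaleR L2_torus_kernel)

text \<open>
  Both sides are built from the same coefficients by sums and integrals, and \<open>is_gradient\<close> is closed under these.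
\<close>

lemma profile_gradient:
  assumes t: "0 < t" "t \<le> T"
  shows "is_gradient (profile \<phi>0 u t) (grad_semigroup \<phi>0 t - flow.forcing u t)"
proof -
  have t0: "0 \<le> t" using t by simp
  let ?K = "\<lambda>\<tau>. kernel 1 (\<lambda>_. 1 :: real) (t - \<tau>)"
  note int = heat_integrable[OF t0 t(2)]
  have eq: "(1/2) *\<^sub>R ?K \<tau> (u \<tau>) (u \<tau>) + ?K \<tau> (v \<tau>) (u \<tau>) = ?K \<tau> ((1/2) *\<^sub>R u \<tau> + v \<tau>) (u \<tau>)" for \<tau>
    by (simp add: heat.B.add_left heat.B.scaleR_left)
  have int_half: "set_integrable lborel {0<..<t} (\<lambda>\<tau>. (1/2) *\<^sub>R ?K \<tau> (u \<tau>) (u \<tau>))"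
    using int(1) by (rule set_integrable_scaleR_right)
  have sum_int: "set_integrable lborel {0<..<t} (\<lambda>\<tau>. ?K \<tau> ((1/2) *\<^sub>R u \<tau> + v \<tau>) (u \<tau>))"
    using set_integral_add(1)[OF int_half int(2)] by (simp only: eq)
  have "(LINT \<tau>:{0<..<t}|lborel. ?K \<tau> ((1/2) *\<^sub>R u \<tau> + v \<tau>) (u \<tau>)) = (1/2) *\<^sub>R heat.duhamel u u t + heat.duhamel v u t"
    using set_integral_add(2)[OF int_half int(2)] by (simp only: eq set_integral_scaleR_right heat.duhamel_def)
  then have "profile \<phi>0 u t = semigroup_KS L1 L2 t (rep_L2 \<phi>0) - (LINT \<tau>:{0<..<t}|lborel. ?K \<tau> ((1/2) *\<^sub>R u \<tau> + v \<tau>) (u \<tau>))"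
    by (simp add: profile_def)
  moreover have "is_gradient (LINT \<tau>:{0<..<t}|lborel. ?K \<tau> ((1/2) *\<^sub>R u \<tau> + v \<tau>) (u \<tau>)) (flow.forcing u t)"
    unfolding flow.forcing_def flow.duhamel_def set_lebesgue_integral_def
    using sum_int flow.forcing_bound(1)[OF u T R t0 t(2)]
    by (intro is_gradient_integral is_gradient_scaleR is_gradient_kernel) (simp_all add: set_integrable_def)
  moreover have "is_gradient (semigroup_KS L1 L2 t (rep_L2 \<phi>0)) (grad_semigroup \<phi>0 t)"
    using t T by (intro is_gradient_semigroup) auto
  ultimately show ?thesis
    by (simp add: is_gradient_diff)
qed

end

text \<open>
  A solution \<open>u\<close> of the Volterra equation is the weak gradient of its profile, by \<open>profile_gradient\<close>.  A jointly
  measurable representative of \<open>u\<close> supplies the function \<open>G\<close> demanded by the definition of mild solutions.  The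
  velocity \<open>v0\<close> agrees with \<open>v\<close> only for almost all times; the Borel measurable \<open>v1\<close> is there to make the
  integrands with \<open>v0\<close> measurable.
\<close>

lemma mild_solution_profile:
  assumes T: "T \<le> 1" and R: "0 \<le> R" and u: "flow.admissible T R u"
    and eq: "\<And>t. 0 < t \<Longrightarrow> t \<le> T \<Longrightarrow> u t = grad_semigroup \<phi>0 t - flow.forcing u t"
    and v1: "v1 \<in> borel_measurable borel" "\<And>t. 0 < t \<Longrightarrow> v1 t = v0 t" "AE t in lborel. 0 < t \<longrightarrow> v0 t = v t"
  shows "mild_solution L1 L2 v0 \<phi>0 T (profile \<phi>0 u)" "profile \<phi>0 u \<in> Xtilde L1 L2 T"
proof -
  have [measurable]: "u \<in> borel_measurable borel" using u by (simp add: flow.admissible_def)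
  have C_L2: "profile \<phi>0 u \<in> C_L2 L1 L2 T"
    using continuous_on_profile[OF T R u] profile_in_L2_torus[OF T R u] by (simp add: C_L2_def)
  have grad: "weak_gradient L1 L2 (rep_L2 (profile \<phi>0 u t)) (rep_L2 (u t))" if "0 < t" "t \<le> T" for t
    using profile_gradient[OF T R u that, of \<phi>0] eq[OF that] by (simp add: is_gradient_def)
  have u_torus: "u t \<in> L2_torus L1 L2" if t: "0 < t" "t \<le> T" for t
  proof -
    have "grad_semigroup \<phi>0 t \<in> L2_torus L1 L2"
      by (simp add: grad_semigroup_def L2_torus_propagate L2_torus_zero)
    then show ?thesis
      using forcing_in_L2_torus[OF T R u, of t] t eq[OF t] by (simp add: L2_torus_diff)
  qed
  show "profile \<phi>0 u \<in> Xtilde L1 L2 T"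
    unfolding Xtilde_def
  proof (intro CollectI conjI C_L2 exI[of _ R] ballI)
    fix t assume "t \<in> {0<..T}"
    then have t: "0 < t" "t \<le> T" by auto
    have "t powr (1/4) * norm (u t) \<le> t powr (1/4) * (R * t powr (- (1/4)))"
      using u t by (intro mult_left_mono) (auto simp: flow.admissible_def)
    also have "\<dots> = R * (t powr (1/4) * t powr (- (1/4)))" by simp
    also have "\<dots> = R" using t by (simp add: powr_add[symmetric])
    finally show "\<exists>g\<in>L2_torus L1 L2. weak_gradient L1 L2 (rep_L2 (profile \<phi>0 u t)) (rep_L2 g) \<and> t powr (1/4) * norm g \<le> R"
      using grad[OF t] u_torus[OF t] by blast
  qed
  obtain G where G [measurable]: "(\<lambda>(t, x). G t x) \<in> borel_measurable (borel \<Otimes>\<^sub>M borel)"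
    and G_eq: "\<And>t. AE x in lborel. G t x = rep_L2 (u t) x"
    using measurable_representative[of u] by auto
  have G_slice [measurable]: "G t \<in> borel_measurable borel" for t
    using measurable_Pair2[OF G, of t] by simp
  have [measurable]: "rep_L2 w \<in> borel_measurable borel" for w :: "plane L2"
    using square_integrableD[OF square_integrable_rep_L2[of w]] by simp
  have inner_int: "set_integrable lborel Q (\<lambda>x. rep_L2 w x \<bullet> G t x)" for w t
    using set_integrable_inner[of w "u t"] unfolding set_integrable_def
    by (subst integrable_cong_AE[where g = "\<lambda>x. indicator Q x *\<^sub>R (rep_L2 w x \<bullet> rep_L2 (u t) x)"])
      (use G_eq[of t] in \<open>auto elim: eventually_mono\<close>)
  have square_int: "set_integrable lborel Q (\<lambda>x. (norm (G t x))\<^sup>2)" for t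
    using set_integrable_inner[of "u t" "u t"] unfolding set_integrable_def
    by (subst integrable_cong_AE[where g = "\<lambda>x. indicator Q x *\<^sub>R (rep_L2 (u t) x \<bullet> rep_L2 (u t) x)"])
      (use G_eq[of t] in \<open>auto elim: eventually_mono simp: power2_norm_eq_inner\<close>)
  have nonlinear: "semigroup_KS L1 L2 s (\<lambda>x. (norm (G \<tau> x))\<^sup>2) = kernel 1 (\<lambda>_. 1) s (u \<tau>) (u \<tau>)"
    and transport: "semigroup_KS L1 L2 s (\<lambda>x. rep_L2 w x \<bullet> G \<tau> x) = kernel 1 (\<lambda>_. 1) s w (u \<tau>)"
    if s: "0 < s" "s \<le> 1" for s \<tau> w
  proof -
    show "semigroup_KS L1 L2 s (\<lambda>x. (norm (G \<tau> x))\<^sup>2) = kernel 1 (\<lambda>_. 1) s (u \<tau>) (u \<tau>)"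
      by (rule semigroup_KS_inner[OF s _ square_int])
        (use G_eq[of \<tau>] in \<open>auto elim: eventually_mono simp: power2_norm_eq_inner\<close>)
    show "semigroup_KS L1 L2 s (\<lambda>x. rep_L2 w x \<bullet> G \<tau> x) = kernel 1 (\<lambda>_. 1) s w (u \<tau>)"
      by (rule semigroup_KS_inner[OF s _ inner_int]) (use G_eq[of \<tau>] in \<open>auto elim: eventually_mono\<close>)
  qed
  have loc_int: "set_integrable lborel ({a..b} \<times> Q) (\<lambda>(t, x). G t x)" if ab: "0 < a" "a \<le> b" "b < T" for a b
  proof (rule set_integrable_representative[OF G G_eq])
    fix t assume t: "t \<in> {a..b}"
    have "norm (u t) \<le> R * t powr (- (1/4))"
      using u t ab by (simp add: flow.admissible_def)
    also have "\<dots> \<le> R * a powr (- (1/4))"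
      using R t ab by (intro mult_left_mono powr_mono2') auto
    finally show "norm (u t) \<le> R * a powr (- (1/4))" .
  qed
  have time: "set_integrable lborel {0<..<t} (\<lambda>\<tau>. semigroup_KS L1 L2 (t - \<tau>) (\<lambda>x. (norm (G \<tau> x))\<^sup>2))"
    "(LINT \<tau>:{0<..<t}|lborel. semigroup_KS L1 L2 (t - \<tau>) (\<lambda>x. (norm (G \<tau> x))\<^sup>2)) = heat.duhamel u u t"
    "set_integrable lborel {0<..<t} (\<lambda>\<tau>. semigroup_KS L1 L2 (t - \<tau>) (\<lambda>x. rep_L2 (v0 \<tau>) x \<bullet> G \<tau> x))"
    "(LINT \<tau>:{0<..<t}|lborel. semigroup_KS L1 L2 (t - \<tau>) (\<lambda>x. rep_L2 (v0 \<tau>) x \<bullet> G \<tau> x)) = heat.duhamel v u t"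
    if t: "0 \<le> t" "t \<le> T" for t
  proof -
    note int = heat_integrable[OF T R u t]
    have n: "semigroup_KS L1 L2 (t - \<tau>) (\<lambda>x. (norm (G \<tau> x))\<^sup>2) = kernel 1 (\<lambda>_. 1) (t - \<tau>) (u \<tau>) (u \<tau>)" if "\<tau> \<in> {0<..<t}" for \<tau>
      using that t T by (intro nonlinear) auto
    then show "set_integrable lborel {0<..<t} (\<lambda>\<tau>. semigroup_KS L1 L2 (t - \<tau>) (\<lambda>x. (norm (G \<tau> x))\<^sup>2))"
      using int(1) by (subst set_integrable_cong[OF refl refl n]) auto
    show "(LINT \<tau>:{0<..<t}|lborel. semigroup_KS L1 L2 (t - \<tau>) (\<lambda>x. (norm (G \<tau> x))\<^sup>2)) = heat.duhamel u u t"
      unfolding heat.duhamel_def by (rule set_lebesgue_integral_cong) (use n in auto)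
    have tr: "indicator {0<..<t} \<tau> *\<^sub>R semigroup_KS L1 L2 (t - \<tau>) (\<lambda>x. rep_L2 (v0 \<tau>) x \<bullet> G \<tau> x) =
        indicator {0<..<t} \<tau> *\<^sub>R kernel 1 (\<lambda>_. 1) (t - \<tau>) (v1 \<tau>) (u \<tau>)" for \<tau>
      using transport[of "t - \<tau>" "v0 \<tau>" \<tau>] v1(2)[of \<tau>] t T by (auto simp: indicator_def)
    have meas: "(\<lambda>\<tau>. indicator {0<..<t} \<tau> *\<^sub>R kernel 1 (\<lambda>_. 1 :: real) (t - \<tau>) (w \<tau>) (u \<tau>)) \<in> borel_measurable lborel"
      if "w \<in> borel_measurable borel" for w
      using heat.set_measurable_duhamel[OF that, of u t] by (simp add: set_borel_measurable_def)
    have AE_eq: "AE \<tau> in lborel. indicator {0<..<t} \<tau> *\<^sub>R kernel 1 (\<lambda>_. 1 :: real) (t - \<tau>) (v1 \<tau>) (u \<tau>) =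
        indicator {0<..<t} \<tau> *\<^sub>R kernel 1 (\<lambda>_. 1) (t - \<tau>) (v \<tau>) (u \<tau>)"
      using v1(3) by eventually_elim (auto simp: indicator_def v1(2))
    show "set_integrable lborel {0<..<t} (\<lambda>\<tau>. semigroup_KS L1 L2 (t - \<tau>) (\<lambda>x. rep_L2 (v0 \<tau>) x \<bullet> G \<tau> x))"
      unfolding set_integrable_def tr
      using int(2) integrable_cong_AE[OF meas[OF v1(1)] meas[OF measurable_v] AE_eq] by (simp add: set_integrable_def)
    show "(LINT \<tau>:{0<..<t}|lborel. semigroup_KS L1 L2 (t - \<tau>) (\<lambda>x. rep_L2 (v0 \<tau>) x \<bullet> G \<tau> x)) = heat.duhamel v u t"
      unfolding heat.duhamel_def set_lebesgue_integral_def tr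
      by (rule integral_cong_AE[OF meas[OF v1(1)] meas[OF measurable_v] AE_eq])
  qed
  show "mild_solution L1 L2 v0 \<phi>0 T (profile \<phi>0 u)"
    unfolding mild_solution_def
  proof (intro conjI C_L2 exI[of _ G] allI impI ballI loc_int AE_I2)
    fix \<tau> assume "\<tau> \<in> {0<..<T}"
    then show "weak_gradient L1 L2 (rep_L2 (profile \<phi>0 u \<tau>)) (G \<tau>)"
      by (intro weak_gradient_cong[OF grad G_eq G_slice]) auto
  next
    fix t assume "t \<in> {0..T}"
    then have t: "0 \<le> t" "t \<le> T" by auto
    note tt = time[OF t]
    show "set_integrable lborel {0<..<t} (\<lambda>\<tau>. semigroup_KS L1 L2 (t - \<tau>) (\<lambda>x. (norm (G \<tau> x))\<^sup>2))"
      by (rule tt(1))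
    show "set_integrable lborel {0<..<t} (\<lambda>\<tau>. semigroup_KS L1 L2 (t - \<tau>) (\<lambda>x. rep_L2 (v0 \<tau>) x \<bullet> G \<tau> x))"
      by (rule tt(3))
    show "profile \<phi>0 u t = semigroup_KS L1 L2 t (rep_L2 \<phi>0)
       - (1/2) *\<^sub>R (LINT \<tau>:{0<..<t}|lborel. semigroup_KS L1 L2 (t - \<tau>) (\<lambda>x. (norm (G \<tau> x))\<^sup>2))
       - (LINT \<tau>:{0<..<t}|lborel. semigroup_KS L1 L2 (t - \<tau>) (\<lambda>x. rep_L2 (v0 \<tau>) x \<bullet> G \<tau> x))"
      unfolding tt(2,4) profile_def ..
  qed (auto intro: square_int inner_int)
qed


text \<open>
  By uniqueness of weak gradients, for almost every time the gradient \<open>G\<close> of a mild solution is the square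
  integrable gradient whose norm is controlled in \<open>Xtilde\<close>.  It thus defines an admissible \<open>u\<close>, and \<open>\<psi>\<close> is
  the profile of \<open>u\<close>.  Then \<open>r = \<nabla> S t \<phi>0 - forcing u\<close> is a gradient of the profile at every
  positive time, equals \<open>u\<close> almost everywhere, and so solves the equation without exceptional times.
\<close>

lemma mild_solution_is_profile:
  assumes T: "0 < T" "T \<le> 1"
    and mild: "mild_solution L1 L2 v0 \<phi>0 T \<psi>" and X: "\<psi> \<in> Xtilde L1 L2 T"
    and v0: "AE t in lborel. 0 < t \<longrightarrow> v0 t = v t"
  obtains r R where "0 \<le> R" "flow.admissible T R r"
    "\<And>t. 0 < t \<Longrightarrow> t \<le> T \<Longrightarrow> r t = grad_semigroup \<phi>0 t - flow.forcing r t"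
    "\<And>t. 0 \<le> t \<Longrightarrow> t \<le> T \<Longrightarrow> \<psi> t = profile \<phi>0 r t"
proof -
  from mild obtain G where
    "\<forall>a b. 0 < a \<longrightarrow> a \<le> b \<longrightarrow> b < T \<longrightarrow> set_integrable lborel ({a..b} \<times> Q) (\<lambda>(t, x). G t x)"
    and ae: "AE \<tau> in lborel. \<tau> \<in> {0<..<T} \<longrightarrow>
           weak_gradient L1 L2 (rep_L2 (\<psi> \<tau>)) (G \<tau>) \<and>
           set_integrable lborel Q (\<lambda>x. (norm (G \<tau> x))\<^sup>2) \<and>
           set_integrable lborel Q (\<lambda>x. rep_L2 (v0 \<tau>) x \<bullet> G \<tau> x)"
    and eqn: "\<forall>t\<in>{0..T}.
           set_integrable lborel {0<..<t} (\<lambda>\<tau>. semigroup_KS L1 L2 (t - \<tau>) (\<lambda>x. (norm (G \<tau> x))\<^sup>2)) \<and>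
           set_integrable lborel {0<..<t} (\<lambda>\<tau>. semigroup_KS L1 L2 (t - \<tau>) (\<lambda>x. rep_L2 (v0 \<tau>) x \<bullet> G \<tau> x)) \<and>
           \<psi> t = semigroup_KS L1 L2 t (rep_L2 \<phi>0)
             - (1/2) *\<^sub>R (LINT \<tau>:{0<..<t}|lborel. semigroup_KS L1 L2 (t - \<tau>) (\<lambda>x. (norm (G \<tau> x))\<^sup>2))
             - (LINT \<tau>:{0<..<t}|lborel. semigroup_KS L1 L2 (t - \<tau>) (\<lambda>x. rep_L2 (v0 \<tau>) x \<bullet> G \<tau> x))"
    unfolding mild_solution_def by (elim conjE exE) (rule that)
  then have loc: "\<And>a b. 0 < a \<Longrightarrow> a \<le> b \<Longrightarrow> b < T \<Longrightarrow> set_integrable lborel ({a..b} \<times> Q) (\<lambda>(t, x). G t x)"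
    by simp
  from X obtain C where C: "\<And>t. t \<in> {0<..T} \<Longrightarrow> \<exists>g\<in>L2_torus L1 L2.
      weak_gradient L1 L2 (rep_L2 (\<psi> t)) (rep_L2 g) \<and> t powr (1/4) * norm g \<le> C"
    unfolding Xtilde_def by blast
  define R where "R = max 0 C"
  have R: "0 \<le> R" by (simp add: R_def)
  define H where "H t x = indicator ({0<..<T} \<times> Q) (t, x) *\<^sub>R G t x" for t x
  have H [measurable]: "(\<lambda>(t, x). H t x) \<in> borel_measurable (borel \<Otimes>\<^sub>M borel)"
    unfolding H_def by (rule measurable_of_locally_integrable[OF T(1) loc])
  have H_slice [measurable]: "H t \<in> borel_measurable borel" for t
    using measurable_Pair2[OF H, of t] by simp
  \<comment> \<open>Slices that are not square integrable are replaced by \<open>0\<close>.\<close>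
  define energy where "energy t = (\<integral>\<^sup>+x. ennreal ((norm (H t x))\<^sup>2) \<partial>lborel)" for t
  have [measurable]: "energy \<in> borel_measurable borel"
    unfolding energy_def[abs_def] by (rule lborel.borel_measurable_nn_integral) measurable
  define H' where "H' t x = (if energy t < \<infinity> then H t x else 0)" for t x
  have H' [measurable]: "(\<lambda>(t, x). H' t x) \<in> borel_measurable (borel \<Otimes>\<^sub>M borel)"
    unfolding H'_def by measurable
  have sq: "square_integrable (H' t)" for t
  proof (cases "energy t < \<infinity>")
    case True
    then have "H' t = H t" by (simp add: H'_def fun_eq_iff)
    moreover have "integrable lborel (\<lambda>x. (norm (H t x))\<^sup>2)"
      by (rule integrableI_bounded) (use True in \<open>simp_all add: energy_def\<close>)
    ultimately show ?thesis by (simp add: square_integrable_def)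
  next
    case False
    then have "H' t = (\<lambda>x. 0)" by (simp add: H'_def fun_eq_iff)
    then show ?thesis by simp
  qed
  define w where "w t = abs_L2 (H' t)" for t
  have [measurable]: "w \<in> borel_measurable borel"
    unfolding w_def[abs_def] by (rule measurable_abs_L2[OF H' sq])
  \<comment> \<open>Truncation changes nothing for almost all times, and makes the bound hold at every time.\<close>
  define u where "u t = (if 0 < t \<and> norm (w t) \<le> R * t powr (- (1/4)) then w t else 0)" for t
  have u_meas [measurable]: "u \<in> borel_measurable borel"
    unfolding u_def by measurable
  have u: "flow.admissible T R u"
    using u_meas R by (auto simp: flow.admissible_def u_def)
  have G_u: "AE \<tau> in lborel. \<tau> \<in> {0<..<T} \<longrightarrow>
      weak_gradient L1 L2 (rep_L2 (\<psi> \<tau>)) (G \<tau>) \<and> u \<tau> \<in> L2_torus L1 L2 \<and>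
      (AE x in lborel. x \<in> Q \<longrightarrow> G \<tau> x = rep_L2 (u \<tau>) x) \<and>
      set_integrable lborel Q (\<lambda>x. (norm (G \<tau> x))\<^sup>2) \<and>
      set_integrable lborel Q (\<lambda>x. rep_L2 (v0 \<tau>) x \<bullet> G \<tau> x)"
    using ae
  proof eventually_elim
    case (elim \<tau>)
    show ?case
    proof
      assume \<tau>: "\<tau> \<in> {0<..<T}"
      with elim have g: "weak_gradient L1 L2 (rep_L2 (\<psi> \<tau>)) (G \<tau>)"
        and G2: "set_integrable lborel Q (\<lambda>x. (norm (G \<tau> x))\<^sup>2)"
        and vG: "set_integrable lborel Q (\<lambda>x. rep_L2 (v0 \<tau>) x \<bullet> G \<tau> x)" by auto
      have H_eq: "H \<tau> = (\<lambda>x. indicator Q x *\<^sub>R G \<tau> x)"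
        using \<tau> by (auto simp: H_def fun_eq_iff indicator_def)
      have "integrable lborel (\<lambda>x. (norm (H \<tau> x))\<^sup>2)"
      proof -
        have "(\<lambda>x. (norm (H \<tau> x))\<^sup>2) = (\<lambda>x. indicator Q x *\<^sub>R (norm (G \<tau> x))\<^sup>2)"
          by (auto simp: H_eq indicator_def)
        then show ?thesis using G2 by (simp add: set_integrable_def)
      qed
      then have "energy \<tau> < \<infinity>"
        by (simp add: energy_def nn_integral_eq_integral)
      then have H'_eq: "H' \<tau> = (\<lambda>x. indicator Q x *\<^sub>R G \<tau> x)"
        by (simp add: H'_def H_eq fun_eq_iff)
      then have w_eq: "w \<tau> = to_L2_torus L1 L2 (G \<tau>)"
        by (simp add: w_def to_L2_torus_def)
      have sqG: "square_integrable (\<lambda>x. indicator Q x *\<^sub>R G \<tau> x)"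
        using sq[of \<tau>] by (simp only: H'_eq)
      have w_torus: "w \<tau> \<in> L2_torus L1 L2"
        unfolding w_eq by (rule to_L2_torus_in_L2_torus[OF sqG])
      have rep_w: "AE x in lborel. rep_L2 (w \<tau>) x = indicator Q x *\<^sub>R G \<tau> x"
        unfolding w_eq to_L2_torus_def by (rule rep_L2_abs_L2[OF sqG])
      obtain g' where g': "g' \<in> L2_torus L1 L2" "weak_gradient L1 L2 (rep_L2 (\<psi> \<tau>)) (rep_L2 g')"
        "\<tau> powr (1/4) * norm g' \<le> C"
        using C[of \<tau>] \<tau> by auto
      have "w \<tau> = g'"
      proof (rule L2_torus_eqI[OF w_torus g'(1)])
        show "AE x in lborel. x \<in> Q \<longrightarrow> rep_L2 (w \<tau>) x = rep_L2 g' x"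
          using rep_w weak_gradient_unique[OF g g'(2)] by eventually_elim auto
      qed
      have "norm (w \<tau>) = (\<tau> powr (1/4) * norm g') * \<tau> powr (- (1/4))"
        using \<tau> by (simp add: \<open>w \<tau> = g'\<close> powr_minus field_simps)
      also have "\<dots> \<le> R * \<tau> powr (- (1/4))"
        using g'(3) by (intro mult_right_mono) (auto simp: R_def)
      finally have "u \<tau> = w \<tau>"
        using \<tau> by (simp add: u_def)
      moreover have "AE x in lborel. x \<in> Q \<longrightarrow> G \<tau> x = rep_L2 (w \<tau>) x"
        using rep_w by eventually_elim auto
      ultimately show "weak_gradient L1 L2 (rep_L2 (\<psi> \<tau>)) (G \<tau>) \<and> u \<tau> \<in> L2_torus L1 L2 \<and>
          (AE x in lborel. x \<in> Q \<longrightarrow> G \<tau> x = rep_L2 (u \<tau>) x) \<and>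
          set_integrable lborel Q (\<lambda>x. (norm (G \<tau> x))\<^sup>2) \<and>
          set_integrable lborel Q (\<lambda>x. rep_L2 (v0 \<tau>) x \<bullet> G \<tau> x)"
        using g G2 vG w_torus by simp
    qed
  qed
  have \<psi>_eq: "\<psi> t = profile \<phi>0 u t" if t: "0 \<le> t" "t \<le> T" for t
  proof -
    have meas: "(\<lambda>\<tau>. indicator {0<..<t} \<tau> *\<^sub>R kernel 1 (\<lambda>_. 1 :: real) (t - \<tau>) (p \<tau>) (u \<tau>)) \<in> borel_measurable lborel"
      if "p \<in> borel_measurable borel" for p
      using heat.set_measurable_duhamel[OF that u_meas, of t] by (simp add: set_borel_measurable_def)
    have *: "set_integrable lborel {0<..<t} (\<lambda>\<tau>. semigroup_KS L1 L2 (t - \<tau>) (\<lambda>x. (norm (G \<tau> x))\<^sup>2))"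
      "set_integrable lborel {0<..<t} (\<lambda>\<tau>. semigroup_KS L1 L2 (t - \<tau>) (\<lambda>x. rep_L2 (v0 \<tau>) x \<bullet> G \<tau> x))"
      "\<psi> t = semigroup_KS L1 L2 t (rep_L2 \<phi>0)
             - (1/2) *\<^sub>R (LINT \<tau>:{0<..<t}|lborel. semigroup_KS L1 L2 (t - \<tau>) (\<lambda>x. (norm (G \<tau> x))\<^sup>2))
             - (LINT \<tau>:{0<..<t}|lborel. semigroup_KS L1 L2 (t - \<tau>) (\<lambda>x. rep_L2 (v0 \<tau>) x \<bullet> G \<tau> x))"
      using eqn t by auto
    have "(LINT \<tau>:{0<..<t}|lborel. semigroup_KS L1 L2 (t - \<tau>) (\<lambda>x. (norm (G \<tau> x))\<^sup>2)) = heat.duhamel u u t"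
      unfolding heat.duhamel_def set_lebesgue_integral_def
    proof (rule integral_cong_AE)
      show "AE \<tau> in lborel. indicator {0<..<t} \<tau> *\<^sub>R semigroup_KS L1 L2 (t - \<tau>) (\<lambda>x. (norm (G \<tau> x))\<^sup>2) =
          indicator {0<..<t} \<tau> *\<^sub>R kernel 1 (\<lambda>_. 1) (t - \<tau>) (u \<tau>) (u \<tau>)"
        using G_u
      proof eventually_elim
        case (elim \<tau>)
        show ?case
        proof (cases "\<tau> \<in> {0<..<t}")
          case True
          with elim t have a: "AE x in lborel. x \<in> Q \<longrightarrow> G \<tau> x = rep_L2 (u \<tau>) x"
            and i: "set_integrable lborel Q (\<lambda>x. (norm (G \<tau> x))\<^sup>2)" by auto
          have "AE x in lborel. x \<in> Q \<longrightarrow> (norm (G \<tau> x))\<^sup>2 = rep_L2 (u \<tau>) x \<bullet> rep_L2 (u \<tau>) x"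
            using a by eventually_elim (simp add: power2_norm_eq_inner)
          then have "semigroup_KS L1 L2 (t - \<tau>) (\<lambda>x. (norm (G \<tau> x))\<^sup>2) = kernel 1 (\<lambda>_. 1) (t - \<tau>) (u \<tau>) (u \<tau>)"
            using True t T by (intro semigroup_KS_inner i) auto
          then show ?thesis by simp
        qed simp
      qed
    qed (use *(1) meas[OF u_meas] in \<open>auto simp: set_integrable_def dest: borel_measurable_integrable\<close>)
    moreover have "(LINT \<tau>:{0<..<t}|lborel. semigroup_KS L1 L2 (t - \<tau>) (\<lambda>x. rep_L2 (v0 \<tau>) x \<bullet> G \<tau> x)) = heat.duhamel v u t"
      unfolding heat.duhamel_def set_lebesgue_integral_def
    proof (rule integral_cong_AE)
      show "AE \<tau> in lborel. indicator {0<..<t} \<tau> *\<^sub>R semigroup_KS L1 L2 (t - \<tau>) (\<lambda>x. rep_L2 (v0 \<tau>) x \<bullet> G \<tau> x) =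
          indicator {0<..<t} \<tau> *\<^sub>R kernel 1 (\<lambda>_. 1) (t - \<tau>) (v \<tau>) (u \<tau>)"
        using G_u v0
      proof eventually_elim
        case (elim \<tau>)
        show ?case
        proof (cases "\<tau> \<in> {0<..<t}")
          case True
          with elim t have a: "AE x in lborel. x \<in> Q \<longrightarrow> G \<tau> x = rep_L2 (u \<tau>) x" and v: "v0 \<tau> = v \<tau>"
            and i: "set_integrable lborel Q (\<lambda>x. rep_L2 (v0 \<tau>) x \<bullet> G \<tau> x)" by auto
          have "AE x in lborel. x \<in> Q \<longrightarrow> rep_L2 (v0 \<tau>) x \<bullet> G \<tau> x = rep_L2 (v \<tau>) x \<bullet> rep_L2 (u \<tau>) x"
            using a by eventually_elim (simp add: v)
          then have "semigroup_KS L1 L2 (t - \<tau>) (\<lambda>x. rep_L2 (v0 \<tau>) x \<bullet> G \<tau> x) = kernel 1 (\<lambda>_. 1) (t - \<tau>) (v \<tau>) (u \<tau>)"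
            using True t T by (intro semigroup_KS_inner i) auto
          then show ?thesis by simp
        qed simp
      qed
    qed (use *(2) meas[OF measurable_v] in \<open>auto simp: set_integrable_def dest: borel_measurable_integrable\<close>)
    ultimately show ?thesis
      using *(3) by (simp only: profile_def)
  qed
  define r where "r t = grad_semigroup \<phi>0 t - flow.forcing u t" for t
  have r_meas: "r \<in> borel_measurable borel"
    unfolding r_def[abs_def]
    by (intro borel_measurable_diff measurable_grad_semigroup flow.measurable_forcing u_meas)
  have u_r: "AE \<tau> in lborel. \<tau> \<in> {0<..<T} \<longrightarrow> u \<tau> = r \<tau>"
    using G_u
  proof eventually_elim
    case (elim \<tau>)
    show ?case
    proof
      assume \<tau>: "\<tau> \<in> {0<..<T}"
      then have t: "0 < \<tau>" "\<tau> \<le> T" by auto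
      from elim \<tau> have g: "weak_gradient L1 L2 (rep_L2 (\<psi> \<tau>)) (G \<tau>)" and ut: "u \<tau> \<in> L2_torus L1 L2"
        and Gu: "AE x in lborel. x \<in> Q \<longrightarrow> G \<tau> x = rep_L2 (u \<tau>) x" by auto
      have g': "weak_gradient L1 L2 (rep_L2 (\<psi> \<tau>)) (rep_L2 (r \<tau>))"
        using profile_gradient[OF T(2) R u t, of \<phi>0] \<psi>_eq[of \<tau>] t by (simp add: is_gradient_def r_def)
      have "grad_semigroup \<phi>0 \<tau> \<in> L2_torus L1 L2"
        by (simp add: grad_semigroup_def L2_torus_propagate L2_torus_zero)
      then have rt: "r \<tau> \<in> L2_torus L1 L2"
        unfolding r_def using forcing_in_L2_torus[OF T(2) R u, of \<tau>] t by (intro L2_torus_diff) auto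
      show "u \<tau> = r \<tau>"
        by (rule L2_torus_eqI[OF ut rt])
          (use Gu weak_gradient_unique[OF g g'] in \<open>eventually_elim, simp\<close>)
    qed
  qed
  have same: "flow.forcing u t = flow.forcing r t" "profile \<phi>0 u t = profile \<phi>0 r t" if t: "t \<le> T" for t
  proof -
    have ae: "AE \<tau> in lborel. \<tau> \<in> {0<..<t} \<longrightarrow> u \<tau> = r \<tau>"
      using u_r by eventually_elim (use t in auto)
    show "flow.forcing u t = flow.forcing r t"
      unfolding flow.forcing_def
      by (rule flow.duhamel_cong_AE) (use ae u_meas r_meas measurable_v in \<open>auto elim: eventually_mono\<close>)
    have "heat.duhamel u u t = heat.duhamel r r t" "heat.duhamel v u t = heat.duhamel v r t"
      by (rule heat.duhamel_cong_AE; use ae u_meas r_meas measurable_v in \<open>auto elim: eventually_mono\<close>)+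
    then show "profile \<phi>0 u t = profile \<phi>0 r t"
      by (simp add: profile_def)
  qed
  define R' where "R' = 2 * sqrt smoothing_constant * norm \<phi>0 + kernel_constant * singular_constant (1/2) (1/2) * ((R / 2 + V) * R)"
  have K: "0 \<le> kernel_constant * singular_constant (1/2) (1/2) * ((R / 2 + V) * R)"
    using R flow.V_nonneg kernel_constant_pos less_imp_le[OF singular_constant_pos[of "1/2" "1/2"]] by simp
  show ?thesis
  proof (rule that)
    show "0 \<le> R'"
      unfolding R'_def using K smoothing_constant_pos by simp
    show "flow.admissible T R' r"
      unfolding flow.admissible_def
    proof (intro conjI r_meas allI impI)
      fix t assume t: "0 < t" "t \<le> T"
      have "norm (r t) \<le> norm (grad_semigroup \<phi>0 t) + norm (flow.forcing u t)"
        unfolding r_def by (rule norm_triangle_ineq4)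
      also have "\<dots> \<le> 2 * sqrt smoothing_constant * norm \<phi>0 * t powr (- (1/4)) +
          kernel_constant * singular_constant (1/2) (1/2) * ((R / 2 + V) * R)"
        using t T by (intro add_mono norm_grad_semigroup flow.forcing_bound(2)[OF u T(2) R]) auto
      also have "\<dots> \<le> 2 * sqrt smoothing_constant * norm \<phi>0 * t powr (- (1/4)) +
          kernel_constant * singular_constant (1/2) (1/2) * ((R / 2 + V) * R) * t powr (- (1/4))"
        using mult_left_mono[OF one_le_powr_minus[of t "1/4"] K] t T by simp
      finally show "norm (r t) \<le> R' * t powr (- (1/4))"
        by (simp only: R'_def distrib_right)
    qed
    show "r t = grad_semigroup \<phi>0 t - flow.forcing r t" if "0 < t" "t \<le> T" for t
      using same(1)[OF that(2)] by (simp add: r_def)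
    show "\<psi> t = profile \<phi>0 r t" if "0 \<le> t" "t \<le> T" for t
      using \<psi>_eq[OF that] same(2)[OF that(2)] by simp
  qed
qed

end

context torus
begin

section \<open>Local well-posedness\<close>

text \<open>
  \<open>N\<close> bounds the velocity and \<open>M\<close> the initial datum.  \<open>A\<close> is the constant of \<open>norm_grad_semigroup\<close>, and \<open>X\<close> the
  factor of \<open>T powr (1/4)\<close> in the smallness condition of \<open>volterra.existence\<close>.
\<close>

definition lifetime :: "real \<Rightarrow> real \<Rightarrow> real" where
  "lifetime N M =
     (let A = 2 * sqrt smoothing_constant * M; V = max 0 N;
          X = kernel_constant * singular_constant (1/2) (1/2) * (A + 1 + V) * (A + 1)
      in min 1 ((1 / (2 * X)) powr 4))"

lemma lifetime_bounds:
  assumes M: "0 \<le> M" and A: "A = 2 * sqrt smoothing_constant * M" and V: "V = max 0 N"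
  shows "0 < lifetime N M" "lifetime N M \<le> 1"
    "kernel_constant * singular_constant (1/2) (1/2) * (A + 1 + V) * (A + 1) * lifetime N M powr (1/4) \<le> 1/2"
proof -
  define X where "X = kernel_constant * singular_constant (1/2) (1/2) * (A + 1 + V) * (A + 1)"
  have "0 \<le> A" using M smoothing_constant_pos by (simp add: A)
  then have X: "0 < X"
    unfolding X_def using kernel_constant_pos singular_constant_pos[of "1/2" "1/2"]
    by (intro mult_pos_pos) (auto simp: V)
  have eq: "lifetime N M = min 1 ((1 / (2 * X)) powr 4)"
    by (simp only: lifetime_def Let_def X_def A V)
  show pos: "0 < lifetime N M" "lifetime N M \<le> 1"
    unfolding eq using X by auto
  have "lifetime N M powr (1/4) \<le> ((1 / (2 * X)) powr 4) powr (1/4)"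
    using pos(1) by (intro powr_mono2) (auto simp: eq)
  also have "\<dots> = 1 / (2 * X)"
    unfolding powr_powr using X by simp
  finally have "X * lifetime N M powr (1/4) \<le> X * (1 / (2 * X))"
    using X by (intro mult_left_mono) auto
  also have "\<dots> = 1/2" using X by simp
  finally show "kernel_constant * singular_constant (1/2) (1/2) * (A + 1 + V) * (A + 1) * lifetime N M powr (1/4) \<le> 1/2"
    by (simp only: X_def)
qed

lemma well_posedness:
  fixes \<phi>0 :: "real L2"
  assumes v: "v \<in> Linf_L2 L1 L2"
  defines "T \<equiv> lifetime (Linf_L2_norm v) (norm \<phi>0)"
  shows "0 < T" "T \<le> 1"
    "\<exists>\<phi>. mild_solution L1 L2 v \<phi>0 T \<phi> \<and> \<phi> \<in> Xtilde L1 L2 T \<and>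
       (\<forall>\<psi>. mild_solution L1 L2 v \<phi>0 T \<psi> \<and> \<psi> \<in> Xtilde L1 L2 T \<longrightarrow> (\<forall>t\<in>{0..T}. \<psi> t = \<phi> t))"
proof -
  define A where "A = 2 * sqrt smoothing_constant * norm \<phi>0"
  define V where "V = max 0 (Linf_L2_norm v)"
  have A: "0 \<le> A" using smoothing_constant_pos by (simp add: A_def)
  note life = lifetime_bounds[OF norm_ge_zero[of \<phi>0] A_def V_def, folded T_def]
  show T: "0 < T" "T \<le> 1" by (rule life)+
  obtain v1 where v1 [measurable]: "v1 \<in> borel_measurable borel" and v1_eq: "\<And>t. 0 < t \<Longrightarrow> v1 t = v t"
    and v_norm: "AE t in lborel. 0 < t \<longrightarrow> norm (v t) \<le> Linf_L2_norm v"
    by (rule Linf_L2_representative[OF v]) (rule that)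
  \<comment> \<open>The bound by the essential supremum may fail on a null set of times.\<close>
  define w where "w t = (if norm (v1 t) \<le> V then v1 t else 0)" for t
  have "w \<in> borel_measurable borel" unfolding w_def by measurable
  moreover have "norm (w t) \<le> V" for t by (simp add: w_def V_def)
  ultimately interpret torus_flow L1 L2 w V
    by unfold_locales
  have v_w: "AE t in lborel. 0 < t \<longrightarrow> v t = w t"
    using v_norm by (rule eventually_mono) (auto simp: w_def v1_eq V_def le_max_iff_disj)
  have u0: "flow.admissible T A (grad_semigroup \<phi>0)"
    unfolding flow.admissible_def A_def
    using measurable_grad_semigroup T by (auto intro!: norm_grad_semigroup)
  obtain u where u: "flow.admissible T (A + 1) u"
    "\<And>t. 0 < t \<Longrightarrow> t \<le> T \<Longrightarrow> u t = grad_semigroup \<phi>0 t - flow.forcing u t"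
    using flow.existence[OF u0 T A life(3)] by blast
  have R: "0 \<le> A + 1" using A by simp
  note sol = mild_solution_profile[OF T(2) R u v1 v1_eq v_w]
  have "\<psi> t = profile \<phi>0 u t"
    if \<psi>: "mild_solution L1 L2 v \<phi>0 T \<psi>" "\<psi> \<in> Xtilde L1 L2 T" and t: "t \<in> {0..T}" for \<psi> t
  proof -
    obtain r R' where r: "0 \<le> R'" "flow.admissible T R' r"
      "\<And>t. 0 < t \<Longrightarrow> t \<le> T \<Longrightarrow> r t = grad_semigroup \<phi>0 t - flow.forcing r t"
      "\<And>t. 0 \<le> t \<Longrightarrow> t \<le> T \<Longrightarrow> \<psi> t = profile \<phi>0 r t"
      by (rule mild_solution_is_profile[OF T \<psi> v_w]) (rule that)
    define S where "S = max (A + 1) R'"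
    have S: "0 \<le> S" using R by (simp add: S_def)
    have adm: "flow.admissible T S u" "flow.admissible T S r"
      using u(1) r(2) unfolding flow.admissible_def S_def
      by (auto intro: order_trans mult_right_mono)
    have eq: "u t = r t" if "0 < t" "t \<le> T" for t
      by (rule flow.uniqueness[OF adm T(2) S u(2) r(3) that])
    have "heat.duhamel u u t = heat.duhamel r r t" "heat.duhamel w u t = heat.duhamel w r t"
      unfolding heat.duhamel_def by (rule set_lebesgue_integral_cong; use t eq in auto)+
    then show ?thesis
      using r(4)[of t] t by (simp add: profile_def)
  qed
  with sol show "\<exists>\<phi>. mild_solution L1 L2 v \<phi>0 T \<phi> \<and> \<phi> \<in> Xtilde L1 L2 T \<and>
       (\<forall>\<psi>. mild_solution L1 L2 v \<phi>0 T \<psi> \<and> \<psi> \<in> Xtilde L1 L2 T \<longrightarrow> (\<forall>t\<in>{0..T}. \<psi> t = \<phi> t))"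
    by blast
qed

end

theorem theorem2p4:
  "\<exists>\<T> :: real \<Rightarrow> real \<Rightarrow> real \<Rightarrow> real \<Rightarrow> real.
     \<forall>L1 L2 :: real. \<forall>\<phi>0 :: real L2. \<forall>v :: real \<Rightarrow> plane L2.
       0 < L1 \<longrightarrow> 0 < L2 \<longrightarrow> \<phi>0 \<in> L2_torus L1 L2 \<longrightarrow> v \<in> Linf_L2 L1 L2 \<longrightarrow>
       (AE t in lborel. 0 < t \<longrightarrow> divergence_free L1 L2 (rep_L2 (v t))) \<longrightarrow>
       (let T = \<T> L1 L2 (Linf_L2_norm v) (norm \<phi>0) in
          0 < T \<and> T \<le> 1 \<and>
          (\<exists>\<phi>. mild_solution L1 L2 v \<phi>0 T \<phi> \<and> \<phi> \<in> Xtilde L1 L2 T \<and>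
             (\<forall>\<psi>. mild_solution L1 L2 v \<phi>0 T \<psi> \<and> \<psi> \<in> Xtilde L1 L2 T \<longrightarrow>
                (\<forall>t\<in>{0..T}. \<psi> t = \<phi> t))))"
proof (intro exI[of _ torus.lifetime] allI impI)
  fix L1 L2 :: real and \<phi>0 :: "real L2" and v :: "real \<Rightarrow> plane L2"
  assume "0 < L1" "0 < L2" and v: "v \<in> Linf_L2 L1 L2"
  then interpret torus L1 L2 by unfold_locales
  show "let T = lifetime (Linf_L2_norm v) (norm \<phi>0) in
          0 < T \<and> T \<le> 1 \<and>
          (\<exists>\<phi>. mild_solution L1 L2 v \<phi>0 T \<phi> \<and> \<phi> \<in> Xtilde L1 L2 T \<and>
             (\<forall>\<psi>. mild_solution L1 L2 v \<phi>0 T \<psi> \<and> \<psi> \<in> Xtilde L1 L2 T \<longrightarrow>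
                (\<forall>t\<in>{0..T}. \<psi> t = \<phi> t)))"
    unfolding Let_def by (intro conjI well_posedness v)
qed

end
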